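(* Let $\star\in\{{\rm ABS},{\rm NOR}\}$. (i) For every $\omega>0$ there is a constant $C_\omega>0$ depending only on $\omega$ such that for all $d\in\mathbb N$ and all $\varepsilon\in(0,1)$, $$n^{\star}(\varepsilon,d;\Lambda^{\rm std})\le C_\omega\Big(n^{\star}(\varepsilon/4,d;\Lambda^{\rm all})+1\Big)^{1+\omega}.$$ (ii) For all sufficiently small $\omega>0$ and $\delta>0$ there is a constant $C_{\omega,\delta}>0$ depending only on $\omega,\delta$ such that for all $d\in\mathbb N$ and $\varepsilon\in(0,1)$, $$n^{\star}(\varepsilon,d;\Lambda^{\rm std})\le C_{\omega,\delta}\Big(n^{\star}(\varepsilon/A_\delta,d;\Lambda^{\rm all})+1\Big)^{1+\omega},\qquad A_\delta:=\Big(1+\frac{1}{12\ln(1/\delta)}\Big)^{1/2}\frac{1}{\sqrt{1-\delta}}.$$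
   Context: Setting (average case approximation). For each $d\in\mathbb N$: $D_d\subset\mathbb R^d$ is a Borel set of positive Lebesgue measure, $\rho_d$ is a probability density on $D_d$, and $G_d=L_2(D_d,\rho_d(x)\,dx)$. $F_d$ is a separable Banach space of real-valued functions on $D_d$, continuously embedded in $G_d$, such that every point evaluation $f\mapsto f(x)$, $x\in D_d$, is a continuous linear functional on $F_d$; $F_d$ carries a zero-mean Gaussian measure $\mu_d$. ${\rm APP}_d:F_d\to G_d$, ${\rm APP}_d f=f$. $\Lambda^{\rm all}$ is the class of all continuous linear functionals on $F_d$, $\Lambda^{\rm std}$ the class of point evaluations. For $\Lambda\in\{\Lambda^{\rm all},\Lambda^{\rm std}\}$, an algorithm is $A_{n,d}f=\phi_{n,d}(L_1(f),\dots,L_n(f))$ with $L_i\in\Lambda$ and $\phi_{n,d}:\mathbb R^n\to G_d$ measurable; its average case error is $e^{\rm avg}(A_{n,d})=\big(\int_{F_d}\|f-A_{n,d}f\|_{G_d}^2\,\mu_d(df)\big)^{1/2}$, and $e^{\rm avg}(n,d;\Lambda)$ is the infimum of $e^{\rm avg}(A_{n,d})$ over all such algorithms using $n$ functionals from $\Lambda$ (for $n=0$, $A_{0,d}=0$). Set $\Gamma_d=(e^{\rm avg}(0,d;\Lambda))^2$ (same for both classes). Information complexity: for $\varepsilon>0$, $n^{\star}(\varepsilon,d;\Lambda)=\min\{n\ge0:\ e^{\rm avg}(n,d;\Lambda)\le\varepsilon\,{\rm CRI}_d\}$, where ${\rm CRI}_d=1$ for $\star={\rm ABS}$ (absolute error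 criterion) and ${\rm CRI}_d=\sqrt{\Gamma_d}$ for $\star={\rm NOR}$ (normalized error criterion). *)

theory Defs
  imports "HOL-Probability.Probability"
begin

text \<open>Points of R^d are modelled as extensional functions nat => real
  (coordinates 0..d-1, value undefined elsewhere); functions on D_d are
  modelled as functions (nat => real) => real vanishing outside D_d.\<close>

type_synonym point = "nat \<Rightarrow> real"
type_synonym fn = "point \<Rightarrow> real"

definition lebd :: "nat \<Rightarrow> point measure" where
  "lebd d = completion (PiM {..<d} (\<lambda>_. lborel))"

text \<open>The measure rho(x) dx on D, defining G_d = L_2(D, rho(x) dx).\<close>
definition Gmeas :: "nat \<Rightarrow> point set \<Rightarrow> (point \<Rightarrow> real) \<Rightarrow> point measure" where
  "Gmeas d D \<rho> = density (restrict_space (lebd d) D) (\<lambda>x. ennreal (\<rho> x))"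

definition L2sq :: "nat \<Rightarrow> point set \<Rightarrow> (point \<Rightarrow> real) \<Rightarrow> fn \<Rightarrow> ennreal" where
  "L2sq d D \<rho> h = (\<integral>\<^sup>+ x. ennreal ((h x)\<^sup>2) \<partial>Gmeas d D \<rho>)"

definition banach_fn_space :: "point set \<Rightarrow> fn set \<Rightarrow> (fn \<Rightarrow> real) \<Rightarrow> bool" where
  "banach_fn_space D F nF \<longleftrightarrow>
     F \<subseteq> {f. \<forall>x. x \<notin> D \<longrightarrow> f x = 0} \<and>
     (\<lambda>_. 0) \<in> F \<and>
     (\<forall>f\<in>F. \<forall>g\<in>F. (\<lambda>x. f x + g x) \<in> F) \<and>
     (\<forall>c. \<forall>f\<in>F. (\<lambda>x. c * f x) \<in> F) \<and>
     (\<forall>f\<in>F. 0 \<le> nF f \<and> (nF f = 0 \<longleftrightarrow> f = (\<lambda>_. 0))) \<and>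
     (\<forall>c. \<forall>f\<in>F. nF (\<lambda>x. c * f x) = \<bar>c\<bar> * nF f) \<and>
     (\<forall>f\<in>F. \<forall>g\<in>F. nF (\<lambda>x. f x + g x) \<le> nF f + nF g) \<and>
     (\<forall>s. (\<forall>k. s k \<in> F) \<longrightarrow>
          (\<forall>e>0. \<exists>N. \<forall>m\<ge>N. \<forall>k\<ge>N. nF (\<lambda>x. s m x - s k x) < e) \<longrightarrow>
          (\<exists>f\<in>F. (\<lambda>k. nF (\<lambda>x. s k x - f x)) \<longlonglongrightarrow> 0)) \<and>
     (\<exists>S. countable S \<and> S \<subseteq> F \<and>
          (\<forall>f\<in>F. \<forall>e>0. \<exists>s\<in>S. nF (\<lambda>x. f x - s x) < e))"

definition norm_open_sets :: "fn set \<Rightarrow> (fn \<Rightarrow> real) \<Rightarrow> fn set set" where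
  "norm_open_sets F nF =
     {U. U \<subseteq> F \<and> (\<forall>f\<in>U. \<exists>r>0. \<forall>g\<in>F. nF (\<lambda>x. g x - f x) < r \<longrightarrow> g \<in> U)}"

definition cont_lin_fun :: "fn set \<Rightarrow> (fn \<Rightarrow> real) \<Rightarrow> (fn \<Rightarrow> real) \<Rightarrow> bool" where
  "cont_lin_fun F nF L \<longleftrightarrow>
     (\<forall>f\<in>F. \<forall>g\<in>F. L (\<lambda>x. f x + g x) = L f + L g) \<and>
     (\<forall>c. \<forall>f\<in>F. L (\<lambda>x. c * f x) = c * L f) \<and>
     (\<exists>C. \<forall>f\<in>F. \<bar>L f\<bar> \<le> C * nF f)"

definition Lambda_all :: "fn set \<Rightarrow> (fn \<Rightarrow> real) \<Rightarrow> (fn \<Rightarrow> real) set" where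
  "Lambda_all F nF = {L. cont_lin_fun F nF L}"

definition Lambda_std :: "point set \<Rightarrow> (fn \<Rightarrow> real) set" where
  "Lambda_std D = {(\<lambda>f. f x) | x. x \<in> D}"

definition zero_mean_gaussian :: "fn set \<Rightarrow> (fn \<Rightarrow> real) \<Rightarrow> fn measure \<Rightarrow> bool" where
  "zero_mean_gaussian F nF \<mu> \<longleftrightarrow>
     prob_space \<mu> \<and> space \<mu> = F \<and> sets \<mu> = sigma_sets F (norm_open_sets F nF) \<and>
     (\<forall>L. cont_lin_fun F nF L \<longrightarrow>
        (AE f in \<mu>. L f = 0) \<or>
        (\<exists>\<sigma>>0. distributed \<mu> lborel L (normal_density 0 \<sigma>)))"

definition avg_setting ::
  "nat \<Rightarrow> point set \<Rightarrow> (point \<Rightarrow> real) \<Rightarrow> fn set \<Rightarrow> (fn \<Rightarrow> real) \<Rightarrow> fn measure \<Rightarrow> bool" where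
  "avg_setting d D \<rho> F nF \<mu> \<longleftrightarrow>
     D \<in> sets (PiM {..<d} (\<lambda>_. lborel)) \<and>
     emeasure (lebd d) D > 0 \<and>
     \<rho> \<in> borel_measurable (restrict_space (lebd d) D) \<and>
     (\<forall>x\<in>D. 0 \<le> \<rho> x) \<and>
     (\<integral>\<^sup>+ x. ennreal (\<rho> x) \<partial>restrict_space (lebd d) D) = 1 \<and>
     banach_fn_space D F nF \<and>
     \<comment> \<open>continuous (injective) embedding F into G\<close>
     (\<forall>f\<in>F. f \<in> borel_measurable (restrict_space (lebd d) D)) \<and>
     (\<exists>C. \<forall>f\<in>F. L2sq d D \<rho> f \<le> ennreal (C * (nF f)\<^sup>2)) \<and>
     (\<forall>f\<in>F. L2sq d D \<rho> f = 0 \<longrightarrow> f = (\<lambda>_. 0)) \<and>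
     \<comment> \<open>point evaluations are continuous\<close>
     (\<forall>x\<in>D. \<exists>C. \<forall>f\<in>F. \<bar>f x\<bar> \<le> C * nF f) \<and>
     zero_mean_gaussian F nF \<mu>"

text \<open>Algorithms using n functionals from Lam: functionals Ls 0..n-1 in Lam
  and a measurable phi : R^n -> G_d (given as a jointly measurable function
  of data y and point x).\<close>
definition algorithms ::
  "nat \<Rightarrow> point set \<Rightarrow> (fn \<Rightarrow> real) set \<Rightarrow> nat \<Rightarrow>
   ((nat \<Rightarrow> fn \<Rightarrow> real) \<times> (point \<Rightarrow> point \<Rightarrow> real)) set" where
  "algorithms d D Lam n =
     {(Ls, \<phi>). (\<forall>i<n. Ls i \<in> Lam) \<and>
        case_prod \<phi> \<in> borel_measurable
          (PiM {..<n} (\<lambda>_. lborel) \<Otimes>\<^sub>M restrict_space (lebd d) D)}"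

definition alg_err2 ::
  "nat \<Rightarrow> point set \<Rightarrow> (point \<Rightarrow> real) \<Rightarrow> fn measure \<Rightarrow> nat \<Rightarrow>
   (nat \<Rightarrow> fn \<Rightarrow> real) \<Rightarrow> (point \<Rightarrow> point \<Rightarrow> real) \<Rightarrow> ennreal" where
  "alg_err2 d D \<rho> \<mu> n Ls \<phi> =
     (\<integral>\<^sup>+ f. L2sq d D \<rho> (\<lambda>x. f x - \<phi> (\<lambda>i\<in>{..<n}. Ls i f) x) \<partial>\<mu>)"

text \<open>(e^avg(n,d;Lam))^2; for n = 0 the zero algorithm is used.\<close>
definition avg_err2 ::
  "nat \<Rightarrow> point set \<Rightarrow> (point \<Rightarrow> real) \<Rightarrow> fn measure \<Rightarrow> (fn \<Rightarrow> real) set \<Rightarrow> nat \<Rightarrow> ennreal" where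
  "avg_err2 d D \<rho> \<mu> Lam n =
     (if n = 0 then (\<integral>\<^sup>+ f. L2sq d D \<rho> f \<partial>\<mu>)
      else (INF A \<in> algorithms d D Lam n. alg_err2 d D \<rho> \<mu> n (fst A) (snd A)))"

datatype criterion = ABS | NOR

definition CRI2 ::
  "criterion \<Rightarrow> nat \<Rightarrow> point set \<Rightarrow> (point \<Rightarrow> real) \<Rightarrow> fn measure \<Rightarrow> ennreal" where
  "CRI2 c d D \<rho> \<mu> = (case c of ABS \<Rightarrow> 1 | NOR \<Rightarrow> avg_err2 d D \<rho> \<mu> {} 0)"

definition info_compl ::
  "criterion \<Rightarrow> real \<Rightarrow> nat \<Rightarrow> point set \<Rightarrow> (point \<Rightarrow> real) \<Rightarrow> fn measure \<Rightarrow>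
   (fn \<Rightarrow> real) set \<Rightarrow> nat" where
  "info_compl c \<epsilon> d D \<rho> \<mu> Lam =
     (LEAST n. avg_err2 d D \<rho> \<mu> Lam n \<le> ennreal (\<epsilon>\<^sup>2) * CRI2 c d D \<rho> \<mu>)"

definition A_delta :: "real \<Rightarrow> real" where
  "A_delta \<delta> = sqrt (1 + 1 / (12 * ln (1 / \<delta>))) * (1 / sqrt (1 - \<delta>))"

end

theory Submission
  imports Defs "Jordan_Normal_Form.Determinant"
begin

text \<open>Volume sampling. Let K(x, y) be the covariance kernel of the Gaussian measure. Draw m points
  with density proportional to the Gram determinant of K. The best linear algorithm using the values
  at x_1, ..., x_m has squared error det G(x_1, ..., x_m, x) / det G(x_1, ..., x_m) at x, so its
  average squared error under this density is the ratio of the integrals of two consecutive Gram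
  determinants. By Gaussianity, an arbitrary algorithm using r functionals is no better than the
  orthogonal projection onto their span, which splits K = K' + (rank r) with K' positive semidefinite
  and the integral of K'(x, x) a lower bound for its squared error. A linear algebra inequality bounds
  the ratio by (m + 1) / (m + 1 - 2 r) times that integral. Taking m = k r with k fixed (k = 3 already
  gives the factor 4, and k large gives factors arbitrarily close to 1), the information complexity of
  function values is at most a constant multiple of that of arbitrary functionals.\<close>

section \<open>Gram determinants\<close>

text \<open>The sampling weight is chosen to cancel the denominator of the optimal error, so the
  conditioning of the sample points never has to be controlled, and an averaging argument then
  extracts one good point set. The 2 in m + 1 - 2 r comes from estimating (1 - t)^2 by 1 - 2 t. With
  m = 2 r the factor would be 2 r + 1 and grow with r, which is why k starts at 3. Four obstacles
  shape the rest. Gram determinants may vanish, and semidefiniteness must then show that fewer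
  points already do. The definition of the Gaussian measure speaks only of one-dimensional laws, so
  the independence behind the optimality of the projection is derived from linear combinations of
  functionals through characteristic functions. Finiteness of the integral of K(x, x) is not assumed
  and has to come from Gaussian fourth moments. Finally, \<open>info_compl\<close> is a LEAST, which
  is informative only once some n is known to reach the required error; for arbitrary functionals a
  density argument provides it.\<close>

definition gram_mat :: "('a \<Rightarrow> 'a \<Rightarrow> real) \<Rightarrow> nat \<Rightarrow> (nat \<Rightarrow> 'a) \<Rightarrow> real mat" where
  "gram_mat K n X = Matrix.mat n n (\<lambda>(i, j). K (X i) (X j))"

definition gram_det :: "('a \<Rightarrow> 'a \<Rightarrow> real) \<Rightarrow> nat \<Rightarrow> (nat \<Rightarrow> 'a) \<Rightarrow> real" where
  "gram_det K n X = Determinant.det (gram_mat K n X)"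

definition quad_form :: "('a \<Rightarrow> 'a \<Rightarrow> real) \<Rightarrow> nat \<Rightarrow> (nat \<Rightarrow> 'a) \<Rightarrow> (nat \<Rightarrow> real) \<Rightarrow> (nat \<Rightarrow> real) \<Rightarrow> real" where
  "quad_form K n X c d = (\<Sum>i<n. \<Sum>j<n. c i * d j * K (X i) (X j))"

text \<open>Nonnegative real quadratic forms do not force symmetry, hence the separate clause. The
  points \<open>X i\<close> may repeat.\<close>

definition psd_on :: "'a set \<Rightarrow> ('a \<Rightarrow> 'a \<Rightarrow> real) \<Rightarrow> bool" where
  "psd_on S K \<longleftrightarrow> (\<forall>x\<in>S. \<forall>y\<in>S. K x y = K y x) \<and>
     (\<forall>n X c. (\<forall>i<n. X i \<in> S) \<longrightarrow> 0 \<le> quad_form K n X c c)"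

lemma gram_mat_carrier [simp]: "gram_mat K n X \<in> carrier_mat n n"
  by (simp add: gram_mat_def)

lemma gram_mat_index [simp]: "i < n \<Longrightarrow> j < n \<Longrightarrow> gram_mat K n X $$ (i, j) = K (X i) (X j)"
  by (simp add: gram_mat_def)

lemma psd_on_sym: "psd_on S K \<Longrightarrow> x \<in> S \<Longrightarrow> y \<in> S \<Longrightarrow> K x y = K y x"
  by (simp add: psd_on_def)

lemma psd_on_quad_form: "psd_on S K \<Longrightarrow> (\<And>i. i < n \<Longrightarrow> X i \<in> S) \<Longrightarrow> 0 \<le> quad_form K n X c c"
  by (simp add: psd_on_def)

lemma psd_on_diag: "psd_on S K \<Longrightarrow> x \<in> S \<Longrightarrow> 0 \<le> K x x"
  using psd_on_quad_form[of S K 1 "\<lambda>_. x" "\<lambda>_. 1"] by (simp add: quad_form_def)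

lemma quad_form_sym:
  assumes "psd_on S K" "\<And>i. i < n \<Longrightarrow> X i \<in> S"
  shows "quad_form K n X c d = quad_form K n X d c"
  unfolding quad_form_def
  by (subst sum.swap) (auto intro!: sum.cong simp: psd_on_sym[OF assms(1) assms(2) assms(2)])

text \<open>The polynomial is smallest at t = - b / c. This abstract Cauchy-Schwarz inequality
  serves both semidefinite kernels and the L_2 product \<open>inner_G\<close>.\<close>

lemma discriminant_le:
  fixes a b c :: real
  assumes "\<And>t. 0 \<le> a + 2 * t * b + t\<^sup>2 * c" "0 \<le> c"
  shows "b\<^sup>2 \<le> a * c"
proof (cases "c = 0")
  case True
  have "b = 0"
  proof (rule ccontr)
    assume "b \<noteq> 0"
    \<comment> \<open>With c = 0 the polynomial is affine in t, and the t used here gives it the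
      value -1.\<close>
    then show False
      using assms(1)[of "- (a + 1) / (2 * b)"] True by (simp add: field_simps)
  qed
  then show ?thesis using True by simp
next
  case False
  then have "0 < c" using assms(2) by simp
  then show ?thesis
    using assms(1)[of "- b / c"]
    by (simp add: field_simps power2_eq_square)
qed

lemma quad_form_Cauchy_Schwarz:
  assumes "psd_on S K" "\<And>i. i < n \<Longrightarrow> X i \<in> S"
  shows "(quad_form K n X c d)\<^sup>2 \<le> quad_form K n X c c * quad_form K n X d d"
proof (rule discriminant_le)
  fix t
  have "quad_form K n X (\<lambda>i. c i + t * d i) (\<lambda>i. c i + t * d i)
      = quad_form K n X c c + t * quad_form K n X c d + t * quad_form K n X d c + t\<^sup>2 * quad_form K n X d d"
    unfolding quad_form_def
    by (simp add: sum.distrib sum_distrib_left algebra_simps power2_eq_square)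
  moreover have "0 \<le> quad_form K n X (\<lambda>i. c i + t * d i) (\<lambda>i. c i + t * d i)"
    by (rule psd_on_quad_form[OF assms])
  moreover have "quad_form K n X c d = quad_form K n X d c"
    by (rule quad_form_sym[OF assms])
  ultimately show "0 \<le> quad_form K n X c c + 2 * t * quad_form K n X c d + t\<^sup>2 * quad_form K n X d d"
    by simp
qed (rule psd_on_quad_form[OF assms])

text \<open>A Schur complement by one column operation: subtracting the combination \<open>a\<close>
  of the first n columns clears the last column except for its bottom entry, and Laplace expansion
  along that column finishes. Invertibility of the Gram matrix is replaced by a solution
  \<open>a\<close> of the normal equations.\<close>

lemma gram_det_bordered:
  assumes sym: "\<And>i. i < n \<Longrightarrow> K (X i) x = K x (X i)"
    and a: "\<And>i. i < n \<Longrightarrow> (\<Sum>j<n. K (X i) (X j) * a j) = K (X i) x"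
  shows "gram_det K (Suc n) (X(n := x)) = gram_det K n X * (K x x - (\<Sum>j<n. K x (X j) * a j))"
proof -
  define G where "G = gram_mat K (Suc n) (X(n := x))"
  \<comment> \<open>Right multiplication by \<open>U\<close> performs the column operation; being
    unit triangular, it has determinant 1.\<close>
  define U where "U = Matrix.mat (Suc n) (Suc n) (\<lambda>(i, j). if i = j then 1 else if j = n then - a i else (0::real))"
  have GC: "G \<in> carrier_mat (Suc n) (Suc n)" and UC: "U \<in> carrier_mat (Suc n) (Suc n)"
    by (simp_all add: G_def U_def)
  have "upper_triangular U"
    by (auto simp: U_def)
  then have "Determinant.det U = prod_list (diag_mat U)"
    using det_upper_triangular UC by blast
  also have "\<dots> = 1"
    unfolding prod_list_diag_prod by (simp add: U_def)
  finally have detU: "Determinant.det U = 1" .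
  have GU: "(G * U) $$ (i, j) = (\<Sum>k<Suc n. G $$ (i, k) * U $$ (k, j))" if "i < Suc n" "j < Suc n" for i j
    using that GC UC by (simp add: scalar_prod_def atLeast0LessThan)
  have col: "(G * U) $$ (i, n) = (if i = n then K x x - (\<Sum>j<n. K x (X j) * a j) else 0)" if "i < Suc n" for i
  proof -
    have "(G * U) $$ (i, n) = (\<Sum>k<n. G $$ (i, k) * U $$ (k, n)) + G $$ (i, n) * U $$ (n, n)"
      using GU[OF that, of n] by simp
    also have "\<dots> = G $$ (i, n) - (\<Sum>k<n. G $$ (i, k) * a k)"
      by (simp add: U_def sum_negf)
    also have "\<dots> = (if i = n then K x x - (\<Sum>j<n. K x (X j) * a j) else 0)"
      using that a[of i] by (auto simp: G_def)
    finally show ?thesis .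
  qed
  have minor: "mat_delete (G * U) n n = gram_mat K n X"
  proof (rule eq_matI)
    fix i j assume ij: "i < dim_row (gram_mat K n X)" "j < dim_col (gram_mat K n X)"
    then have ij: "i < n" "j < n" by (simp_all add: gram_mat_def)
    have "mat_delete (G * U) n n $$ (i, j) = (G * U) $$ (i, j)"
      using ij GC UC by (simp add: mat_delete_def)
    also have "\<dots> = (\<Sum>k<Suc n. if k = j then G $$ (i, j) else 0)"
    proof -
      have "(G * U) $$ (i, j) = (\<Sum>k<Suc n. G $$ (i, k) * U $$ (k, j))"
        using ij by (intro GU) auto
      also have "\<dots> = (\<Sum>k<Suc n. if k = j then G $$ (i, j) else 0)"
        by (rule sum.cong) (use ij in \<open>auto simp: U_def\<close>)
      finally show ?thesis .
    qed
    also have "\<dots> = gram_mat K n X $$ (i, j)"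
      using ij by (simp add: G_def)
    finally show "mat_delete (G * U) n n $$ (i, j) = gram_mat K n X $$ (i, j)" .
  qed (use GC UC in \<open>auto simp: gram_mat_def\<close>)
  have "gram_det K (Suc n) (X(n := x)) = Determinant.det (G * U)"
    using det_mult[OF GC UC] detU by (simp add: gram_det_def G_def)
  also have "\<dots> = (\<Sum>i<Suc n. (G * U) $$ (i, n) * cofactor (G * U) i n)"
    by (rule laplace_expansion_column) (use GC UC in auto)
  also have "\<dots> = (K x x - (\<Sum>j<n. K x (X j) * a j)) * cofactor (G * U) n n"
    using col by simp
  also have "cofactor (G * U) n n = gram_det K n X"
    by (simp add: cofactor_def minor gram_det_def)
  finally show ?thesis by (simp only: mult.commute)
qed

text \<open>The map \<^term>\<open>insert_index i\<close> enumerates the natural numbers other than \<^term>\<open>i\<close>.\<close>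

lemma gram_inverse:
  assumes "gram_det K n X \<noteq> 0"
  obtains B where
    "\<And>i j. i < n \<Longrightarrow> j < n \<Longrightarrow> (\<Sum>k<n. K (X i) (X k) * B k j) = (if i = j then 1 else (0::real))"
    "\<And>i j. i < n \<Longrightarrow> j < n \<Longrightarrow> (\<Sum>k<n. B i k * K (X k) (X j)) = (if i = j then 1 else 0)"
    "\<And>i. i < n \<Longrightarrow> B i i = gram_det K (n - 1) (\<lambda>j. X (insert_index i j)) / gram_det K n X"
proof -
  define G where "G = gram_mat K n X"
  define B where "B i j = adj_mat G $$ (i, j) / gram_det K n X" for i j
  have GC: "G \<in> carrier_mat n n" by (simp add: G_def)
  note adj = adj_mat[OF GC]
  have det: "Determinant.det G = gram_det K n X" by (simp add: G_def gram_det_def)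
  \<comment> \<open>Cramer's rule: the diagonal of the inverse is a principal minor over the
    determinant, with sign (-1)^(i + i) = 1, and deleting row and column i of a Gram matrix means
    deleting the point \<open>X i\<close>.\<close>
  have 3: "B i i = gram_det K (n - 1) (\<lambda>j. X (insert_index i j)) / gram_det K n X" if i: "i < n" for i
  proof -
    have "B i i = cofactor G i i / gram_det K n X"
      using i GC by (simp add: B_def adj_mat_def)
    also have "mat_delete G i i = gram_mat K (n - 1) (\<lambda>j. X (insert_index i j))"
      by (rule eq_matI) (use i GC in \<open>auto simp: mat_delete_def gram_mat_def G_def insert_index_def\<close>)
    then have "cofactor G i i = gram_det K (n - 1) (\<lambda>j. X (insert_index i j))"
      by (simp add: cofactor_def gram_det_def flip: power_add mult_2)
    finally show ?thesis .
  qed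
  have 1: "(\<Sum>k<n. K (X i) (X k) * B k j) = (if i = j then 1 else (0::real))"
    and 2: "(\<Sum>k<n. B i k * K (X k) (X j)) = (if i = j then 1 else 0)" if i: "i < n" and j: "j < n" for i j
  proof -
    have "(G * adj_mat G) $$ (i, j) = (\<Sum>k<n. K (X i) (X k) * adj_mat G $$ (k, j))"
      using i j GC adj(1) by (simp add: scalar_prod_def atLeast0LessThan) (simp add: G_def)
    moreover have "(G * adj_mat G) $$ (i, j) = (if i = j then gram_det K n X else 0)"
      using i j by (simp add: adj(2) det)
    ultimately show "(\<Sum>k<n. K (X i) (X k) * B k j) = (if i = j then 1 else (0::real))"
      using assms by (cases "i = j") (auto simp: B_def simp flip: sum_divide_distrib)
    have "(adj_mat G * G) $$ (i, j) = (\<Sum>k<n. adj_mat G $$ (i, k) * K (X k) (X j))"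
      using i j GC adj(1) by (simp add: scalar_prod_def atLeast0LessThan) (simp add: G_def)
    moreover have "(adj_mat G * G) $$ (i, j) = (if i = j then gram_det K n X else 0)"
      using i j by (simp add: adj(3) det)
    ultimately show "(\<Sum>k<n. B i k * K (X k) (X j)) = (if i = j then 1 else 0)"
      using assms by (cases "i = j") (auto simp: B_def simp flip: sum_divide_distrib)
  qed
  show thesis by (rule that[of B]) (fact 1 2 3)+
qed

text \<open>For general matrices a singular leading block says nothing about the next one. Here a
  kernel vector of the block, padded with 0, has vanishing quadratic form, so by Cauchy-Schwarz the
  larger matrix annihilates it too. This covers the cases in which division by the determinant is
  impossible.\<close>

lemma gram_det_eq_0_Suc:
  assumes psd: "psd_on S K" and X: "\<And>i. i < n \<Longrightarrow> X i \<in> S" and x: "x \<in> S"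
    and 0: "gram_det K n X = 0"
  shows "gram_det K (Suc n) (X(n := x)) = 0"
proof -
  obtain v where v: "v \<in> carrier_vec n" "v \<noteq> 0\<^sub>v n" "gram_mat K n X *\<^sub>v v = 0\<^sub>v n"
    using 0 det_0_iff_vec_prod_zero_field[OF gram_mat_carrier, of K n X] by (auto simp: gram_det_def)
  define Y where "Y = X(n := x)"
  have Y: "Y i \<in> S" if "i < Suc n" for i using that X x by (auto simp: Y_def less_Suc_eq)
  define c where "c i = (if i < n then vec_index v i else 0)" for i
  have Gv: "(\<Sum>j<n. K (X i) (X j) * c j) = 0" if "i < n" for i
  proof -
    have "vec_index (gram_mat K n X *\<^sub>v v) i = (\<Sum>j<n. K (X i) (X j) * vec_index v j)"
      using that v(1) by (simp add: scalar_prod_def atLeast0LessThan gram_mat_def)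
    then show ?thesis using v(3) that by (simp add: c_def)
  qed
  have qf: "quad_form K (Suc n) Y c' c = (\<Sum>i<Suc n. c' i * (\<Sum>j<n. K (Y i) (X j) * c j))" for c'
    unfolding quad_form_def by (intro sum.cong refl) (simp add: c_def Y_def sum_distrib_left mult_ac)
  have "quad_form K (Suc n) Y c c = 0"
    unfolding qf using Gv by (simp add: c_def Y_def)
  \<comment> \<open>Pairing with the last unit vector reads off the new row applied to
    \<open>c\<close>; Cauchy-Schwarz bounds its square by a multiple of the vanishing form.\<close>
  moreover have "quad_form K (Suc n) Y (\<lambda>i. if i = n then 1 else 0) c = (\<Sum>j<n. K x (X j) * c j)"
    unfolding qf by (simp add: Y_def)
  ultimately have Kx: "(\<Sum>j<n. K x (X j) * c j) = 0"
    using quad_form_Cauchy_Schwarz[OF psd, of "Suc n" Y "\<lambda>i. if i = n then 1 else 0" c] Y by simp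
  define w where "w = Matrix.vec (Suc n) c"
  have "gram_mat K (Suc n) Y *\<^sub>v w = 0\<^sub>v (Suc n)"
  proof (rule eq_vecI)
    fix i assume "i < dim_vec (0\<^sub>v (Suc n) :: real Matrix.vec)"
    then have i: "i < Suc n" by simp
    then have "vec_index (gram_mat K (Suc n) Y *\<^sub>v w) i = (\<Sum>j<Suc n. K (Y i) (Y j) * c j)"
      by (simp add: scalar_prod_def atLeast0LessThan gram_mat_def w_def)
    also have "\<dots> = (\<Sum>j<n. K (Y i) (X j) * c j)"
      by (simp add: c_def Y_def)
    also have "\<dots> = 0" using i Gv Kx by (auto simp: less_Suc_eq Y_def)
    finally show "vec_index (gram_mat K (Suc n) Y *\<^sub>v w) i = vec_index (0\<^sub>v (Suc n)) i" using i by simp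
  qed (simp add: gram_mat_def)
  moreover have "w \<noteq> 0\<^sub>v (Suc n)"
  proof
    assume w0: "w = 0\<^sub>v (Suc n)"
    have "v = 0\<^sub>v n"
    proof (rule eq_vecI)
      fix i assume "i < dim_vec (0\<^sub>v n :: real Matrix.vec)"
      then have "i < n" by simp
      then have "vec_index w i = vec_index v i" by (simp add: w_def c_def)
      then show "vec_index v i = vec_index (0\<^sub>v n) i" using w0 \<open>i < n\<close> by simp
    qed (use v in auto)
    then show False using v by simp
  qed
  moreover have "w \<in> carrier_vec (Suc n)" by (simp add: w_def)
  ultimately show ?thesis
    using det_0_iff_vec_prod_zero_field[OF gram_mat_carrier, of K "Suc n" Y] by (auto simp: gram_det_def Y_def)
qed

text \<open>For a covariance kernel K this is the mean squared error of predicting f(x) by the sum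
  of the a_i f(X_i), as \<open>kriging_err_ip\<close> shows. The weights are arbitrary here;
  \<open>gram_det_Suc\<close> supplies the optimal ones.\<close>

definition kriging_err :: "('a \<Rightarrow> 'a \<Rightarrow> real) \<Rightarrow> nat \<Rightarrow> (nat \<Rightarrow> 'a) \<Rightarrow> (nat \<Rightarrow> real) \<Rightarrow> 'a \<Rightarrow> real" where
  "kriging_err K n X a x = K x x - 2 * (\<Sum>i<n. a i * K (X i) x) + (\<Sum>i<n. \<Sum>j<n. a i * a j * K (X i) (X j))"

lemma kriging_err_nonneg:
  assumes psd: "psd_on S K" and X: "\<And>i. i < n \<Longrightarrow> X i \<in> S" and x: "x \<in> S"
  shows "0 \<le> kriging_err K n X a x"
proof -
  \<comment> \<open>The prediction residual, up to sign, is the combination with coefficient -1 at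
    the new point.\<close>
  have "0 \<le> quad_form K (Suc n) (X(n := x)) (a(n := -1)) (a(n := -1))"
    by (rule psd_on_quad_form[OF psd]) (use X x in \<open>auto simp: less_Suc_eq\<close>)
  also have "\<dots> = kriging_err K n X a x"
  proof -
    have "(\<Sum>i<n. a i * K x (X i)) = (\<Sum>i<n. a i * K (X i) x)"
      by (rule sum.cong) (use x X psd_on_sym[OF psd x] in auto)
    then show ?thesis
      unfolding quad_form_def kriging_err_def by (simp add: sum.distrib sum_negf sum_subtractf)
  qed
  finally show ?thesis .
qed

text \<open>With \<open>B\<close> the inverse Gram matrix the weights solve the normal equations,
  and their error is the Schur complement. \<open>B\<close> is chosen before x, so the weights are
  fixed linear combinations of the functions K (X j) and inherit their measurability. The second
  property yields Hadamard's inequality later.\<close>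

lemma gram_det_Suc:
  assumes psd: "psd_on S K" and X: "\<And>i. i < n \<Longrightarrow> X i \<in> S" and det: "gram_det K n X \<noteq> 0"
  obtains B where
    "\<And>x. x \<in> S \<Longrightarrow> gram_det K (Suc n) (X(n := x)) =
       gram_det K n X * kriging_err K n X (\<lambda>i. \<Sum>j<n. B i j * K (X j) x) x"
    "\<And>x. x \<in> S \<Longrightarrow> kriging_err K n X (\<lambda>i. \<Sum>j<n. B i j * K (X j) x) x \<le> K x x"
proof -
  obtain B where B: "\<And>i j. i < n \<Longrightarrow> j < n \<Longrightarrow> (\<Sum>k<n. K (X i) (X k) * B k j) = (if i = j then 1 else (0::real))"
    using gram_inverse[OF det] by metis
  define a where "a x i = (\<Sum>j<n. B i j * K (X j) x)" for x i
  have a: "(\<Sum>j<n. K (X i) (X j) * a x j) = K (X i) x" if "i < n" for x i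
  proof -
    have "(\<Sum>j<n. K (X i) (X j) * a x j) = (\<Sum>l<n. (\<Sum>j<n. K (X i) (X j) * B j l) * K (X l) x)"
      unfolding a_def sum_distrib_left sum_distrib_right
      by (subst sum.swap) (simp add: mult_ac)
    also have "\<dots> = (\<Sum>l<n. if i = l then K (X l) x else 0)"
      by (rule sum.cong) (use that in \<open>auto simp: B\<close>)
    finally show ?thesis using that by simp
  qed
  have quad: "(\<Sum>i<n. \<Sum>j<n. a x i * a x j * K (X i) (X j)) = (\<Sum>i<n. a x i * K (X i) x)" for x
    by (intro sum.cong refl) (simp add: a[symmetric] sum_distrib_left mult_ac)
  have err: "kriging_err K n X (a x) x = K x x - (\<Sum>j<n. K x (X j) * a x j)" if "x \<in> S" for x
  proof -
    have "(\<Sum>i<n. a x i * K (X i) x) = (\<Sum>j<n. K x (X j) * a x j)"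
      by (rule sum.cong) (use that X psd_on_sym[OF psd that] in auto)
    then show ?thesis unfolding kriging_err_def quad by simp
  qed
  show thesis
  proof
    fix x assume x: "x \<in> S"
    show "gram_det K (Suc n) (X(n := x)) =
       gram_det K n X * kriging_err K n X (\<lambda>i. \<Sum>j<n. B i j * K (X j) x) x"
    proof -
      have "gram_det K (Suc n) (X(n := x)) = gram_det K n X * (K x x - (\<Sum>j<n. K x (X j) * a x j))"
        by (rule gram_det_bordered) (use a X x psd_on_sym[OF psd] in auto)
      then show ?thesis by (simp only: err[OF x, symmetric]) (simp add: a_def[abs_def])
    qed
    have "0 \<le> quad_form K n X (a x) (a x)" by (rule psd_on_quad_form[OF psd X])
    then show "kriging_err K n X (\<lambda>i. \<Sum>j<n. B i j * K (X j) x) x \<le> K x x"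
      using quad[of x] unfolding kriging_err_def quad_form_def a_def by simp
  qed
qed

lemma gram_det_cong: "(\<And>i. i < n \<Longrightarrow> X i = Y i) \<Longrightarrow> gram_det K n X = gram_det K n Y"
  unfolding gram_det_def gram_mat_def by (rule arg_cong[where f = Determinant.det], rule eq_matI) auto

lemma gram_det_0 [simp]: "gram_det K 0 X = 1"
  by (simp add: gram_det_def gram_mat_def)

text \<open>Adding a point either keeps the determinant at 0 or multiplies it by a nonnegative
  prediction error.\<close>

lemma gram_det_nonneg:
  assumes psd: "psd_on S K" and X: "\<And>i. i < n \<Longrightarrow> X i \<in> S"
  shows "0 \<le> gram_det K n X"
  using X
proof (induction n)
  case (Suc n)
  show ?case
  proof (cases "gram_det K n X = 0")
    case True
    have "gram_det K (Suc n) (X(n := X n)) = 0"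
      by (rule gram_det_eq_0_Suc[OF psd _ _ True]) (use Suc.prems in auto)
    then show ?thesis by simp
  next
    case False
    obtain B where "\<And>x. x \<in> S \<Longrightarrow> gram_det K (Suc n) (X(n := x)) =
       gram_det K n X * kriging_err K n X (\<lambda>i. \<Sum>j<n. B i j * K (X j) x) x"
      by (rule gram_det_Suc[OF psd Suc.prems[OF less_SucI] False]) (assumption, rule that, assumption+)
    from this[of "X n"] show ?thesis
      using Suc kriging_err_nonneg[OF psd, of n X "X n"] by simp
  qed
qed simp

text \<open>Let v_i have Gram matrix K, let w_i be the dual basis and Q the projection onto the rank r part.
  The i-th quotient of Gram determinants is |w_i|^2, and |v_i - Q v_i|^2 |w_i|^2 is at least
  (1 - <Q v_i, w_i>)^2, hence at least 1 - 2 <Q v_i, w_i>. The sum of the <Q v_i, w_i> is the trace of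
  a product of two projections, one of which has rank at most r.\<close>

lemma gram_det_rank_bound:
  assumes psd: "psd_on S K" and psd': "psd_on S K'" and X: "\<And>i. i < m \<Longrightarrow> X i \<in> S"
    and dec: "\<And>x y. x \<in> S \<Longrightarrow> y \<in> S \<Longrightarrow> K x y = K' x y + (\<Sum>l<r. b l x * b l y)"
  shows "(real m - 2 * real r) * gram_det K m X
    \<le> (\<Sum>i<m. K' (X i) (X i) * gram_det K (m - 1) (\<lambda>j. X (insert_index i j)))"
proof (cases "gram_det K m X = 0")
  case True
  have "0 \<le> K' (X i) (X i) * gram_det K (m - 1) (\<lambda>j. X (insert_index i j))" if "i < m" for i
    using that X by (intro mult_nonneg_nonneg psd_on_diag[OF psd'] gram_det_nonneg[OF psd])
      (auto simp: insert_index_def)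
  then show ?thesis unfolding True mult_zero_right by (intro sum_nonneg) auto
next
  case False
  then have pos: "0 < gram_det K m X" using gram_det_nonneg[OF psd, of m X] X by simp
  obtain B where B: "\<And>i j. i < m \<Longrightarrow> j < m \<Longrightarrow> (\<Sum>k<m. K (X i) (X k) * B k j) = (if i = j then 1 else (0::real))"
    "\<And>i j. i < m \<Longrightarrow> j < m \<Longrightarrow> (\<Sum>k<m. B i k * K (X k) (X j)) = (if i = j then 1 else 0)"
    "\<And>i. i < m \<Longrightarrow> B i i = gram_det K (m - 1) (\<lambda>j. X (insert_index i j)) / gram_det K m X"
    by (rule gram_inverse[OF False]) (rule that, assumption+)
  \<comment> \<open>\<open>u l\<close> is the inverse Gram matrix applied to the values of
    \<open>b l\<close>: the coordinates, in terms of the v_i, of the projection of the l-th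
    direction of the rank r part onto their span.\<close>
  define u where "u l i = (\<Sum>k<m. B i k * b l (X k))" for l i
  have split: "quad_form K m X c d = quad_form K' m X c d
      + (\<Sum>l<r. (\<Sum>i<m. c i * b l (X i)) * (\<Sum>j<m. d j * b l (X j)))" for c d
  proof -
    have "quad_form K m X c d = (\<Sum>i<m. \<Sum>j<m. c i * d j * K' (X i) (X j) + (\<Sum>l<r. (c i * b l (X i)) * (d j * b l (X j))))"
      unfolding quad_form_def
    proof (intro sum.cong refl)
      fix i j assume "i \<in> {..<m}" "j \<in> {..<m}"
      then have "K (X i) (X j) = K' (X i) (X j) + (\<Sum>l<r. b l (X i) * b l (X j))"
        by (intro dec X) auto
      then show "c i * d j * K (X i) (X j) = c i * d j * K' (X i) (X j) + (\<Sum>l<r. (c i * b l (X i)) * (d j * b l (X j)))"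
        by (simp add: distrib_left sum_distrib_left mult_ac)
    qed
    also have "\<dots> = quad_form K' m X c d + (\<Sum>i<m. \<Sum>j<m. \<Sum>l<r. (c i * b l (X i)) * (d j * b l (X j)))"
      by (simp add: quad_form_def sum.distrib)
    also have "(\<Sum>i<m. \<Sum>j<m. \<Sum>l<r. (c i * b l (X i)) * (d j * b l (X j)))
       = (\<Sum>l<r. \<Sum>i<m. \<Sum>j<m. (c i * b l (X i)) * (d j * b l (X j)))"
    proof -
      have "(\<Sum>i<m. \<Sum>j<m. \<Sum>l<r. (c i * b l (X i)) * (d j * b l (X j)))
        = (\<Sum>i<m. \<Sum>l<r. \<Sum>j<m. (c i * b l (X i)) * (d j * b l (X j)))"
        by (intro sum.cong refl sum.swap)
      also have "\<dots> = (\<Sum>l<r. \<Sum>i<m. \<Sum>j<m. (c i * b l (X i)) * (d j * b l (X j)))"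
        by (rule sum.swap)
      finally show ?thesis .
    qed
    finally show ?thesis by (simp add: sum_product)
  qed
  have KB: "(\<Sum>j<m. K (X i) (X j) * u l j) = b l (X i)" if "i < m" for i l
  proof -
    have "(\<Sum>j<m. K (X i) (X j) * u l j) = (\<Sum>k<m. (\<Sum>j<m. K (X i) (X j) * B j k) * b l (X k))"
      unfolding u_def sum_distrib_left sum_distrib_right by (subst sum.swap) (simp add: mult_ac)
    also have "\<dots> = (\<Sum>k<m. if i = k then b l (X k) else 0)"
      by (rule sum.cong) (use that in \<open>auto simp: B\<close>)
    finally show ?thesis using that by simp
  qed
  \<comment> \<open>The squared length of that projection, hence the bound 1. The trace mentioned
    above is the sum of the \<open>q l\<close>.\<close>
  define q where "q l = (\<Sum>i<m. u l i * b l (X i))" for l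
  have q1: "q l \<le> 1" if l: "l < r" for l
  proof -
    have "quad_form K m X (u l) (u l) = (\<Sum>i<m. u l i * (\<Sum>j<m. K (X i) (X j) * u l j))"
      by (simp add: quad_form_def sum_distrib_left mult_ac)
    also have "\<dots> = q l" unfolding q_def by (intro sum.cong refl) (simp add: KB)
    finally have "q l = quad_form K m X (u l) (u l)" by simp
    also have "\<dots> \<ge> (\<Sum>l'<r. (\<Sum>i<m. u l i * b l' (X i)) * (\<Sum>j<m. u l j * b l' (X j)))"
      unfolding split using psd_on_quad_form[OF psd', of m X "u l"] X by simp
    \<comment> \<open>Keeping only the summand l' = l gives
      \<open>q l * q l \<le> q l\<close>.\<close>
    also have "(\<Sum>l'<r. (\<Sum>i<m. u l i * b l' (X i)) * (\<Sum>j<m. u l j * b l' (X j))) \<ge> q l * q l"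
      using member_le_sum[of l "{..<r}" "\<lambda>l'. (\<Sum>i<m. u l i * b l' (X i)) * (\<Sum>j<m. u l j * b l' (X j))"] l
      by (simp add: q_def)
    finally have "q l * q l \<le> q l" by linarith
    show ?thesis
    proof (rule ccontr)
      assume "\<not> q l \<le> 1"
      then have "1 * q l < q l * q l" by (intro mult_strict_right_mono) auto
      then show False using \<open>q l * q l \<le> q l\<close> by simp
    qed
  qed
  \<comment> \<open>\<open>B i\<close> holds the coordinates of the dual vector w_i and
    \<open>e\<close> those of v_i. Both are paired in K', the form of the component orthogonal to
    the rank r part.\<close>
  have key: "1 - 2 * (\<Sum>l<r. u l i * b l (X i)) \<le> K' (X i) (X i) * B i i" if i: "i < m" for i
  proof -
    define e where "e j = (if j = i then 1 else 0 :: real)" for j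
    define s where "s = (\<Sum>l<r. u l i * b l (X i))"
    have ei: "(\<Sum>j<m. e j * h j) = h i" for h
    proof -
      have "(\<Sum>j<m. e j * h j) = (\<Sum>j<m. if j = i then h j else 0)"
        by (rule sum.cong) (auto simp: e_def)
      then show ?thesis using i by simp
    qed
    have eK: "quad_form K' m X e e = K' (X i) (X i)"
    proof -
      have "quad_form K' m X e e = (\<Sum>j<m. e j * (\<Sum>k<m. e k * K' (X j) (X k)))"
        by (simp add: quad_form_def sum_distrib_left mult_ac)
      then show ?thesis by (simp add: ei)
    qed
    have BB: "quad_form K m X (B i) (B i) = B i i"
    proof -
      have "quad_form K m X (B i) (B i) = (\<Sum>j<m. (\<Sum>k<m. B i k * K (X k) (X j)) * B i j)"
        unfolding quad_form_def sum_distrib_right by (subst sum.swap) (simp add: mult_ac)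
      also have "\<dots> = (\<Sum>j<m. if i = j then B i j else 0)"
        by (rule sum.cong) (use i in \<open>auto simp: B\<close>)
      finally show ?thesis using i by simp
    qed
    have Be: "quad_form K m X (B i) e = 1"
    proof -
      have "quad_form K m X (B i) e = (\<Sum>j<m. e j * (\<Sum>k<m. B i k * K (X k) (X j)))"
        unfolding quad_form_def sum_distrib_left by (subst sum.swap) (simp add: mult_ac)
      then show ?thesis using i by (simp add: ei B)
    qed
    have **: "quad_form K' m X (B i) e = 1 - s"
      using split[of "B i" e] Be by (simp add: ei s_def u_def)
    have "quad_form K' m X (B i) (B i) \<le> B i i"
      using split[of "B i" "B i"] BB sum_nonneg[of "{..<r}" "\<lambda>l. (\<Sum>k<m. B i k * b l (X k)) * (\<Sum>k<m. B i k * b l (X k))"]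
      by simp
    have *: "(quad_form K' m X (B i) e)\<^sup>2 \<le> quad_form K' m X (B i) (B i) * quad_form K' m X e e"
      by (rule quad_form_Cauchy_Schwarz[OF psd' X])
    have "0 \<le> K' (X i) (X i)" using psd_on_diag[OF psd'] X i by simp
    have "(1 - s)\<^sup>2 \<le> K' (X i) (X i) * B i i"
    proof -
      have "(1 - s)\<^sup>2 \<le> quad_form K' m X (B i) (B i) * K' (X i) (X i)"
        using * by (simp only: eK **)
      also have "\<dots> \<le> B i i * K' (X i) (X i)"
        by (rule mult_right_mono) fact+
      finally show ?thesis by (simp only: mult.commute)
    qed
    moreover have "1 - 2 * s \<le> (1 - s)\<^sup>2" by (simp add: power2_eq_square algebra_simps)
    ultimately show ?thesis by (simp add: s_def)
  qed
  have "real m - 2 * real r \<le> real m - 2 * (\<Sum>l<r. q l)"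
    using sum_mono[of "{..<r}" q "\<lambda>_. 1"] q1 by simp
  \<comment> \<open>The trace is summed over directions before this step and over points after
    it.\<close>
  also have "\<dots> = (\<Sum>i<m. 1 - 2 * (\<Sum>l<r. u l i * b l (X i)))"
    unfolding q_def by (subst sum.swap) (simp add: sum_subtractf sum_distrib_left)
  also have "\<dots> \<le> (\<Sum>i<m. K' (X i) (X i) * B i i)"
    by (rule sum_mono) (use key in simp)
  also have "\<dots> = (\<Sum>i<m. K' (X i) (X i) * gram_det K (m - 1) (\<lambda>j. X (insert_index i j))) / gram_det K m X"
    unfolding sum_divide_distrib
    by (rule sum.cong[OF refl]) (simp only: B(3) lessThan_iff times_divide_eq_right)
  finally show ?thesis by (simp only: pos_le_divide_eq[OF pos])
qed

section \<open>Volume sampling\<close>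

text \<open>The Leibniz formula makes the determinant a polynomial in the kernel values. The
  reindexing \<open>f\<close> allows determinants with one point left out.\<close>

lemma gram_det_measurable:
  assumes K: "case_prod K \<in> borel_measurable (N \<Otimes>\<^sub>M N)" and f: "\<And>j. j < n \<Longrightarrow> f j \<in> I"
  shows "(\<lambda>X. gram_det K n (\<lambda>j. X (f j))) \<in> borel_measurable (PiM I (\<lambda>_. N))"
proof -
  have eq: "gram_det K n (\<lambda>j. X (f j)) = (\<Sum>p\<in>{p. p permutes {0..<n}}. signof p * (\<Prod>i=0..<n. K (X (f i)) (X (f (p i)))))" for X
    unfolding gram_det_def det_def'[OF gram_mat_carrier]
  proof (intro sum.cong refl arg_cong2[where f = "(*)"] prod.cong)
    fix p i assume "p \<in> {p. p permutes {0..<n}}" "i \<in> {0..<n}"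
    then have "i < n" "p i < n" using permutes_in_image[of p "{0..<n}" i] by auto
    then show "gram_mat K n (\<lambda>j. X (f j)) $$ (i, p i) = K (X (f i)) (X (f (p i)))" by simp
  qed
  have "(\<lambda>X. K (X (f i)) (X (f j))) \<in> borel_measurable (PiM I (\<lambda>_. N))" if "i < n" "j < n" for i j
  proof -
    have [measurable]: "(\<lambda>X. X (f i)) \<in> PiM I (\<lambda>_. N) \<rightarrow>\<^sub>M N" "(\<lambda>X. X (f j)) \<in> PiM I (\<lambda>_. N) \<rightarrow>\<^sub>M N"
      using f that by (auto intro: measurable_component_singleton)
    have "(\<lambda>X. case_prod K (X (f i), X (f j))) \<in> borel_measurable (PiM I (\<lambda>_. N))"
      by (rule measurable_compose[OF _ K]) measurable
    then show ?thesis by simp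
  qed
  then show ?thesis
    unfolding eq
    apply (intro borel_measurable_sum borel_measurable_times borel_measurable_const borel_measurable_prod)
    using permutes_in_image by fastforce
qed

text \<open>This removes the randomness: if h / w has mean at most c under the density proportional
  to w, then h / w is at most c at some point of positive density. Otherwise c w < h wherever w is
  nonzero, which would make the integrals strictly ordered.\<close>

lemma nn_integral_ratio_witness:
  fixes h w :: "'a \<Rightarrow> ennreal"
  assumes [measurable]: "h \<in> borel_measurable M" "w \<in> borel_measurable M"
    and le: "integral\<^sup>N M h \<le> c * integral\<^sup>N M w" and w: "integral\<^sup>N M w \<noteq> 0" "integral\<^sup>N M w < \<infinity>"
  shows "\<exists>x\<in>space M. w x \<noteq> 0 \<and> h x \<le> c * w x"
proof (rule ccontr)
  assume neg: "\<not> ?thesis"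
  then have lt: "c * w x < h x" if "x \<in> space M" "w x \<noteq> 0" for x
    using that not_le by blast
  have w_nz: "\<not> (AE x in M. w x = 0)"
    using w(1) nn_integral_0_iff_AE[of w M] by simp
  have "\<exists>x\<in>space M. w x \<noteq> 0"
    using w_nz by (rule contrapos_np) (intro AE_I2, auto)
  then obtain x where x: "x \<in> space M" "w x \<noteq> 0" by blast
  \<comment> \<open>Strictness of the integral inequality needs c w to have a finite integral; the
    strict bound at one point with nonzero w already excludes an infinite c.\<close>
  have "c \<noteq> \<infinity>"
    using lt[OF x] x(2) by (auto simp: ennreal_mult_eq_top_iff ennreal_top_mult)
  then have cw: "(\<integral>\<^sup>+x. c * w x \<partial>M) \<noteq> \<infinity>"
    using w(2) by (simp add: nn_integral_cmult ennreal_mult_eq_top_iff less_top)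
  have le': "AE x in M. c * w x \<le> h x"
  proof (rule AE_I2)
    fix x assume "x \<in> space M"
    then show "c * w x \<le> h x" using lt[of x] by (cases "w x = 0") auto
  qed
  have "\<not> (AE x in M. h x \<le> c * w x)"
  proof
    assume "AE x in M. h x \<le> c * w x"
    then have "AE x in M. w x = 0"
      by (rule AE_mp) (use lt leD in \<open>auto intro!: AE_I2\<close>)
    then show False using w_nz by simp
  qed
  then have "(\<integral>\<^sup>+x. c * w x \<partial>M) < integral\<^sup>N M h"
    by (intro nn_integral_less cw le') auto
  then show False using le by (simp add: nn_integral_cmult)
qed

text \<open>The normalizing constant of the volume sampling density on n points.\<close>

definition gram_int :: "'a measure \<Rightarrow> ('a \<Rightarrow> 'a \<Rightarrow> real) \<Rightarrow> nat \<Rightarrow> ennreal" where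
  "gram_int N K n = (\<integral>\<^sup>+X. ennreal (gram_det K n X) \<partial>PiM {..<n} (\<lambda>_. N))"

locale sampling = prob_space N for N :: "'a measure" +
  fixes K :: "'a \<Rightarrow> 'a \<Rightarrow> real"
  assumes K_meas: "case_prod K \<in> borel_measurable (N \<Otimes>\<^sub>M N)"
    and K_psd: "psd_on (space N) K"
    and K_finite: "(\<integral>\<^sup>+x. ennreal (K x x) \<partial>N) < \<infinity>"
begin

sublocale P: product_prob_space "\<lambda>_::nat. N" UNIV
  by unfold_locales

lemma gram_det_measurable' [measurable]:
  "(\<lambda>X. gram_det K n X) \<in> borel_measurable (PiM {..<n} (\<lambda>_. N))"
  using gram_det_measurable[OF K_meas, of n "\<lambda>j. j" "{..<n}"] by simp

lemma K_diag_measurable [measurable]: "(\<lambda>x. K x x) \<in> borel_measurable N"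
  using measurable_compose[OF _ K_meas, of "\<lambda>x. (x, x)" N] by simp

lemma gram_det_upd_measurable:
  "(\<lambda>(X, x). gram_det K (Suc n) (X(n := x))) \<in> borel_measurable (PiM {..<n} (\<lambda>_. N) \<Otimes>\<^sub>M N)"
proof -
  have "(\<lambda>(X, x). X(n := x)) \<in> PiM {..<n} (\<lambda>_. N) \<Otimes>\<^sub>M N \<rightarrow>\<^sub>M PiM {..<Suc n} (\<lambda>_. N)"
    using measurable_add_dim[of n "{..<n}" "\<lambda>_. N"] by (simp add: lessThan_Suc)
  from measurable_compose[OF this gram_det_measurable'] show ?thesis
    by (simp add: case_prod_unfold)
qed

lemma gram_det_upd_measurable2 [measurable]:
  "X \<in> space (PiM {..<n} (\<lambda>_. N)) \<Longrightarrow> (\<lambda>x. gram_det K (Suc n) (X(n := x))) \<in> borel_measurable N"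
  using measurable_compose[OF _ gram_det_upd_measurable, of "\<lambda>x. (X, x)" N n] by simp

lemma gram_int_Suc:
  "gram_int N K (Suc n) = (\<integral>\<^sup>+X. \<integral>\<^sup>+x. ennreal (gram_det K (Suc n) (X(n := x))) \<partial>N \<partial>PiM {..<n} (\<lambda>_. N))"
  unfolding gram_int_def lessThan_Suc
  by (rule P.product_nn_integral_insert) (use gram_det_measurable'[of "Suc n"] in \<open>auto simp: lessThan_Suc\<close>)

lemma space_PiM_D: "X \<in> space (PiM {..<n} (\<lambda>_. N)) \<Longrightarrow> i < n \<Longrightarrow> X i \<in> space N"
  by (auto simp: space_PiM)

text \<open>Hadamard's inequality one point at a time: a new point x multiplies the determinant by
  at most K(x, x), whose integral is finite.\<close>

lemma gram_int_finite: "gram_int N K n < \<infinity>"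
proof (induction n)
  case 0
  then show ?case by (simp add: gram_int_def PiM_empty emeasure_space_1 P.emeasure_space_1)
next
  case (Suc n)
  have "gram_int N K (Suc n) \<le> (\<integral>\<^sup>+X. \<integral>\<^sup>+x. ennreal (gram_det K n X) * ennreal (K x x) \<partial>N \<partial>PiM {..<n} (\<lambda>_. N))"
    unfolding gram_int_Suc
  proof (intro nn_integral_mono)
    fix X x assume X: "X \<in> space (PiM {..<n} (\<lambda>_. N))" and x: "x \<in> space N"
    note XS = space_PiM_D[OF X]
    have nn: "0 \<le> gram_det K n X" by (rule gram_det_nonneg[OF K_psd XS])
    have "gram_det K (Suc n) (X(n := x)) \<le> gram_det K n X * K x x"
    proof (cases "gram_det K n X = 0")
      case True
      then show ?thesis using gram_det_eq_0_Suc[OF K_psd XS x True] by simp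
    next
      case False
      show ?thesis
        by (rule gram_det_Suc[OF K_psd XS False]) (use x nn in \<open>auto intro: mult_left_mono\<close>)
    qed
    then show "ennreal (gram_det K (Suc n) (X(n := x))) \<le> ennreal (gram_det K n X) * ennreal (K x x)"
      using nn by (metis ennreal_leI ennreal_mult')
  qed
  also have "\<dots> = gram_int N K n * (\<integral>\<^sup>+x. ennreal (K x x) \<partial>N)"
    by (simp add: nn_integral_cmult nn_integral_multc gram_int_def)
  also have "\<dots> < \<infinity>"
    using Suc K_finite by (simp add: ennreal_mult_less_top)
  finally show ?case .
qed

text \<open>Once coordinate i is split off, the two factors share no variable and Fubini separates
  them.\<close>

lemma leave_one_out:
  assumes [measurable]: "\<kappa> \<in> borel_measurable N" and i: "i < Suc n"
  shows "(\<integral>\<^sup>+X. \<kappa> (X i) * ennreal (gram_det K n (\<lambda>j. X (insert_index i j))) \<partial>PiM {..<Suc n} (\<lambda>_. N))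
     = (\<integral>\<^sup>+x. \<kappa> x \<partial>N) * gram_int N K n"
proof -
  define I where "I = {..<Suc n} - {i}"
  have ins: "insert i I = {..<Suc n}" "finite I" "i \<notin> I" using i by (auto simp: I_def)
  have ii: "insert_index i j \<in> I" if "j < n" for j
    using that by (auto simp: I_def insert_index_def)
  have ne: "insert_index i j \<noteq> i" for j by (auto simp: insert_index_def)
  have [measurable]: "(\<lambda>X. gram_det K n (\<lambda>j. X (insert_index i j))) \<in> borel_measurable (PiM I (\<lambda>_. N))"
    "(\<lambda>X. gram_det K n (\<lambda>j. X (insert_index i j))) \<in> borel_measurable (PiM (insert i I) (\<lambda>_. N))"
    using ii by (auto intro!: gram_det_measurable K_meas)
  have [measurable]: "(\<lambda>X. X i) \<in> PiM (insert i I) (\<lambda>_. N) \<rightarrow>\<^sub>M N" by simp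
  have "(\<integral>\<^sup>+X. \<kappa> (X i) * ennreal (gram_det K n (\<lambda>j. X (insert_index i j))) \<partial>PiM {..<Suc n} (\<lambda>_. N))
    = (\<integral>\<^sup>+X. \<integral>\<^sup>+x. \<kappa> ((X(i := x)) i) * ennreal (gram_det K n (\<lambda>j. (X(i := x)) (insert_index i j))) \<partial>N \<partial>PiM I (\<lambda>_. N))"
    unfolding ins(1)[symmetric] by (rule P.product_nn_integral_insert[OF ins(2,3)]) measurable
  also have "\<dots> = (\<integral>\<^sup>+x. \<kappa> x \<partial>N) * (\<integral>\<^sup>+X. ennreal (gram_det K n (\<lambda>j. X (insert_index i j))) \<partial>PiM I (\<lambda>_. N))"
    using ne by (simp add: nn_integral_cmult nn_integral_multc)
  also have "(\<integral>\<^sup>+X. ennreal (gram_det K n (\<lambda>j. X (insert_index i j))) \<partial>PiM I (\<lambda>_. N)) = gram_int N K n"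
  proof -
    \<comment> \<open>The remaining coordinates are renumbered by \<open>insert_index i\<close>; a
      product of identical measures does not notice.\<close>
    have d: "distr (PiM I (\<lambda>_. N)) (PiM {..<n} (\<lambda>_. N)) (\<lambda>\<omega>. \<lambda>j\<in>{..<n}. \<omega> (insert_index i j)) = PiM {..<n} (\<lambda>_. N)"
      by (rule distr_PiM_reindex) (use ii in \<open>auto simp: insert_index_def inj_on_def prob_space_axioms split: if_splits\<close>)
    have m: "(\<lambda>\<omega>. \<lambda>j\<in>{..<n}. \<omega> (insert_index i j)) \<in> PiM I (\<lambda>_. N) \<rightarrow>\<^sub>M PiM {..<n} (\<lambda>_. N)"
      by (rule measurable_restrict) (use ii in auto)
    have "gram_int N K n = (\<integral>\<^sup>+X. ennreal (gram_det K n X) \<partial>distr (PiM I (\<lambda>_. N)) (PiM {..<n} (\<lambda>_. N)) (\<lambda>\<omega>. \<lambda>j\<in>{..<n}. \<omega> (insert_index i j)))"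
      unfolding d gram_int_def ..
    also have "\<dots> = (\<integral>\<^sup>+X. ennreal (gram_det K n (\<lambda>j\<in>{..<n}. X (insert_index i j))) \<partial>PiM I (\<lambda>_. N))"
      by (rule nn_integral_distr[OF m]) simp
    also have "\<dots> = (\<integral>\<^sup>+X. ennreal (gram_det K n (\<lambda>j. X (insert_index i j))) \<partial>PiM I (\<lambda>_. N))"
      by (intro nn_integral_cong arg_cong[where f = ennreal] gram_det_cong) simp
    finally show ?thesis ..
  qed
  finally show ?thesis .
qed

text \<open>Integrate \<open>gram_det_rank_bound\<close> for m + 1 points; by
  \<open>leave_one_out\<close> its m + 1 terms contribute equally. \<open>\<kappa>\<close> stands in
  for the diagonal of K', about whose measurability nothing is assumed; in the application it is the
  pointwise error of the given algorithm.\<close>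

lemma gram_int_rank_bound:
  assumes psd': "psd_on (space N) K'"
    and dec: "\<And>x y. x \<in> space N \<Longrightarrow> y \<in> space N \<Longrightarrow> K x y = K' x y + (\<Sum>l<r. b l x * b l y)"
    and \<kappa>[measurable]: "\<kappa> \<in> borel_measurable N" and K'\<kappa>: "\<And>x. x \<in> space N \<Longrightarrow> ennreal (K' x x) \<le> \<kappa> x"
    and r: "2 * r \<le> m"
  shows "gram_int N K (Suc m) \<le> ennreal ((real m + 1) / (real m + 1 - 2 * real r)) * (\<integral>\<^sup>+x. \<kappa> x \<partial>N) * gram_int N K m"
proof -
  define q where "q = real (Suc m) - 2 * real r"
  have q: "0 < q" using r by (simp add: q_def)
  have "ennreal q * gram_int N K (Suc m) = (\<integral>\<^sup>+X. ennreal (q * gram_det K (Suc m) X) \<partial>PiM {..<Suc m} (\<lambda>_. N))"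
    using q by (simp add: gram_int_def ennreal_mult' nn_integral_cmult)
  also have "\<dots> \<le> (\<integral>\<^sup>+X. (\<Sum>i<Suc m. \<kappa> (X i) * ennreal (gram_det K m (\<lambda>j. X (insert_index i j)))) \<partial>PiM {..<Suc m} (\<lambda>_. N))"
  proof (rule nn_integral_mono)
    fix X assume X: "X \<in> space (PiM {..<Suc m} (\<lambda>_. N))"
    note XS = space_PiM_D[OF X]
    have nn: "0 \<le> gram_det K m (\<lambda>j. X (insert_index i j))" "0 \<le> K' (X i) (X i)" if "i < Suc m" for i
      by (rule gram_det_nonneg[OF K_psd], rule XS) (use that XS in \<open>auto simp: insert_index_def intro: psd_on_diag[OF psd']\<close>)
    have "q * gram_det K (Suc m) X \<le> (\<Sum>i<Suc m. K' (X i) (X i) * gram_det K m (\<lambda>j. X (insert_index i j)))"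
      using gram_det_rank_bound[OF K_psd psd', of "Suc m" X b r] XS dec unfolding q_def diff_Suc_1 by blast
    then have "ennreal (q * gram_det K (Suc m) X) \<le> ennreal (\<Sum>i<Suc m. K' (X i) (X i) * gram_det K m (\<lambda>j. X (insert_index i j)))"
      by (rule ennreal_leI)
    also have "\<dots> = (\<Sum>i<Suc m. ennreal (K' (X i) (X i)) * ennreal (gram_det K m (\<lambda>j. X (insert_index i j))))"
      using nn by (subst sum_ennreal[symmetric]) (auto intro!: sum.cong ennreal_mult simp del: sum.lessThan_Suc)
    also have "\<dots> \<le> (\<Sum>i<Suc m. \<kappa> (X i) * ennreal (gram_det K m (\<lambda>j. X (insert_index i j))))"
      by (intro sum_mono mult_right_mono K'\<kappa> XS) auto
    finally show "ennreal (q * gram_det K (Suc m) X) \<le> \<dots>" .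
  qed
  also have "\<dots> = (\<Sum>i<Suc m. (\<integral>\<^sup>+X. \<kappa> (X i) * ennreal (gram_det K m (\<lambda>j. X (insert_index i j))) \<partial>PiM {..<Suc m} (\<lambda>_. N)))"
  proof (rule nn_integral_sum)
    fix i assume "i \<in> {..<Suc m}"
    then have [measurable]: "(\<lambda>X. X i) \<in> PiM {..<Suc m} (\<lambda>_. N) \<rightarrow>\<^sub>M N"
      "(\<lambda>X. gram_det K m (\<lambda>j. X (insert_index i j))) \<in> borel_measurable (PiM {..<Suc m} (\<lambda>_. N))"
      by (auto intro!: gram_det_measurable K_meas simp: insert_index_def)
    show "(\<lambda>X. \<kappa> (X i) * ennreal (gram_det K m (\<lambda>j. X (insert_index i j)))) \<in> borel_measurable (PiM {..<Suc m} (\<lambda>_. N))"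
      by measurable
  qed
  also have "\<dots> = (\<Sum>i<Suc m. (\<integral>\<^sup>+x. \<kappa> x \<partial>N) * gram_int N K m)"
    by (rule sum.cong) (auto intro!: leave_one_out)
  also have "\<dots> = ennreal (real (m + 1)) * ((\<integral>\<^sup>+x. \<kappa> x \<partial>N) * gram_int N K m)"
    by (simp add: ennreal_of_nat_eq_real_of_nat del: of_nat_Suc sum.lessThan_Suc)
  finally have "ennreal (1 / q) * (ennreal q * gram_int N K (Suc m)) \<le> ennreal (1 / q) * (ennreal (real (m + 1)) * ((\<integral>\<^sup>+x. \<kappa> x \<partial>N) * gram_int N K m))"
    by (rule mult_left_mono) simp
  moreover have "ennreal (1 / q) * (ennreal q * gram_int N K (Suc m)) = gram_int N K (Suc m)"
    using q by (simp add: mult.assoc[symmetric] ennreal_mult[symmetric] del: mult.assoc)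
  moreover have "ennreal (1 / q) * (ennreal (real (m + 1)) * ((\<integral>\<^sup>+x. \<kappa> x \<partial>N) * gram_int N K m))
      = ennreal ((real m + 1) / (real m + 1 - 2 * real r)) * (\<integral>\<^sup>+x. \<kappa> x \<partial>N) * gram_int N K m"
  proof -
    have "ennreal (1 / q) * ennreal (real (m + 1)) = ennreal ((real m + 1) / (real m + 1 - 2 * real r))"
      using q by (subst ennreal_mult[symmetric]) (auto simp: q_def add_ac)
    then show ?thesis by (simp add: mult.assoc[symmetric])
  qed
  ultimately show ?thesis by simp
qed

text \<open>The hypothesis bounds the average optimal error under volume sampling by c, so some
  sample does at least as well. The witness has a nonzero determinant, as the formula for the
  optimal weights requires.\<close>

lemma good_sample_step:
  assumes le: "gram_int N K (Suc n) \<le> c * gram_int N K n" and nz: "gram_int N K n \<noteq> 0"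
  shows "\<exists>X B. (\<forall>i<n. X i \<in> space N) \<and>
    (\<integral>\<^sup>+x. ennreal (kriging_err K n X (\<lambda>i. \<Sum>j<n. B i j * K (X j) x) x) \<partial>N) \<le> c"
proof -
  have "\<exists>X\<in>space (PiM {..<n} (\<lambda>_. N)). ennreal (gram_det K n X) \<noteq> 0 \<and>
     (\<integral>\<^sup>+x. ennreal (gram_det K (Suc n) (X(n := x))) \<partial>N) \<le> c * ennreal (gram_det K n X)"
  proof (rule nn_integral_ratio_witness)
    show "(\<lambda>X. \<integral>\<^sup>+x. ennreal (gram_det K (Suc n) (X(n := x))) \<partial>N) \<in> borel_measurable (PiM {..<n} (\<lambda>_. N))"
      using gram_det_upd_measurable[of n] by (intro borel_measurable_nn_integral) (simp add: case_prod_unfold)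
  qed (use le nz gram_int_finite[of n] in \<open>simp_all add: gram_int_Suc[unfolded gram_int_def] gram_int_def\<close>)
  then obtain X where X: "X \<in> space (PiM {..<n} (\<lambda>_. N))" and nz: "ennreal (gram_det K n X) \<noteq> 0"
    and le: "(\<integral>\<^sup>+x. ennreal (gram_det K (Suc n) (X(n := x))) \<partial>N) \<le> c * ennreal (gram_det K n X)"
    by blast
  note XS = space_PiM_D[OF X]
  from nz have pos: "0 < gram_det K n X" by (metis ennreal_neg not_le)
  obtain B where B: "\<And>x. x \<in> space N \<Longrightarrow> gram_det K (Suc n) (X(n := x)) =
       gram_det K n X * kriging_err K n X (\<lambda>i. \<Sum>j<n. B i j * K (X j) x) x"
    by (rule gram_det_Suc[OF K_psd XS, of n]) (use pos in auto)
  define e where "e x = kriging_err K n X (\<lambda>i. \<Sum>j<n. B i j * K (X j) x) x" for x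
  have em: "e \<in> borel_measurable N"
  proof (rule measurable_cong[THEN iffD1])
    show "(\<lambda>x. gram_det K (Suc n) (X(n := x)) / gram_det K n X) \<in> borel_measurable N"
      using X by measurable
  qed (use pos in \<open>simp add: B e_def\<close>)
  have "(\<integral>\<^sup>+x. ennreal (gram_det K (Suc n) (X(n := x))) \<partial>N) = (\<integral>\<^sup>+x. ennreal (gram_det K n X) * ennreal (e x) \<partial>N)"
    using pos by (intro nn_integral_cong) (simp add: B e_def ennreal_mult')
  also have "\<dots> = ennreal (gram_det K n X) * (\<integral>\<^sup>+x. ennreal (e x) \<partial>N)"
    using em by (simp add: nn_integral_cmult)
  finally have "ennreal (gram_det K n X) * (\<integral>\<^sup>+x. ennreal (e x) \<partial>N) \<le> ennreal (gram_det K n X) * c"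
    using le by (simp add: mult.commute)
  then have "(\<integral>\<^sup>+x. ennreal (e x) \<partial>N) \<le> c"
    using pos by (simp add: ennreal_mult_le_mult_iff)
  then show ?thesis using XS unfolding e_def by blast
qed

text \<open>If the normalizing constant for m points vanishes, one stops at the last number of
  points at which it does not: the next constant is 0, so a sample of that size has error 0. Hence n
  may be smaller than m.\<close>

lemma good_sample:
  assumes psd': "psd_on (space N) K'"
    and dec: "\<And>x y. x \<in> space N \<Longrightarrow> y \<in> space N \<Longrightarrow> K x y = K' x y + (\<Sum>l<r. b l x * b l y)"
    and \<kappa>: "\<kappa> \<in> borel_measurable N" and K'\<kappa>: "\<And>x. x \<in> space N \<Longrightarrow> ennreal (K' x x) \<le> \<kappa> x"
    and r: "2 * r \<le> m"
  obtains n X B where "n \<le> m" "\<And>i. i < n \<Longrightarrow> X i \<in> space N"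
    "(\<integral>\<^sup>+x. ennreal (kriging_err K n X (\<lambda>i. \<Sum>j<n. B i j * K (X j) x) x) \<partial>N)
       \<le> ennreal ((real m + 1) / (real m + 1 - 2 * real r)) * (\<integral>\<^sup>+x. \<kappa> x \<partial>N)"
proof -
  define c where "c = ennreal ((real m + 1) / (real m + 1 - 2 * real r)) * (\<integral>\<^sup>+x. \<kappa> x \<partial>N)"
  have "\<exists>n\<le>m. gram_int N K (Suc n) \<le> c * gram_int N K n \<and> gram_int N K n \<noteq> 0"
  proof (cases "gram_int N K m = 0")
    case False
    then show ?thesis using gram_int_rank_bound[OF psd' dec \<kappa> K'\<kappa> r] by (auto simp: c_def)
  next
    case True
    \<comment> \<open>The first vanishing constant cannot have index 0, because the empty
      determinant integrates to 1; its predecessor is the desired size.\<close>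
    define n where "n = (LEAST n. gram_int N K n = 0)"
    have n0: "gram_int N K n = 0" unfolding n_def by (rule LeastI) (rule True)
    have nm: "n \<le> m" unfolding n_def by (rule Least_le) (rule True)
    have "gram_int N K 0 = 1" by (simp add: gram_int_def PiM_empty P.emeasure_space_1)
    with n0 obtain k where k: "n = Suc k" by (cases n) auto
    have "gram_int N K k \<noteq> 0"
      using not_less_Least[of k "\<lambda>n. gram_int N K n = 0"] k unfolding n_def by simp
    then show ?thesis using nm n0 k by (intro exI[of _ k]) auto
  qed
  then obtain n where n: "n \<le> m" "gram_int N K (Suc n) \<le> c * gram_int N K n" "gram_int N K n \<noteq> 0" by blast
  from good_sample_step[OF n(2,3)] n(1) show thesis
    using that unfolding c_def by blast
qed

end

section \<open>Independence from trigonometric moments\<close>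

text \<open>Use the positive and negative parts of W as densities. The moments say that X has the
  same characteristic function under both, so Levy's uniqueness theorem gives equal laws.\<close>

lemma (in prob_space) trig_moments_zero_imp_indicator:
  assumes W: "integrable M W" and X[measurable]: "X \<in> borel_measurable M"
    and c0: "\<And>t. (\<integral>x. W x * cos (t * X x) \<partial>M) = 0"
    and s0: "\<And>t. (\<integral>x. W x * sin (t * X x) \<partial>M) = 0"
    and A[measurable]: "A \<in> sets (borel :: real measure)"
  shows "(\<integral>x. W x * indicator A (X x) \<partial>M) = (0::real)"
proof -
  note [measurable] = borel_measurable_integrable[OF W]
  define P where "P x = max 0 (W x)" for x
  define Q where "Q x = max 0 (- W x)" for x
  have WPQ: "W x = P x - Q x" for x by (auto simp: P_def Q_def)
  have PQ0: "0 \<le> P x" "0 \<le> Q x" for x by (auto simp: P_def Q_def)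
  have intP: "integrable M P" and intQ: "integrable M Q"
    unfolding P_def[abs_def] Q_def[abs_def] using W by auto
  note [measurable] = borel_measurable_integrable[OF intP] borel_measurable_integrable[OF intQ]
  have int_bd: "integrable M (\<lambda>x. V x * g (X x))" if "integrable M V" "\<And>y. \<bar>g y\<bar> \<le> 1" "g \<in> borel_measurable borel"
    for V and g :: "real \<Rightarrow> real"
  proof (rule Bochner_Integration.integrable_bound[OF that(1)])
    note [measurable] = that(3) borel_measurable_integrable[OF that(1)]
    show "(\<lambda>x. V x * g (X x)) \<in> borel_measurable M" by measurable
    show "AE x in M. norm (V x * g (X x)) \<le> norm (V x)"
      using that(2) by (intro AE_I2) (simp add: abs_mult mult_left_le)
  qed
  have PQ: "(\<integral>x. P x * g (X x) \<partial>M) = (\<integral>x. Q x * g (X x) \<partial>M)"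
    if "(\<integral>x. W x * g (X x) \<partial>M) = 0" "\<And>y. \<bar>g y\<bar> \<le> 1" "g \<in> borel_measurable borel" for g :: "real \<Rightarrow> real"
    using that(1) int_bd[OF intP that(2,3)] int_bd[OF intQ that(2,3)] by (simp add: WPQ left_diff_distrib)
  define c where "c = (\<integral>x. P x \<partial>M)"
  \<comment> \<open>The cosine moment at t = 0 says that both parts have the same mass.\<close>
  have cQ: "c = (\<integral>x. Q x \<partial>M)"
    using PQ[of "\<lambda>y. 1"] c0[of 0] by (simp add: c_def)
  have "0 \<le> c" unfolding c_def using PQ0 by (intro integral_nonneg_AE) auto
  then consider "c = 0" | "0 < c" by linarith
  then show ?thesis
  proof cases
    case 1
    \<comment> \<open>Without mass there is nothing to normalize, but then W vanishes almost
      everywhere.\<close>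
    have "AE x in M. P x = 0" "AE x in M. Q x = 0"
      using integral_nonneg_eq_0_iff_AE[OF intP] integral_nonneg_eq_0_iff_AE[OF intQ] PQ0 1 cQ
      by (simp_all add: c_def)
    then have "AE x in M. W x * indicator A (X x) = 0"
      by eventually_elim (simp add: WPQ)
    then show ?thesis by (rule integral_eq_zero_AE)
  next
    case 2
    define D where "D V = density M (\<lambda>x. ennreal (V x / c))" for V
    have key: "real_distribution (distr (D V) borel X) \<and>
        (\<forall>g::real \<Rightarrow> complex. g \<in> borel_measurable borel \<longrightarrow> (\<integral>y. g y \<partial>distr (D V) borel X) = (\<integral>x. (V x / c) *\<^sub>R g (X x) \<partial>M)) \<and>
        measure (distr (D V) borel X) A = (\<integral>x. V x / c * indicator A (X x) \<partial>M)"
      if V: "integrable M V" "\<And>x. 0 \<le> V x" "(\<integral>x. V x \<partial>M) = c" for V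
    proof (intro conjI allI impI)
      note [measurable] = borel_measurable_integrable[OF V(1)]
      have "emeasure (D V) (space M) = (\<integral>\<^sup>+x. ennreal (V x / c) \<partial>M)"
        unfolding D_def by (subst emeasure_density) (auto intro!: nn_integral_cong)
      also have "\<dots> = ennreal (\<integral>x. V x / c \<partial>M)"
        using V 2 by (intro nn_integral_eq_integral) auto
      also have "\<dots> = 1" using V 2 by simp
      finally have "prob_space (D V)" by (intro prob_spaceI) (simp add: D_def)
      then interpret D: prob_space "D V" .
      have XD: "X \<in> D V \<rightarrow>\<^sub>M borel" by (simp add: D_def)
      show rd: "real_distribution (distr (D V) borel X)" by (rule D.real_distribution_distr[OF XD])
      interpret rd: real_distribution "distr (D V) borel X" by (rule rd)
      {
        fix g :: "real \<Rightarrow> complex" assume [measurable]: "g \<in> borel_measurable borel"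
        have "(\<integral>y. g y \<partial>distr (D V) borel X) = (\<integral>x. g (X x) \<partial>D V)"
          by (rule integral_distr[OF XD]) simp
        also have "\<dots> = (\<integral>x. (V x / c) *\<^sub>R g (X x) \<partial>M)"
          unfolding D_def by (rule integral_density) (use V 2 in auto)
        finally show "(\<integral>y. g y \<partial>distr (D V) borel X) = (\<integral>x. (V x / c) *\<^sub>R g (X x) \<partial>M)" .
      }
      have "measure (distr (D V) borel X) A = (\<integral>y. indicator A y \<partial>distr (D V) borel X)"
        by simp
      also have "\<dots> = (\<integral>x. indicator A (X x) \<partial>D V)"
        by (rule integral_distr[OF XD]) simp
      also have "\<dots> = (\<integral>x. (V x / c) *\<^sub>R indicator A (X x) \<partial>M)"
        unfolding D_def by (rule integral_density) (use V 2 in auto)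
      finally show "measure (distr (D V) borel X) A = (\<integral>x. V x / c * indicator A (X x) \<partial>M)" by simp
    qed
    note kP = key[OF intP PQ0(1) c_def[symmetric]] and kQ = key[OF intQ PQ0(2) cQ[symmetric]]
    have "char (distr (D P) borel X) = char (distr (D Q) borel X)"
    proof
      fix t
      have Re: "(\<integral>x. P x * cos (t * X x) \<partial>M) = (\<integral>x. Q x * cos (t * X x) \<partial>M)"
        by (rule PQ[OF c0]) auto
      have Im: "(\<integral>x. P x * sin (t * X x) \<partial>M) = (\<integral>x. Q x * sin (t * X x) \<partial>M)"
        by (rule PQ[OF s0]) auto
      have cmp: "(\<integral>x. (V x / c) *\<^sub>R iexp (t * X x) \<partial>M)
          = Complex ((\<integral>x. V x * cos (t * X x) \<partial>M) / c) ((\<integral>x. V x * sin (t * X x) \<partial>M) / c)"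
        if V: "integrable M V" for V
      proof -
        note [measurable] = borel_measurable_integrable[OF V]
        have i: "integrable M (\<lambda>x. (V x / c) *\<^sub>R iexp (t * X x))"
        proof (rule Bochner_Integration.integrable_bound)
          show "integrable M (\<lambda>x. V x / c)" using V by simp
        qed (auto intro!: AE_I2)
        show ?thesis
        proof (rule complex_eqI)
          have "Re (\<integral>x. (V x / c) *\<^sub>R iexp (t * X x) \<partial>M) = (\<integral>x. V x * cos (t * X x) / c \<partial>M)"
            unfolding integral_Re[OF i, symmetric] by (intro Bochner_Integration.integral_cong refl) (simp add: Re_exp)
          then show "Re (\<integral>x. (V x / c) *\<^sub>R iexp (t * X x) \<partial>M) = Re (Complex ((\<integral>x. V x * cos (t * X x) \<partial>M) / c) ((\<integral>x. V x * sin (t * X x) \<partial>M) / c))"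
            by simp
          have "Im (\<integral>x. (V x / c) *\<^sub>R iexp (t * X x) \<partial>M) = (\<integral>x. V x * sin (t * X x) / c \<partial>M)"
            unfolding integral_Im[OF i, symmetric] by (intro Bochner_Integration.integral_cong refl) (simp add: Im_exp)
          then show "Im (\<integral>x. (V x / c) *\<^sub>R iexp (t * X x) \<partial>M) = Im (Complex ((\<integral>x. V x * cos (t * X x) \<partial>M) / c) ((\<integral>x. V x * sin (t * X x) \<partial>M) / c))"
            by simp
        qed
      qed
      show "char (distr (D P) borel X) t = char (distr (D Q) borel X) t"
        unfolding char_def using kP kQ cmp[OF intP] cmp[OF intQ] Re Im by simp
    qed
    then have "distr (D P) borel X = distr (D Q) borel X"
      using kP kQ by (intro Levy_uniqueness) auto
    then have "(\<integral>x. P x / c * indicator A (X x) \<partial>M) = (\<integral>x. Q x / c * indicator A (X x) \<partial>M)"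
      unfolding kP[THEN conjunct2, THEN conjunct2, symmetric] kQ[THEN conjunct2, THEN conjunct2, symmetric]
      by simp
    then have "(\<integral>x. P x * indicator A (X x) \<partial>M) = (\<integral>x. Q x * indicator A (X x) \<partial>M)"
      using 2 by (simp add: times_divide_eq_left)
    then show ?thesis
      using int_bd[OF intP, of "indicator A"] int_bd[OF intQ, of "indicator A"]
      by (simp add: WPQ left_diff_distrib indicator_def)
  qed
qed

text \<open>One coordinate is handled at a time. The addition formulas factor the last coordinate
  out of the sine and cosine, the one-dimensional lemma replaces its trigonometric factor by an
  indicator, and the induction continues with W times that indicator.\<close>

lemma (in prob_space) trig_moments_zero_imp_rectangle:
  fixes n :: nat
  assumes "integrable M W" "\<And>i. i < n \<Longrightarrow> X i \<in> borel_measurable M"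
    and "\<And>t. (\<integral>x. W x * cos (\<Sum>i<n. t i * X i x) \<partial>M) = 0"
    and "\<And>t. (\<integral>x. W x * sin (\<Sum>i<n. t i * X i x) \<partial>M) = 0"
    and "\<And>i. i < n \<Longrightarrow> A i \<in> sets (borel :: real measure)"
  shows "(\<integral>x. W x * (\<Prod>i<n. indicator (A i) (X i x)) \<partial>M) = (0::real)"
  using assms
proof (induction n arbitrary: W)
  case 0
  from 0(3)[of "\<lambda>_. 0"] show ?case by simp
next
  case (Suc n)
  note W = Suc.prems(1)
  have [measurable]: "X i \<in> borel_measurable M" if "i < Suc n" for i using Suc.prems(2) that .
  have [measurable]: "A n \<in> sets borel" using Suc.prems(5) by simp
  note [measurable] = borel_measurable_integrable[OF W]
  have Xn [measurable]: "X n \<in> borel_measurable M" by simp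
  have bd: "integrable M (\<lambda>x. W x * g x)" if "\<And>y. \<bar>g y\<bar> \<le> 1" "g \<in> borel_measurable M" for g
  proof (rule Bochner_Integration.integrable_bound[OF W])
    show "AE x in M. norm (W x * g x) \<le> norm (W x)"
      using that by (intro AE_I2) (simp add: abs_mult mult_left_le)
  qed (use that in measurable)
  define S where "S t x = (\<Sum>i<n. t i * X i x)" for t x
  have [measurable]: "S t \<in> borel_measurable M" for t unfolding S_def by measurable
  have c: "(\<integral>x. W x * cos (S t x + s * X n x) \<partial>M) = 0" and s: "(\<integral>x. W x * sin (S t x + s * X n x) \<partial>M) = 0" for t s
    using Suc.prems(3,4)[of "t(n := s)"] by (simp_all add: S_def)
  have ic: "integrable M (\<lambda>x. W x * cos (S t x + s * X n x))" and isn: "integrable M (\<lambda>x. W x * sin (S t x + s * X n x))" for t s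
    by (rule bd; simp)+
  have cc: "(\<integral>x. (W x * cos (S t x)) * cos (s * X n x) \<partial>M) = 0" for t s
  proof -
    have "(\<lambda>x. (W x * cos (S t x)) * cos (s * X n x)) = (\<lambda>x. (W x * cos (S t x + s * X n x) + W x * cos (S t x + (-s) * X n x)) / 2)"
      by (rule ext) (simp add: cos_add cos_diff field_simps)
    then show ?thesis using ic[of t s] ic[of t "-s"] c[of t s] c[of t "-s"] by simp
  qed
  have cs: "(\<integral>x. (W x * cos (S t x)) * sin (s * X n x) \<partial>M) = 0" for t s
  proof -
    have "(\<lambda>x. (W x * cos (S t x)) * sin (s * X n x)) = (\<lambda>x. (W x * sin (S t x + s * X n x) - W x * sin (S t x + (-s) * X n x)) / 2)"
      by (rule ext) (simp add: sin_add sin_diff field_simps)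
    then show ?thesis using isn[of t s] isn[of t "-s"] s[of t s] s[of t "-s"] by simp
  qed
  have sc: "(\<integral>x. (W x * sin (S t x)) * cos (s * X n x) \<partial>M) = 0" for t s
  proof -
    have "(\<lambda>x. (W x * sin (S t x)) * cos (s * X n x)) = (\<lambda>x. (W x * sin (S t x + s * X n x) + W x * sin (S t x + (-s) * X n x)) / 2)"
      by (rule ext) (simp add: sin_add sin_diff field_simps)
    then show ?thesis using isn[of t s] isn[of t "-s"] s[of t s] s[of t "-s"] by simp
  qed
  have ss: "(\<integral>x. (W x * sin (S t x)) * sin (s * X n x) \<partial>M) = 0" for t s
  proof -
    have "(\<lambda>x. (W x * sin (S t x)) * sin (s * X n x)) = (\<lambda>x. (W x * cos (S t x + (-s) * X n x) - W x * cos (S t x + s * X n x)) / 2)"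
      by (rule ext) (simp add: cos_add cos_diff field_simps)
    then show ?thesis using ic[of t s] ic[of t "-s"] c[of t s] c[of t "-s"] by simp
  qed
  have C: "(\<integral>x. (W x * cos (S t x)) * indicator (A n) (X n x) \<partial>M) = 0" for t
    by (rule trig_moments_zero_imp_indicator[OF bd Xn cc cs]) auto
  have Sn: "(\<integral>x. (W x * sin (S t x)) * indicator (A n) (X n x) \<partial>M) = 0" for t
    by (rule trig_moments_zero_imp_indicator[OF bd Xn sc ss]) auto
  have "(\<integral>x. (W x * indicator (A n) (X n x)) * (\<Prod>i<n. indicator (A i) (X i x)) \<partial>M) = 0"
  proof (rule Suc.IH)
    show "integrable M (\<lambda>x. W x * indicator (A n) (X n x))"
      by (rule bd) (auto simp: indicator_def)
    show "(\<integral>x. W x * indicator (A n) (X n x) * cos (\<Sum>i<n. t i * X i x) \<partial>M) = 0" for t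
      using C[of t] by (simp add: S_def mult_ac)
    show "(\<integral>x. W x * indicator (A n) (X n x) * sin (\<Sum>i<n. t i * X i x) \<partial>M) = 0" for t
      using Sn[of t] by (simp add: S_def mult_ac)
  qed (use Suc.prems in auto)
  then show ?case by (simp add: mult_ac)
qed

text \<open>The conclusion says that the conditional expectation of W given the X_i is 0. Positive
  and negative part of W push forward to finite measures that agree on rectangles, an
  intersection-stable generator, hence agree everywhere.\<close>

lemma (in prob_space) trig_moments_zero_imp_orthogonal:
  fixes n :: nat
  assumes W: "integrable M W" and X: "\<And>i. i < n \<Longrightarrow> X i \<in> borel_measurable M"
    and c: "\<And>t. (\<integral>x. W x * cos (\<Sum>i<n. t i * X i x) \<partial>M) = 0"
    and s: "\<And>t. (\<integral>x. W x * sin (\<Sum>i<n. t i * X i x) \<partial>M) = 0"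
    and h: "h \<in> borel_measurable (PiM {..<n} (\<lambda>_. borel))" and hb: "\<And>y. \<bar>h y\<bar> \<le> B"
  shows "(\<integral>x. W x * h (\<lambda>i\<in>{..<n}. X i x) \<partial>M) = (0::real)"
proof -
  note [measurable] = borel_measurable_integrable[OF W] h
  define Y where "Y x = (\<lambda>i\<in>{..<n}. X i x)" for x
  have Y [measurable]: "Y \<in> M \<rightarrow>\<^sub>M PiM {..<n} (\<lambda>_. borel)"
    unfolding Y_def by (rule measurable_restrict) (use X in auto)
  define P where "P x = max 0 (W x)" for x
  define Q where "Q x = max 0 (- W x)" for x
  have WPQ: "W x = P x - Q x" for x by (auto simp: P_def Q_def)
  have PQ0: "0 \<le> P x" "0 \<le> Q x" for x by (auto simp: P_def Q_def)
  have intP: "integrable M P" and intQ: "integrable M Q"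
    unfolding P_def[abs_def] Q_def[abs_def] using W by auto
  note [measurable] = borel_measurable_integrable[OF intP] borel_measurable_integrable[OF intQ]
  define D where "D V = distr (density M (\<lambda>x. ennreal (V x))) (PiM {..<n} (\<lambda>_. borel)) Y" for V
  have emD: "emeasure (D V) (Pi\<^sub>E {..<n} A) = ennreal (\<integral>x. V x * (\<Prod>i<n. indicator (A i) (X i x)) \<partial>M)"
    "integrable M (\<lambda>x. V x * (\<Prod>i<n. indicator (A i) (X i x)))"
    if V: "integrable M V" "\<And>x. 0 \<le> V x" and A: "\<And>i. i < n \<Longrightarrow> A i \<in> sets borel" for V A
  proof -
    note [measurable] = borel_measurable_integrable[OF V(1)]
    have A' [measurable]: "Pi\<^sub>E {..<n} A \<in> sets (PiM {..<n} (\<lambda>_. borel))"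
      using A by (intro sets_PiM_I_finite) auto
    have ind: "indicator (Y -` Pi\<^sub>E {..<n} A \<inter> space M) x = (\<Prod>i<n. indicator (A i) (X i x) :: real)" if "x \<in> space M" for x
    proof (cases "\<forall>i<n. X i x \<in> A i")
      case True
      then have "Y x \<in> Pi\<^sub>E {..<n} A" by (auto simp: Y_def)
      then show ?thesis using True that by simp
    next
      case False
      then obtain i where i: "i < n" "X i x \<notin> A i" by auto
      then have "Y x \<notin> Pi\<^sub>E {..<n} A" by (auto simp: Y_def PiE_def Pi_def)
      moreover have "(\<Prod>i<n. indicator (A i) (X i x) :: real) = 0" using i by (intro prod_zero bexI[of _ i]) (auto simp: indicator_def)
      ultimately show ?thesis by simp
    qed
    have S: "Y -` Pi\<^sub>E {..<n} A \<inter> space M \<in> sets M" by measurable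
    have i1: "integrable M (\<lambda>x. V x * indicator (Y -` Pi\<^sub>E {..<n} A \<inter> space M) x)"
      using integrable_mult_indicator[OF S V(1)] by (simp add: mult.commute)
    show "integrable M (\<lambda>x. V x * (\<Prod>i<n. indicator (A i) (X i x)))"
    proof -
      have "integrable M (\<lambda>x. V x * indicator (Y -` Pi\<^sub>E {..<n} A \<inter> space M) x)
          = integrable M (\<lambda>x. V x * (\<Prod>i<n. indicator (A i) (X i x)))"
        by (rule Bochner_Integration.integrable_cong) (simp_all add: ind)
      with i1 show ?thesis by simp
    qed
    have "emeasure (D V) (Pi\<^sub>E {..<n} A) = (\<integral>\<^sup>+x. ennreal (V x) * indicator (Y -` Pi\<^sub>E {..<n} A \<inter> space M) x \<partial>M)"
      unfolding D_def by (subst emeasure_distr) (auto simp: emeasure_density S Y)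
    also have "\<dots> = (\<integral>\<^sup>+x. ennreal (V x * indicator (Y -` Pi\<^sub>E {..<n} A \<inter> space M) x) \<partial>M)"
      by (intro nn_integral_cong) (auto simp: indicator_def)
    also have "\<dots> = ennreal (\<integral>x. V x * indicator (Y -` Pi\<^sub>E {..<n} A \<inter> space M) x \<partial>M)"
      by (rule nn_integral_eq_integral[OF i1]) (use V(2) in auto)
    also have "(\<integral>x. V x * indicator (Y -` Pi\<^sub>E {..<n} A \<inter> space M) x \<partial>M) = (\<integral>x. V x * (\<Prod>i<n. indicator (A i) (X i x)) \<partial>M)"
      by (rule Bochner_Integration.integral_cong) (simp_all add: ind)
    finally show "emeasure (D V) (Pi\<^sub>E {..<n} A) = ennreal (\<integral>x. V x * (\<Prod>i<n. indicator (A i) (X i x)) \<partial>M)" .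
  qed
  have DPQ: "D P = D Q"
  proof (rule measure_eqI_PiM_finite[of "{..<n}" _ "\<lambda>_. borel" _ "\<lambda>_. Pi\<^sub>E {..<n} (\<lambda>_. UNIV)"])
    fix A :: "nat \<Rightarrow> real set" assume A: "\<And>i. i \<in> {..<n} \<Longrightarrow> A i \<in> sets borel"
    have "(\<integral>x. W x * (\<Prod>i<n. indicator (A i) (X i x)) \<partial>M) = 0"
      by (rule trig_moments_zero_imp_rectangle[OF W X c s]) (use A in auto)
    then have "(\<integral>x. P x * (\<Prod>i<n. indicator (A i) (X i x)) \<partial>M) = (\<integral>x. Q x * (\<Prod>i<n. indicator (A i) (X i x)) \<partial>M)"
      using emD(2)[OF intP PQ0(1), of A] emD(2)[OF intQ PQ0(2), of A] A by (simp add: WPQ left_diff_distrib)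
    then show "emeasure (D P) (Pi\<^sub>E {..<n} A) = emeasure (D Q) (Pi\<^sub>E {..<n} A)"
      using emD(1)[OF intP PQ0(1), of A] emD(1)[OF intQ PQ0(2), of A] A by simp
  next
    show "range (\<lambda>_::nat. Pi\<^sub>E {..<n} (\<lambda>_. UNIV)) \<subseteq> prod_algebra {..<n} (\<lambda>_. borel :: real measure)"
      by (auto intro!: prod_algebraI_finite)
    show "emeasure (D P) (Pi\<^sub>E {..<n} (\<lambda>_. UNIV)) \<noteq> \<infinity>"
      by (subst emD(1)[OF intP PQ0(1)]) auto
  qed (auto simp: D_def space_PiM)
  have eq: "(\<integral>y. h y \<partial>D V) = (\<integral>x. V x * h (Y x) \<partial>M)" if V: "integrable M V" "\<And>x. 0 \<le> V x" for V
  proof -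
    note [measurable] = borel_measurable_integrable[OF V(1)]
    have "(\<integral>y. h y \<partial>D V) = (\<integral>x. h (Y x) \<partial>density M (\<lambda>x. ennreal (V x)))"
      unfolding D_def by (rule integral_distr) auto
    also have "\<dots> = (\<integral>x. V x *\<^sub>R h (Y x) \<partial>M)"
      by (rule integral_density) (use V in auto)
    finally show ?thesis by simp
  qed
  have ih: "integrable M (\<lambda>x. V x * h (Y x))" if V: "integrable M V" for V
  proof (rule Bochner_Integration.integrable_bound)
    note [measurable] = borel_measurable_integrable[OF V(1)]
    show "integrable M (\<lambda>x. B * V x)" using V by simp
    have "\<bar>h y\<bar> \<le> \<bar>B\<bar>" for y using hb[of y] by linarith
    then show "AE x in M. norm (V x * h (Y x)) \<le> norm (B * V x)"
      by (intro AE_I2) (simp add: abs_mult mult.commute[of "\<bar>B\<bar>"] mult_left_mono)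
    show "(\<lambda>x. V x * h (Y x)) \<in> borel_measurable M" by measurable
  qed
  have "(\<integral>x. P x * h (Y x) \<partial>M) = (\<integral>x. Q x * h (Y x) \<partial>M)"
    using eq[OF intP PQ0(1)] eq[OF intQ PQ0(2)] DPQ by simp
  then show ?thesis
    using ih[OF intP] ih[OF intQ] by (simp add: WPQ left_diff_distrib Y_def)
qed

section \<open>Spaces of Gaussian functionals\<close>

text \<open>The derivative of sin at 0 along 1 / (k + 1), for the limit in
  \<open>uncorrelated_trig\<close>.\<close>

lemma LIMSEQ_scaled_sin: "(\<lambda>k. real (Suc k) * sin (a / real (Suc k))) \<longlonglongrightarrow> a"
proof (rule LIM_zero_cancel, rule Lim_null_comparison)
  show "\<forall>\<^sub>F k in sequentially. norm (real (Suc k) * sin (a / real (Suc k)) - a) \<le> a\<^sup>2 / 2 * inverse (real (Suc k))"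
  proof (rule always_eventually, rule allI)
    fix k
    define x where "x = a / real (Suc k)"
    have "\<bar>sin x - (\<Sum>m<2. sin_coeff m * x ^ m)\<bar> \<le> inverse (fact 2) * \<bar>x\<bar> ^ 2"
      by (rule Maclaurin_sin_bound)
    then have "\<bar>sin x - x\<bar> \<le> x\<^sup>2 / 2"
      by (simp add: numeral_2_eq_2 sin_coeff_def power2_eq_square)
    then have "real (Suc k) * \<bar>sin x - x\<bar> \<le> real (Suc k) * (x\<^sup>2 / 2)"
      by (rule mult_left_mono) simp
    moreover have "norm (real (Suc k) * sin x - a) = real (Suc k) * \<bar>sin x - x\<bar>"
    proof -
      have "real (Suc k) * sin x - a = real (Suc k) * (sin x - x)"
        by (simp add: x_def right_diff_distrib)
      then show ?thesis by (simp only: real_norm_def abs_mult abs_of_nat)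
    qed
    moreover have "real (Suc k) * (x\<^sup>2 / 2) = a\<^sup>2 / 2 * inverse (real (Suc k))"
      unfolding x_def
      by (simp only: power_divide) (simp add: power2_eq_square del: of_nat_Suc, simp only: divide_inverse)
    ultimately show "norm (real (Suc k) * sin (a / real (Suc k)) - a) \<le> a\<^sup>2 / 2 * inverse (real (Suc k))"
      by (simp only: x_def)
  qed
  show "(\<lambda>k. a\<^sup>2 / 2 * inverse (real (Suc k))) \<longlonglongrightarrow> 0"
    by (rule tendsto_mult_right_zero[OF LIMSEQ_inverse_real_of_nat])
qed

text \<open>Only one-dimensional laws are prescribed; joint Gaussian behaviour is extracted from the
  closure of \<open>V\<close> under linear combinations, in the spirit of Cramer and Wold. Vanishing
  almost everywhere is the degenerate normal law of variance 0.\<close>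

locale gaussian_functionals = prob_space M for M :: "'f measure" +
  fixes V :: "('f \<Rightarrow> real) set"
  assumes V_zero: "(\<lambda>_. 0) \<in> V"
    and V_add: "\<And>u w. u \<in> V \<Longrightarrow> w \<in> V \<Longrightarrow> (\<lambda>f. u f + w f) \<in> V"
    and V_scale: "\<And>c u. u \<in> V \<Longrightarrow> (\<lambda>f. c * u f) \<in> V"
    and V_measurable: "\<And>u. u \<in> V \<Longrightarrow> u \<in> borel_measurable M"
    and V_normal: "\<And>u. u \<in> V \<Longrightarrow> (AE f in M. u f = 0) \<or> (\<exists>\<sigma>>0. distributed M lborel u (normal_density 0 \<sigma>))"
begin

lemma V_sum: "(\<And>i. i \<in> I \<Longrightarrow> u i \<in> V) \<Longrightarrow> (\<lambda>f. \<Sum>i\<in>I. c i * u i f) \<in> V"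
  by (induction I rule: infinite_finite_induct) (auto intro: V_zero V_add[OF V_scale])

lemma V_uminus: "u \<in> V \<Longrightarrow> (\<lambda>f. - u f) \<in> V"
  using V_scale[of u "-1"] by simp

lemma V_diff: "u \<in> V \<Longrightarrow> w \<in> V \<Longrightarrow> (\<lambda>f. u f - w f) \<in> V"
  using V_add[OF _ V_uminus, of u w] by simp

lemma moments:
  assumes u: "u \<in> V"
  shows square_integrable: "integrable M (\<lambda>f. (u f)\<^sup>2)"
    and "integrable M (\<lambda>f. u f ^ 4)"
    and fourth_moment: "(\<integral>f. u f ^ 4 \<partial>M) = 3 * (\<integral>f. (u f)\<^sup>2 \<partial>M)\<^sup>2"
    and normal_variance: "\<And>\<sigma>. 0 < \<sigma> \<Longrightarrow> distributed M lborel u (normal_density 0 \<sigma>) \<Longrightarrow> (\<integral>f. (u f)\<^sup>2 \<partial>M) = \<sigma>\<^sup>2"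
proof -
  note [measurable] = V_measurable[OF u]
  have normal: "integrable M (\<lambda>f. (u f)\<^sup>2) \<and> integrable M (\<lambda>f. u f ^ 4) \<and>
      (\<integral>f. (u f)\<^sup>2 \<partial>M) = \<sigma>\<^sup>2 \<and> (\<integral>f. u f ^ 4 \<partial>M) = 3 * (\<sigma>\<^sup>2)\<^sup>2"
    if "0 < \<sigma>" and d: "distributed M lborel u (normal_density 0 \<sigma>)" for \<sigma>
  proof -
    have i: "integrable M (\<lambda>f. u f ^ (2 * k))" "(\<integral>f. u f ^ (2 * k) \<partial>M) = fact (2 * k) / ((2 / \<sigma>\<^sup>2) ^ k * fact k)" for k
    proof -
      have hb: "has_bochner_integral lborel (\<lambda>x. normal_density 0 \<sigma> x * x ^ (2 * k)) (fact (2 * k) / ((2 / \<sigma>\<^sup>2) ^ k * fact k))"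
        using normal_moment_even[OF \<open>0 < \<sigma>\<close>, of 0 k] by simp
      show "integrable M (\<lambda>f. u f ^ (2 * k))"
        using distributed_integrable[OF d, of "\<lambda>x. x ^ (2 * k)"] integrable.intros[OF hb] by simp
      show "(\<integral>f. u f ^ (2 * k) \<partial>M) = fact (2 * k) / ((2 / \<sigma>\<^sup>2) ^ k * fact k)"
        using distributed_integral[OF d, of "\<lambda>x. x ^ (2 * k)"] has_bochner_integral_integral_eq[OF hb] by simp
    qed
    show ?thesis
      using i[of 1] i[of 2] \<open>0 < \<sigma>\<close> by (simp add: fact_numeral power2_eq_square)
  qed
  have zero: "integrable M (\<lambda>f. u f ^ k) \<and> (\<integral>f. u f ^ k \<partial>M) = 0" if "AE f in M. u f = 0" "0 < k" for k :: nat
  proof -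
    have ae: "AE f in M. u f ^ k = 0" using that(1) by eventually_elim (use that(2) in simp)
    have "integrable M (\<lambda>f. u f ^ k) \<longleftrightarrow> integrable M (\<lambda>_. 0 :: real)"
      by (rule integrable_cong_AE) (use ae in auto)
    then show ?thesis using integral_eq_zero_AE[OF ae] by simp
  qed
  show "integrable M (\<lambda>f. (u f)\<^sup>2)" "integrable M (\<lambda>f. u f ^ 4)"
    "(\<integral>f. u f ^ 4 \<partial>M) = 3 * (\<integral>f. (u f)\<^sup>2 \<partial>M)\<^sup>2"
    using V_normal[OF u] normal zero[of 2] zero[of 4] by auto
  show "(\<integral>f. (u f)\<^sup>2 \<partial>M) = \<sigma>\<^sup>2" if "0 < \<sigma>" "distributed M lborel u (normal_density 0 \<sigma>)" for \<sigma>
    using normal[OF that] by simp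
qed

text \<open>A centred normal law is fixed by its variance, the point mass at 0 included. This is how
  Gaussianity enters \<open>uncorrelated_trig\<close>.\<close>

lemma same_variance_same_law:
  fixes h :: "real \<Rightarrow> real"
  assumes u: "u \<in> V" and w: "w \<in> V" and var: "(\<integral>f. (u f)\<^sup>2 \<partial>M) = (\<integral>f. (w f)\<^sup>2 \<partial>M)"
    and h[measurable]: "h \<in> borel_measurable borel"
  shows "(\<integral>f. h (u f) \<partial>M) = (\<integral>f. h (w f) \<partial>M)"
proof -
  note [measurable] = V_measurable[OF u] V_measurable[OF w]
  have ae: "AE f in M. u f = 0" if u: "u \<in> V" and "(\<integral>f. (u f)\<^sup>2 \<partial>M) = 0" for u
    using integral_nonneg_eq_0_iff_AE[OF square_integrable[OF u]] that by simp
  show ?thesis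
  proof (cases "(\<integral>f. (u f)\<^sup>2 \<partial>M) = 0")
    case True
    have "(\<integral>f. h (u f) \<partial>M) = (\<integral>f. h 0 \<partial>M)" "(\<integral>f. h (w f) \<partial>M) = (\<integral>f. h 0 \<partial>M)"
      using ae[OF u] ae[OF w] True var by (intro integral_cong_AE; auto)+
    then show ?thesis by simp
  next
    case False
    have ex: "\<exists>\<sigma>>0. distributed M lborel u (normal_density 0 \<sigma>)" if u: "u \<in> V" and "(\<integral>f. (u f)\<^sup>2 \<partial>M) \<noteq> 0" for u
    proof -
      have "\<not> (AE f in M. u f = 0)"
      proof
        assume "AE f in M. u f = 0"
        then have "AE f in M. (u f)\<^sup>2 = 0" by eventually_elim simp
        from integral_eq_zero_AE[OF this] show False using that(2) by simp
      qed
      then show ?thesis using V_normal[OF u] by blast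
    qed
    obtain \<sigma> where \<sigma>: "0 < \<sigma>" "distributed M lborel u (normal_density 0 \<sigma>)" using ex[OF u False] by blast
    obtain \<tau> where \<tau>: "0 < \<tau>" "distributed M lborel w (normal_density 0 \<tau>)" using ex[OF w] False var by auto
    have "\<sigma>\<^sup>2 = \<tau>\<^sup>2" using normal_variance[OF u \<sigma>] normal_variance[OF w \<tau>] var by simp
    then have "\<sigma> = \<tau>" using \<sigma>(1) \<tau>(1) by (simp add: power2_eq_iff)
    then show ?thesis
      using distributed_integral[OF \<sigma>(2), of h] distributed_integral[OF \<tau>(2), of h] by simp
  qed
qed

text \<open>The covariance, since all functionals have mean zero. It is only a semi-inner product: a
  nonzero functional may vanish almost everywhere.\<close>

definition ip :: "('f \<Rightarrow> real) \<Rightarrow> ('f \<Rightarrow> real) \<Rightarrow> real" where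
  "ip u w = (\<integral>f. u f * w f \<partial>M)"

lemma product_integrable:
  assumes u: "u \<in> V" and w: "w \<in> V"
  shows "integrable M (\<lambda>f. u f * w f)"
proof (rule Bochner_Integration.integrable_bound)
  note [measurable] = V_measurable[OF u] V_measurable[OF w]
  show "integrable M (\<lambda>f. (u f)\<^sup>2 + (w f)\<^sup>2)" using u w by (intro Bochner_Integration.integrable_add square_integrable)
  show "(\<lambda>f. u f * w f) \<in> borel_measurable M" by measurable
  have "\<bar>a * b\<bar> \<le> a\<^sup>2 + b\<^sup>2" for a b :: real
  proof -
    have "0 \<le> (\<bar>a\<bar> - \<bar>b\<bar>)\<^sup>2" by simp
    then have "2 * (\<bar>a\<bar> * \<bar>b\<bar>) \<le> a\<^sup>2 + b\<^sup>2" by (simp add: power2_diff)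
    then show ?thesis unfolding abs_mult by (smt (verit) mult_nonneg_nonneg abs_ge_zero)
  qed
  then show "AE f in M. norm (u f * w f) \<le> norm ((u f)\<^sup>2 + (w f)\<^sup>2)" by (intro AE_I2) simp
qed

lemma V_integrable:
  assumes u: "u \<in> V"
  shows "integrable M u"
  using square_integrable_imp_integrable[OF V_measurable[OF u] square_integrable[OF u]] .

lemma ip_commute: "ip u w = ip w u"
  by (simp add: ip_def mult.commute)

lemma ip_self: "ip u u = (\<integral>f. (u f)\<^sup>2 \<partial>M)"
  by (simp add: ip_def power2_eq_square)

lemma ip_nonneg: "0 \<le> ip u u"
  by (simp add: ip_self)

lemma ip_add_left: "u \<in> V \<Longrightarrow> u' \<in> V \<Longrightarrow> w \<in> V \<Longrightarrow> ip (\<lambda>f. u f + u' f) w = ip u w + ip u' w"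
  by (simp add: ip_def distrib_right product_integrable)

lemma ip_scale_left: "ip (\<lambda>f. c * u f) w = c * ip u w"
  by (simp add: ip_def mult.assoc)

lemma ip_diff_left: "u \<in> V \<Longrightarrow> u' \<in> V \<Longrightarrow> w \<in> V \<Longrightarrow> ip (\<lambda>f. u f - u' f) w = ip u w - ip u' w"
  by (simp add: ip_def left_diff_distrib product_integrable)

lemma ip_sum_left:
  assumes "\<And>i. i \<in> I \<Longrightarrow> u i \<in> V" "w \<in> V"
  shows "ip (\<lambda>f. \<Sum>i\<in>I. c i * u i f) w = (\<Sum>i\<in>I. c i * ip (u i) w)"
  using assms by (simp add: ip_def sum_distrib_right product_integrable mult.assoc)

lemma ip_add_right: "u \<in> V \<Longrightarrow> u' \<in> V \<Longrightarrow> w \<in> V \<Longrightarrow> ip w (\<lambda>f. u f + u' f) = ip w u + ip w u'"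
  by (simp only: ip_add_left ip_commute[of w])

lemma ip_scale_right: "ip w (\<lambda>f. c * u f) = c * ip w u"
  by (simp only: ip_scale_left ip_commute[of w])

lemma ip_diff_right: "u \<in> V \<Longrightarrow> u' \<in> V \<Longrightarrow> w \<in> V \<Longrightarrow> ip w (\<lambda>f. u f - u' f) = ip w u - ip w u'"
  by (simp only: ip_diff_left ip_commute[of w])

lemma ip_sum_right:
  assumes "\<And>i. i \<in> I \<Longrightarrow> u i \<in> V" "w \<in> V"
  shows "ip w (\<lambda>f. \<Sum>i\<in>I. c i * u i f) = (\<Sum>i\<in>I. c i * ip w (u i))"
  unfolding ip_commute[of w] by (rule ip_sum_left[OF assms])

lemma ip_psd:
  assumes v: "\<And>x. x \<in> S \<Longrightarrow> v x \<in> V"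
  shows "psd_on S (\<lambda>x y. ip (v x) (v y))"
  unfolding psd_on_def
proof (intro conjI ballI allI impI)
  fix n and X :: "nat \<Rightarrow> 'a" and c :: "nat \<Rightarrow> real" assume "\<forall>i<n. X i \<in> S"
  then have vX: "v (X i) \<in> V" if "i < n" for i using that v by simp
  have "0 \<le> ip (\<lambda>f. \<Sum>i<n. c i * v (X i) f) (\<lambda>f. \<Sum>i<n. c i * v (X i) f)" by (rule ip_nonneg)
  also have "\<dots> = (\<Sum>i<n. c i * (\<Sum>j<n. c j * ip (v (X i)) (v (X j))))"
  proof -
    have "ip (\<lambda>f. \<Sum>i<n. c i * v (X i) f) (\<lambda>f. \<Sum>i<n. c i * v (X i) f)
        = (\<Sum>i<n. c i * ip (v (X i)) (\<lambda>f. \<Sum>i<n. c i * v (X i) f))"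
      by (rule ip_sum_left) (use vX in \<open>auto intro: V_sum\<close>)
    also have "\<dots> = (\<Sum>i<n. c i * (\<Sum>j<n. c j * ip (v (X i)) (v (X j))))"
      by (intro sum.cong refl arg_cong2[where f = "(*)"] ip_sum_right) (use vX in auto)
    finally show ?thesis .
  qed
  finally show "0 \<le> quad_form (\<lambda>x y. ip (v x) (v y)) n X c c"
    by (simp add: quad_form_def sum_distrib_left mult.assoc)
qed (rule ip_commute)

lemma kriging_err_ip:
  assumes vx: "v x \<in> V" and vX: "\<And>i. i < n \<Longrightarrow> v (X i) \<in> V"
  shows "(\<integral>\<^sup>+f. ennreal ((v x f - (\<Sum>i<n. a i * v (X i) f))\<^sup>2) \<partial>M) = ennreal (kriging_err (\<lambda>x y. ip (v x) (v y)) n X a x)"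
proof -
  define s where "s = (\<lambda>f. \<Sum>i<n. a i * v (X i) f)"
  have s: "s \<in> V" unfolding s_def using vX by (intro V_sum) auto
  have "(\<integral>\<^sup>+f. ennreal ((v x f - s f)\<^sup>2) \<partial>M) = ennreal (ip (\<lambda>f. v x f - s f) (\<lambda>f. v x f - s f))"
    unfolding ip_self by (intro nn_integral_eq_integral square_integrable V_diff vx s) auto
  also have "ip (\<lambda>f. v x f - s f) (\<lambda>f. v x f - s f) = ip (v x) (v x) - 2 * ip s (v x) + ip s s"
    using vx s by (simp add: ip_diff_left ip_diff_right V_diff ip_commute[of "v x" s])
  also have "ip s (v x) = (\<Sum>i<n. a i * ip (v (X i)) (v x))"
    unfolding s_def by (rule ip_sum_left) (use vX vx in auto)
  also have "ip s s = (\<Sum>i<n. a i * ip (v (X i)) s)"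
    by (subst (1) s_def, rule ip_sum_left) (use vX s in auto)
  also have "\<dots> = (\<Sum>i<n. a i * (\<Sum>j<n. a j * ip (v (X i)) (v (X j))))"
    unfolding s_def by (intro sum.cong refl arg_cong2[where f = "(*)"] ip_sum_right) (use vX in auto)
  finally show ?thesis
    by (simp add: kriging_err_def s_def sum_distrib_left mult.assoc)
qed

text \<open>Needed for the degenerate step of the orthogonalization in
  \<open>projection\<close>.\<close>

lemma ip_zero_right:
  assumes "u \<in> V" "e \<in> V" "ip e e = 0"
  shows "ip u e = 0"
proof -
  have "AE f in M. (e f)\<^sup>2 = 0"
    using integral_nonneg_eq_0_iff_AE[OF square_integrable[OF assms(2)]] assms(3) by (simp add: ip_self)
  then have "AE f in M. u f * e f = 0" by eventually_elim simp
  then show ?thesis unfolding ip_def by (rule integral_eq_zero_AE)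
qed

text \<open>The laws of y + s g and y - s g agree and are symmetric, so sin(s g) is orthogonal to cos y and
  sin y; divide by s and let s tend to 0.\<close>

lemma uncorrelated_trig:
  assumes g: "g \<in> V" and y: "y \<in> V" and gy: "ip g y = 0"
  shows "(\<integral>f. g f * cos (y f) \<partial>M) = 0" "(\<integral>f. g f * sin (y f) \<partial>M) = 0"
proof -
  note [measurable] = V_measurable[OF g] V_measurable[OF y]
  have bdi: "integrable M q" if "q \<in> borel_measurable M" "\<And>f. \<bar>q f\<bar> \<le> 1" for q :: "'f \<Rightarrow> real"
    by (rule integrable_const_bound[of _ 1]) (use that in auto)
  define u where "u s = (\<lambda>f. y f + s * g f)" for s
  have uV: "u s \<in> V" for s unfolding u_def by (intro V_add V_scale g y)
  note [measurable] = V_measurable[OF uV]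
  \<comment> \<open>The mixed term vanishes because \<open>g\<close> and \<open>y\<close> are
    uncorrelated, so the variance is even in s.\<close>
  have var: "ip (u s) (u s) = ip y y + s\<^sup>2 * ip g g" for s
    unfolding u_def using g y gy V_scale[OF g, of s] V_add[OF y V_scale[OF g, of s]]
    by (simp add: ip_add_left ip_add_right ip_scale_left ip_scale_right ip_commute[of y g] power2_eq_square)
  have sin0: "(\<integral>f. sin (u s f) \<partial>M) = 0" for s
  proof -
    have "(\<integral>f. sin (u s f) \<partial>M) = (\<integral>f. sin (- u s f) \<partial>M)"
      by (rule same_variance_same_law[OF uV V_uminus[OF uV]]) auto
    then show ?thesis by simp
  qed
  have cos_sym: "(\<integral>f. cos (u s f) \<partial>M) = (\<integral>f. cos (u (-s) f) \<partial>M)" for s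
    by (rule same_variance_same_law[OF uV uV]) (use var in \<open>simp_all add: ip_self\<close>)
  have C: "(\<integral>f. sin (s * g f) * cos (y f) \<partial>M) = 0" for s
  proof -
    have "(\<lambda>f. sin (s * g f) * cos (y f)) = (\<lambda>f. (sin (u s f) - sin (u (-s) f)) / 2)"
      by (rule ext) (simp add: u_def sin_add sin_diff field_simps)
    then show ?thesis
      using sin0[of s] sin0[of "-s"] by (simp add: bdi)
  qed
  have S: "(\<integral>f. sin (s * g f) * sin (y f) \<partial>M) = 0" for s
  proof -
    have "(\<lambda>f. sin (s * g f) * sin (y f)) = (\<lambda>f. (cos (u (-s) f) - cos (u s f)) / 2)"
      by (rule ext) (simp add: u_def cos_add cos_diff field_simps)
    then show ?thesis
      using cos_sym[of s] by (simp add: bdi)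
  qed
  have lim: "(\<integral>f. g f * q f \<partial>M) = 0"
    if [measurable]: "q \<in> borel_measurable M" and q: "\<And>f. \<bar>q f\<bar> \<le> 1" and 0: "\<And>s. (\<integral>f. sin (s * g f) * q f \<partial>M) = 0" for q
  proof -
    have "(\<lambda>k. \<integral>f. (real (Suc k) * sin (g f / real (Suc k))) * q f \<partial>M) \<longlonglongrightarrow> (\<integral>f. g f * q f \<partial>M)"
    proof (rule integral_dominated_convergence[where w = "\<lambda>f. \<bar>g f\<bar>"])
      show "AE f in M. (\<lambda>k. real (Suc k) * sin (g f / real (Suc k)) * q f) \<longlonglongrightarrow> g f * q f"
        by (intro AE_I2 tendsto_mult_right LIMSEQ_scaled_sin)
      fix k
      have "\<bar>real (Suc k) * sin (a / real (Suc k)) * b\<bar> \<le> \<bar>a\<bar>" if "\<bar>b\<bar> \<le> 1" for a b :: real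
      proof -
        have "\<bar>sin (a / real (Suc k))\<bar> \<le> \<bar>a / real (Suc k)\<bar>" by (rule abs_sin_x_le_abs_x)
        then have "real (Suc k) * \<bar>sin (a / real (Suc k))\<bar> \<le> real (Suc k) * \<bar>a / real (Suc k)\<bar>"
          by (rule mult_left_mono) simp
        also have "\<dots> = \<bar>a\<bar>" by (simp add: abs_divide)
        finally have "real (Suc k) * \<bar>sin (a / real (Suc k))\<bar> * \<bar>b\<bar> \<le> \<bar>a\<bar> * 1"
          using that by (intro mult_mono) auto
        then show ?thesis by (simp add: abs_mult)
      qed
      then show "AE f in M. norm (real (Suc k) * sin (g f / real (Suc k)) * q f) \<le> \<bar>g f\<bar>"
        using q by (intro AE_I2) simp
    qed (use V_integrable[OF g] in auto)
    moreover have "(\<integral>f. (real (Suc k) * sin (g f / real (Suc k))) * q f \<partial>M) = 0" for k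
      using 0[of "1 / real (Suc k)"] by (simp add: mult.assoc)
    ultimately have "(\<lambda>k. 0) \<longlonglongrightarrow> (\<integral>f. g f * q f \<partial>M)" by (simp only:)
    then show ?thesis by (simp add: LIMSEQ_const_iff)
  qed
  show "(\<integral>f. g f * cos (y f) \<partial>M) = 0" by (rule lim) (use C in auto)
  show "(\<integral>f. g f * sin (y f) \<partial>M) = 0" by (rule lim) (use S in auto)
qed

text \<open>Gram-Schmidt. \<open>d u\<close> holds the coefficients of the projection of u onto the
  span of the L_i, and \<open>b l\<close> is the coordinate along the l-th orthonormal direction, or
  0 if that step is degenerate. The second clause is the splitting of the covariance that
  \<open>gram_det_rank_bound\<close> asks for.\<close>

lemma projection:
  fixes L :: "nat \<Rightarrow> 'f \<Rightarrow> real"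
  assumes "\<And>i. i < r \<Longrightarrow> L i \<in> V"
  shows "\<exists>d b. (\<forall>u\<in>V. \<forall>i<r. ip (\<lambda>f. u f - (\<Sum>j<r. d u j * L j f)) (L i) = 0) \<and>
    (\<forall>u\<in>V. \<forall>w\<in>V. ip (\<lambda>f. u f - (\<Sum>j<r. d u j * L j f)) (\<lambda>f. w f - (\<Sum>j<r. d w j * L j f))
       = ip u w - (\<Sum>l<r. b l u * b l w))"
  using assms
proof (induction r)
  case 0
  show ?case by simp
next
  case (Suc r)
  then obtain d b where
    orth: "\<And>u i. u \<in> V \<Longrightarrow> i < r \<Longrightarrow> ip (\<lambda>f. u f - (\<Sum>j<r. d u j * L j f)) (L i) = 0" and
    res: "\<And>u w. u \<in> V \<Longrightarrow> w \<in> V \<Longrightarrow> ip (\<lambda>f. u f - (\<Sum>j<r. d u j * L j f)) (\<lambda>f. w f - (\<Sum>j<r. d w j * L j f))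
       = ip u w - (\<Sum>l<r. b l u * b l w)"
    using Suc.IH[OF Suc.prems[OF less_SucI]] by blast
  have LV: "L i \<in> V" if "i < Suc r" for i using Suc.prems that .
  define g where "g u = (\<lambda>f. u f - (\<Sum>j<r. d u j * L j f))" for u
  have gV: "g u \<in> V" if "u \<in> V" for u
    unfolding g_def using that LV by (intro V_diff V_sum) auto
  define e where "e = g (L r)"
  have eV: "e \<in> V" unfolding e_def using LV by (intro gV) auto
  have orth': "ip (g u) (L i) = 0" if "u \<in> V" "i < r" for u i using orth[OF that] by (simp add: g_def)
  have res': "ip (g u) (g w) = ip u w - (\<Sum>l<r. b l u * b l w)" if "u \<in> V" "w \<in> V" for u w
    using res[OF that] by (simp add: g_def)
  have Lr: "ip (g u) (L r) = ip (g u) e" if "u \<in> V" for u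
  proof -
    have "ip (g u) e = ip (g u) (L r) - ip (g u) (\<lambda>f. \<Sum>j<r. d (L r) j * L j f)"
      unfolding e_def g_def[of "L r"] by (rule ip_diff_right) (use gV[OF that] LV V_sum[of "{..<r}" L] in auto)
    also have "ip (g u) (\<lambda>f. \<Sum>j<r. d (L r) j * L j f) = (\<Sum>j<r. d (L r) j * ip (g u) (L j))"
      by (rule ip_sum_right) (use gV[OF that] LV in auto)
    finally have "ip (g u) e = ip (g u) (L r) - (\<Sum>j<r. d (L r) j * ip (g u) (L j))" .
    then show ?thesis using orth'[OF that] by simp
  qed
  have eL: "ip e (L i) = 0" if "i < r" for i
    unfolding e_def using that LV by (intro orth') auto
  show ?case
  proof (cases "ip e e = 0")
    case True
    show ?thesis
    proof (intro exI conjI ballI allI impI)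
      \<comment> \<open>Here L_r is almost surely a combination of the earlier functionals and
        contributes nothing.\<close>
      define d' where "d' = (\<lambda>u i. if i < r then d u i else 0)"
      define b' where "b' = (\<lambda>l u. if l < r then b l u else 0)"
      have g': "(\<lambda>f. u f - (\<Sum>j<Suc r. d' u j * L j f)) = g u" for u
        by (rule ext) (simp add: g_def d'_def)
      fix u assume u: "u \<in> V"
      show "ip (\<lambda>f. u f - (\<Sum>j<Suc r. d' u j * L j f)) (L i) = 0" if "i < Suc r" for i
        unfolding g' using that orth'[OF u] Lr[OF u] ip_zero_right[OF gV[OF u] eV True] by (auto simp: less_Suc_eq)
      fix w assume w: "w \<in> V"
      show "ip (\<lambda>f. u f - (\<Sum>j<Suc r. d' u j * L j f)) (\<lambda>f. w f - (\<Sum>j<Suc r. d' w j * L j f))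
        = ip u w - (\<Sum>l<Suc r. b' l u * b' l w)"
        unfolding g' res'[OF u w] by (simp add: b'_def)
    qed
  next
    case False
    define q where "q = ip e e"
    have q: "0 < q" using False ip_nonneg[of e] by (simp add: q_def)
    define p where "p u = ip (g u) e" for u
    \<comment> \<open>Subtracting a multiple of \<open>e\<close> also changes the earlier
      coefficients, because \<open>e\<close> is L_r minus its own projection.\<close>
    define d' where "d' = (\<lambda>u i. if i < r then d u i - p u / q * d (L r) i else p u / q)"
    define b' where "b' = (\<lambda>l u. if l < r then b l u else p u / sqrt q)"
    have g': "(\<lambda>f. u f - (\<Sum>j<Suc r. d' u j * L j f)) = (\<lambda>f. g u f - p u / q * e f)" for u
      by (rule ext) (simp add: g_def d'_def e_def left_diff_distrib right_diff_distrib sum_subtractf sum_distrib_left mult.assoc)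
    have peV: "(\<lambda>f. p u / q * e f) \<in> V" for u by (intro V_scale eV)
    have ge: "ip e (g u) = p u" for u by (simp add: p_def ip_commute)
    show ?thesis
    proof (intro exI[of _ d'] exI[of _ b'] conjI ballI allI impI)
      fix u assume u: "u \<in> V"
      note V = gV[OF u] peV[of u] eV
      show "ip (\<lambda>f. u f - (\<Sum>j<Suc r. d' u j * L j f)) (L i) = 0" if i: "i < Suc r" for i
      proof -
        have "ip (\<lambda>f. g u f - p u / q * e f) (L i) = ip (g u) (L i) - p u / q * ip e (L i)"
          using V LV[OF i] by (simp only: ip_diff_left ip_scale_left)
        also have "\<dots> = 0"
        proof (cases "i < r")
          case True
          then show ?thesis using orth'[OF u] eL by simp
        next
          case False
          then have "i = r" using i by simp
          moreover have "ip e (L r) = q" using Lr[of "L r"] LV by (simp add: e_def[symmetric] q_def)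
          ultimately show ?thesis using Lr[OF u] q by (simp add: p_def)
        qed
        finally show ?thesis unfolding g' .
      qed
      fix w assume w: "w \<in> V"
      note V' = V gV[OF w] peV[of w] V_diff[OF gV[OF w] peV[of w]]
      have "ip (\<lambda>f. g u f - p u / q * e f) (\<lambda>f. g w f - p w / q * e f)
         = ip (g u) (g w) - p w / q * p u - p u / q * (p w - p w / q * q)"
        using V' by (simp only: ip_diff_left ip_diff_right ip_scale_left ip_scale_right ge p_def[symmetric] q_def[symmetric])
      also have "\<dots> = ip (g u) (g w) - p u / sqrt q * (p w / sqrt q)"
        using q by (simp add: field_simps)
      also have "\<dots> = ip u w - (\<Sum>l<Suc r. b' l u * b' l w)"
        unfolding res'[OF u w] by (simp add: b'_def)
      finally show "ip (\<lambda>f. u f - (\<Sum>j<Suc r. d' u j * L j f)) (\<lambda>f. w f - (\<Sum>j<Suc r. d' w j * L j f))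
        = ip u w - (\<Sum>l<Suc r. b' l u * b' l w)"
        unfolding g' .
    qed
  qed
qed

text \<open>The residual g of the projection is uncorrelated with every combination of the L_i,
  hence by \<open>uncorrelated_trig\<close> and \<open>trig_moments_zero_imp_orthogonal\<close> it
  is orthogonal to every bounded function of the data. The cross term therefore drops out, and
  nonlinear use of the data cannot beat the projection.\<close>

lemma linear_is_optimal:
  fixes L :: "nat \<Rightarrow> 'f \<Rightarrow> real"
  assumes L: "\<And>i. i < r \<Longrightarrow> L i \<in> V" and u: "u \<in> V"
    and orth: "\<And>i. i < r \<Longrightarrow> ip (\<lambda>f. u f - (\<Sum>j<r. c j * L j f)) (L i) = 0"
    and \<psi>[measurable]: "\<psi> \<in> borel_measurable (PiM {..<r} (\<lambda>_. borel))"
  shows "ennreal (ip (\<lambda>f. u f - (\<Sum>j<r. c j * L j f)) (\<lambda>f. u f - (\<Sum>j<r. c j * L j f)))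
    \<le> (\<integral>\<^sup>+f. ennreal ((u f - \<psi> (\<lambda>i\<in>{..<r}. L i f))\<^sup>2) \<partial>M)"
proof -
  define g where "g f = u f - (\<Sum>j<r. c j * L j f)" for f
  have gV: "g \<in> V" unfolding g_def[abs_def] using L u by (intro V_diff V_sum) auto
  note [measurable] = V_measurable[OF gV] V_measurable[OF u]
  define Y where "Y f = (\<lambda>i\<in>{..<r}. L i f)" for f
  have Y[measurable]: "Y \<in> M \<rightarrow>\<^sub>M PiM {..<r} (\<lambda>_. borel)"
    unfolding Y_def by (rule measurable_restrict) (use L V_measurable in auto)
  define h where "h y = (\<Sum>j<r. c j * y j) - \<psi> y" for y
  have h[measurable]: "h \<in> borel_measurable (PiM {..<r} (\<lambda>_. borel))"
    unfolding h_def by (intro borel_measurable_diff borel_measurable_sum borel_measurable_times \<psi>) auto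
  have eq: "u f - \<psi> (Y f) = g f + h (Y f)" for f
    by (simp add: g_def h_def Y_def)
  \<comment> \<open>\<open>\<psi>\<close> is merely measurable, so the deviation h from the
    projection is truncated at N before a cross term is integrated; N tends to infinity at the
    end.\<close>
  define hN where "hN N y = (if \<bar>h y\<bar> \<le> real N then h y else 0)" for N y
  define iN where "iN N y = (if \<bar>h y\<bar> \<le> real N then 1 else 0 :: real)" for N y
  have [measurable]: "hN N \<in> borel_measurable (PiM {..<r} (\<lambda>_. borel))" "iN N \<in> borel_measurable (PiM {..<r} (\<lambda>_. borel))" for N
    unfolding hN_def iN_def by measurable
  have trig: "(\<integral>f. g f * cos (\<Sum>i<r. t i * L i f) \<partial>M) = 0" "(\<integral>f. g f * sin (\<Sum>i<r. t i * L i f) \<partial>M) = 0" for t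
  proof -
    have "(\<lambda>f. \<Sum>i<r. t i * L i f) \<in> V" using L by (intro V_sum) auto
    moreover have "ip g (\<lambda>f. \<Sum>i<r. t i * L i f) = 0"
    proof -
      have "ip g (\<lambda>f. \<Sum>i<r. t i * L i f) = (\<Sum>i<r. t i * ip g (L i))"
        by (rule ip_sum_right) (use L gV in auto)
      also have "\<dots> = 0"
        using orth by (intro sum.neutral) (simp add: g_def[abs_def])
      finally show ?thesis .
    qed
    ultimately show "(\<integral>f. g f * cos (\<Sum>i<r. t i * L i f) \<partial>M) = 0" "(\<integral>f. g f * sin (\<Sum>i<r. t i * L i f) \<partial>M) = 0"
      using uncorrelated_trig[OF gV] by auto
  qed
  have gh: "(\<integral>f. g f * hN N (Y f) \<partial>M) = 0" for N
    unfolding Y_def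
    by (rule trig_moments_zero_imp_orthogonal[OF V_integrable[OF gV] V_measurable[OF L] trig, where B = "real N"])
      (auto simp: hN_def)
  have igh: "integrable M (\<lambda>f. g f * hN N (Y f))" for N
  proof (rule Bochner_Integration.integrable_bound)
    show "integrable M (\<lambda>f. real N * g f)" using V_integrable[OF gV] by simp
    have "\<bar>hN N y\<bar> \<le> real N" for y by (simp add: hN_def)
    then show "AE f in M. norm (g f * hN N (Y f)) \<le> norm (real N * g f)"
      by (intro AE_I2) (simp add: abs_mult mult.commute[of "real N"] mult_left_mono)
  qed measurable
  have ig: "integrable M (\<lambda>f. iN N (Y f) * (g f)\<^sup>2)" for N
    by (rule Bochner_Integration.integrable_bound[OF square_integrable[OF gV]])
      (auto simp: iN_def intro!: AE_I2)
  have bound: "ennreal (\<integral>f. iN N (Y f) * (g f)\<^sup>2 \<partial>M) \<le> (\<integral>\<^sup>+f. ennreal ((u f - \<psi> (Y f))\<^sup>2) \<partial>M)" for N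
  proof -
    have "(\<integral>f. iN N (Y f) * (g f)\<^sup>2 \<partial>M) = (\<integral>f. iN N (Y f) * (g f)\<^sup>2 + 2 * (g f * hN N (Y f)) \<partial>M)"
      using gh igh ig by simp
    also have "ennreal \<dots> \<le> (\<integral>\<^sup>+f. ennreal (iN N (Y f) * (g f)\<^sup>2 + 2 * (g f * hN N (Y f))) \<partial>M)"
    proof -
      have i: "integrable M (\<lambda>f. iN N (Y f) * (g f)\<^sup>2 + 2 * (g f * hN N (Y f)))"
        using igh ig by simp
      have "(\<integral>f. iN N (Y f) * (g f)\<^sup>2 + 2 * (g f * hN N (Y f)) \<partial>M)
         \<le> (\<integral>f. max 0 (iN N (Y f) * (g f)\<^sup>2 + 2 * (g f * hN N (Y f))) \<partial>M)"
        using i by (intro integral_mono) auto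
      then have "ennreal (\<integral>f. iN N (Y f) * (g f)\<^sup>2 + 2 * (g f * hN N (Y f)) \<partial>M)
         \<le> ennreal (\<integral>f. max 0 (iN N (Y f) * (g f)\<^sup>2 + 2 * (g f * hN N (Y f))) \<partial>M)"
        by (rule ennreal_leI)
      also have "\<dots> = (\<integral>\<^sup>+f. ennreal (max 0 (iN N (Y f) * (g f)\<^sup>2 + 2 * (g f * hN N (Y f)))) \<partial>M)"
        using i by (intro nn_integral_eq_integral[symmetric]) auto
      finally show ?thesis by simp
    qed
    also have "\<dots> \<le> (\<integral>\<^sup>+f. ennreal ((u f - \<psi> (Y f))\<^sup>2) \<partial>M)"
    proof (intro nn_integral_mono ennreal_leI)
      fix f
      \<comment> \<open>Where |h| is at most N only the square of h is dropped; elsewhere the left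
        side is 0.\<close>
      show "iN N (Y f) * (g f)\<^sup>2 + 2 * (g f * hN N (Y f)) \<le> (u f - \<psi> (Y f))\<^sup>2"
        unfolding eq iN_def hN_def by (cases "\<bar>h (Y f)\<bar> \<le> real N") (simp add: power2_sum, simp)
    qed
    finally show ?thesis .
  qed
  have "(\<lambda>N. \<integral>f. iN N (Y f) * (g f)\<^sup>2 \<partial>M) \<longlonglongrightarrow> (\<integral>f. (g f)\<^sup>2 \<partial>M)"
  proof (rule integral_dominated_convergence[where w = "\<lambda>f. (g f)\<^sup>2"])
    show "AE f in M. (\<lambda>N. iN N (Y f) * (g f)\<^sup>2) \<longlonglongrightarrow> (g f)\<^sup>2"
    proof (intro AE_I2 tendsto_eventually)
      fix f
      have "\<forall>\<^sub>F N in sequentially. \<bar>h (Y f)\<bar> \<le> real N"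
        by (rule eventually_sequentiallyI[of "nat \<lceil>\<bar>h (Y f)\<bar>\<rceil>"]) linarith
      then show "\<forall>\<^sub>F N in sequentially. iN N (Y f) * (g f)\<^sup>2 = (g f)\<^sup>2"
        by eventually_elim (simp add: iN_def)
    qed
  qed (use square_integrable[OF gV] in \<open>auto simp: iN_def intro!: AE_I2\<close>)
  then have "(\<lambda>N. ennreal (\<integral>f. iN N (Y f) * (g f)\<^sup>2 \<partial>M)) \<longlonglongrightarrow> ennreal (ip g g)"
    unfolding ip_self by (rule tendsto_ennrealI)
  then have "ennreal (ip g g) \<le> (\<integral>\<^sup>+f. ennreal ((u f - \<psi> (Y f))\<^sup>2) \<partial>M)"
    by (rule LIMSEQ_le_const2) (use bound in auto)
  then show ?thesis by (simp add: g_def[abs_def] Y_def)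
qed

text \<open>This replaces Fernique's theorem: an event that carries most of the mass carries half of every
  second moment, uniformly over the functionals.\<close>

lemma bulk_second_moment:
  assumes u: "u \<in> V" and A: "A \<in> sets M" and small: "prob (space M - A) \<le> 1 / 12"
  shows "(\<integral>f. (u f)\<^sup>2 \<partial>M) \<le> 2 * (\<integral>f. indicator A f * (u f)\<^sup>2 \<partial>M)"
proof -
  note [measurable] = V_measurable[OF u] A
  define s where "s = (\<integral>f. (u f)\<^sup>2 \<partial>M)"
  have s0: "0 \<le> s" by (simp add: s_def)
  have iA: "integrable M (\<lambda>f. indicator A f * (u f)\<^sup>2)"
    using integrable_mult_indicator[OF A square_integrable[OF u]] by simp
  show ?thesis
  proof (cases "s = 0")
    case True
    then show ?thesis by (simp add: s_def[symmetric])
  next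
    case False
    then have s: "0 < s" using s0 by simp
    have le: "(u f)\<^sup>2 \<le> indicator A f * (u f)\<^sup>2 + (u f ^ 4 / (12 * s) + 3 * s * indicator (space M - A) f)" if "f \<in> space M" for f
    proof (cases "f \<in> A")
      case True
      then show ?thesis using s by simp
    next
      case False
      \<comment> \<open>The resulting bound u^2 <= u^4 / (12 s) + 3 s is used off the event. The
        fourth moment 3 s^2 makes the first term cost s / 4, and probability 1 / 12 makes the second
        cost at most s / 4, leaving s / 2 for the event.\<close>
      have "0 \<le> ((u f)\<^sup>2 - 6 * s)\<^sup>2" by simp
      then have "12 * s * (u f)\<^sup>2 \<le> u f ^ 4 + 36 * s\<^sup>2"
        by (simp add: power2_eq_square power4_eq_xxxx algebra_simps)
      then show ?thesis using False that s by (simp add: field_simps power2_eq_square)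
    qed
    have "s \<le> (\<integral>f. indicator A f * (u f)\<^sup>2 + (u f ^ 4 / (12 * s) + 3 * s * indicator (space M - A) f) \<partial>M)"
      unfolding s_def using moments(1,2)[OF u] iA le[unfolded s_def]
      by (intro integral_mono) (auto simp: emeasure_eq_measure)
    also have "\<dots> = (\<integral>f. indicator A f * (u f)\<^sup>2 \<partial>M) + (3 * s\<^sup>2 / (12 * s) + 3 * s * prob (space M - A))"
      using moments(1,2)[OF u] iA fourth_moment[OF u] by (simp add: s_def[symmetric] emeasure_eq_measure)
    also have "3 * s\<^sup>2 / (12 * s) + 3 * s * prob (space M - A) \<le> s / 4 + 3 * s * (1 / 12)"
      using s small by (intro add_mono mult_left_mono) (auto simp: power2_eq_square)
    finally show ?thesis by (simp add: s_def)
  qed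
qed

end

section \<open>The average case setting\<close>

locale average_case_setting =
  fixes d :: nat and D :: "point set" and \<rho> :: "point \<Rightarrow> real" and F :: "fn set"
    and nF :: "fn \<Rightarrow> real" and \<mu> :: "fn measure"
  assumes setting: "avg_setting d D \<rho> F nF \<mu>"
begin

section \<open>The weighted measure and the function space\<close>

abbreviation R where "R \<equiv> restrict_space (lebd d) D"
abbreviation G where "G \<equiv> Gmeas d D \<rho>"

lemma D_sets: "D \<in> sets (PiM {..<d} (\<lambda>_. lborel))"
  and D_pos: "emeasure (lebd d) D > 0"
  and \<rho>_meas: "\<rho> \<in> borel_measurable R"
  and \<rho>_int: "(\<integral>\<^sup>+x. ennreal (\<rho> x) \<partial>R) = 1"
  and banach: "banach_fn_space D F nF"
  and F_meas: "f \<in> F \<Longrightarrow> f \<in> borel_measurable R"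
  and embedding: "\<exists>C. \<forall>f\<in>F. L2sq d D \<rho> f \<le> ennreal (C * (nF f)\<^sup>2)"
  and eval_cont: "x \<in> D \<Longrightarrow> \<exists>C. \<forall>f\<in>F. \<bar>f x\<bar> \<le> C * nF f"
  and gaussian: "zero_mean_gaussian F nF \<mu>"
  using setting by (auto simp: avg_setting_def)

lemma space_R: "space R = D"
proof -
  have "D \<subseteq> space (lebd d)"
    using sets.sets_into_space[OF D_sets] by (simp add: lebd_def)
  then show ?thesis by (auto simp: space_restrict_space)
qed

lemma sets_G [measurable_cong]: "sets G = sets R"
  by (simp add: Gmeas_def)

lemma space_G: "space G = D"
  using sets_eq_imp_space_eq[OF sets_G] space_R by simp

lemma measurable_G: "h \<in> borel_measurable R \<Longrightarrow> h \<in> borel_measurable G"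
  by (simp only: measurable_cong_sets[OF sets_G refl])

sublocale G: prob_space G
proof
  show "emeasure G (space G) = 1"
  proof -
    have "emeasure G (space G) = (\<integral>\<^sup>+x. ennreal (\<rho> x) * indicator (space R) x \<partial>R)"
      unfolding Gmeas_def using \<rho>_meas by (simp add: emeasure_density del: space_restrict_space)
    also have "\<dots> = (\<integral>\<^sup>+x. ennreal (\<rho> x) \<partial>R)"
      by (rule nn_integral_cong) simp
    finally show ?thesis using \<rho>_int by simp
  qed
qed

lemma D_nonempty: "D \<noteq> {}"
  using D_pos by auto

lemma zero_F: "(\<lambda>_. 0) \<in> F"
  and add_F: "f \<in> F \<Longrightarrow> g \<in> F \<Longrightarrow> (\<lambda>x. f x + g x) \<in> F"
  and scale_F: "f \<in> F \<Longrightarrow> (\<lambda>x. c * f x) \<in> F"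
  and nF_nonneg: "f \<in> F \<Longrightarrow> 0 \<le> nF f"
  and nF_scale: "f \<in> F \<Longrightarrow> nF (\<lambda>x. c * f x) = \<bar>c\<bar> * nF f"
  and nF_triangle: "f \<in> F \<Longrightarrow> g \<in> F \<Longrightarrow> nF (\<lambda>x. f x + g x) \<le> nF f + nF g"
  and separable: "\<exists>S. countable S \<and> S \<subseteq> F \<and> (\<forall>f\<in>F. \<forall>e>0. \<exists>s\<in>S. nF (\<lambda>x. f x - s x) < e)"
  using banach unfolding banach_fn_space_def by auto

lemma diff_F: "f \<in> F \<Longrightarrow> g \<in> F \<Longrightarrow> (\<lambda>x. f x - g x) \<in> F"
  using add_F[OF _ scale_F, of f g "-1"] by simp

lemma nF_diff_triangle:
  assumes "f \<in> F" "g \<in> F" "h \<in> F"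
  shows "nF (\<lambda>x. f x - h x) \<le> nF (\<lambda>x. f x - g x) + nF (\<lambda>x. g x - h x)"
  using nF_triangle[OF diff_F[OF assms(1,2)] diff_F[OF assms(2,3)]]
  by (simp only: add_diff_eq diff_add_cancel)

sublocale \<mu>: prob_space \<mu>
  using gaussian by (simp add: zero_mean_gaussian_def)

section \<open>The Gaussian measure and its functionals\<close>

lemma space_\<mu>: "space \<mu> = F"
  and sets_\<mu>: "sets \<mu> = sigma_sets F (norm_open_sets F nF)"
  using gaussian by (simp_all add: zero_mean_gaussian_def)

lemma norm_open_in_sets: "U \<in> norm_open_sets F nF \<Longrightarrow> U \<in> sets \<mu>"
  by (simp add: sets_\<mu> sigma_sets.Basic)

lemma clf_add: "cont_lin_fun F nF L \<Longrightarrow> f \<in> F \<Longrightarrow> g \<in> F \<Longrightarrow> L (\<lambda>x. f x + g x) = L f + L g"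
  and clf_scale: "cont_lin_fun F nF L \<Longrightarrow> f \<in> F \<Longrightarrow> L (\<lambda>x. c * f x) = c * L f"
  by (simp_all add: cont_lin_fun_def)

lemma clf_diff: "cont_lin_fun F nF L \<Longrightarrow> f \<in> F \<Longrightarrow> g \<in> F \<Longrightarrow> L (\<lambda>x. f x - g x) = L f - L g"
  using clf_add[OF _ _ scale_F, of L f g "-1"] clf_scale[of L g "-1"] by simp

lemma clf_bound:
  assumes "cont_lin_fun F nF L"
  obtains C where "0 < C" "\<And>f. f \<in> F \<Longrightarrow> \<bar>L f\<bar> \<le> C * nF f"
proof -
  obtain C where C: "\<And>f. f \<in> F \<Longrightarrow> \<bar>L f\<bar> \<le> C * nF f"
    using assms unfolding cont_lin_fun_def by blast
  have "\<bar>L f\<bar> \<le> (\<bar>C\<bar> + 1) * nF f" if "f \<in> F" for f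
  proof -
    have "C * nF f \<le> (\<bar>C\<bar> + 1) * nF f"
      using nF_nonneg[OF that] by (intro mult_right_mono) auto
    then show ?thesis using C[OF that] by linarith
  qed
  then show ?thesis using that[of "\<bar>C\<bar> + 1"] by simp
qed

lemma clf_measurable:
  assumes L: "cont_lin_fun F nF L"
  shows "L \<in> borel_measurable \<mu>"
proof (rule borel_measurableI)
  fix S :: "real set" assume S: "open S"
  obtain C where C: "0 < C" "\<And>f. f \<in> F \<Longrightarrow> \<bar>L f\<bar> \<le> C * nF f" using clf_bound[OF L] by blast
  have "L -` S \<inter> F \<in> norm_open_sets F nF"
    unfolding norm_open_sets_def
  proof (intro CollectI conjI ballI)
    fix f assume "f \<in> L -` S \<inter> F"
    then have f: "f \<in> F" "L f \<in> S" by auto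
    obtain e where e: "e > 0" "\<And>y. dist y (L f) < e \<Longrightarrow> y \<in> S"
      using S f(2) unfolding open_dist by blast
    show "\<exists>r>0. \<forall>g\<in>F. nF (\<lambda>x. g x - f x) < r \<longrightarrow> g \<in> L -` S \<inter> F"
    proof (intro exI[of _ "e / C"] conjI ballI impI)
      fix g assume g: "g \<in> F" "nF (\<lambda>x. g x - f x) < e / C"
      have "\<bar>L g - L f\<bar> \<le> C * nF (\<lambda>x. g x - f x)"
        using C(2)[OF diff_F[OF g(1) f(1)]] clf_diff[OF L g(1) f(1)] by simp
      also have "\<dots> < e" using g(2) C(1) by (simp add: field_simps)
      finally show "g \<in> L -` S \<inter> F" using e(2)[of "L g"] g(1) by (simp add: dist_real_def)
    qed (use e C in simp)
  qed auto
  then show "L -` S \<inter> space \<mu> \<in> sets \<mu>" by (simp add: space_\<mu> norm_open_in_sets)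
qed

sublocale gaussian_functionals \<mu> "Lambda_all F nF"
proof
  show "(\<lambda>_. 0) \<in> Lambda_all F nF"
    by (auto simp: Lambda_all_def cont_lin_fun_def intro!: exI[of _ 0])
next
  fix u w assume u: "u \<in> Lambda_all F nF" and w: "w \<in> Lambda_all F nF"
  obtain A where A: "0 < A" "\<And>f. f \<in> F \<Longrightarrow> \<bar>u f\<bar> \<le> A * nF f" using clf_bound u by (auto simp: Lambda_all_def)
  obtain B where B: "0 < B" "\<And>f. f \<in> F \<Longrightarrow> \<bar>w f\<bar> \<le> B * nF f" using clf_bound w by (auto simp: Lambda_all_def)
  have "\<bar>u f + w f\<bar> \<le> (A + B) * nF f" if "f \<in> F" for f
    using A(2)[OF that] B(2)[OF that] by (simp add: distrib_right)
  then show "(\<lambda>f. u f + w f) \<in> Lambda_all F nF"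
    using u w unfolding Lambda_all_def cont_lin_fun_def
    by (intro CollectI conjI ballI allI exI[of _ "A + B"]) (auto simp: algebra_simps)
next
  fix c u assume u: "u \<in> Lambda_all F nF"
  obtain A where A: "0 < A" "\<And>f. f \<in> F \<Longrightarrow> \<bar>u f\<bar> \<le> A * nF f" using clf_bound u by (auto simp: Lambda_all_def)
  have "\<bar>c * u f\<bar> \<le> (\<bar>c\<bar> * A) * nF f" if "f \<in> F" for f
    using mult_left_mono[OF A(2)[OF that], of "\<bar>c\<bar>"] by (simp add: abs_mult)
  then show "(\<lambda>f. c * u f) \<in> Lambda_all F nF"
    using u unfolding Lambda_all_def cont_lin_fun_def
    by (intro CollectI conjI ballI allI exI[of _ "\<bar>c\<bar> * A"]) (auto simp: algebra_simps)
next
  fix u assume u: "u \<in> Lambda_all F nF"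
  show "u \<in> borel_measurable \<mu>" using clf_measurable u by (simp add: Lambda_all_def)
  show "(AE f in \<mu>. u f = 0) \<or> (\<exists>\<sigma>>0. distributed \<mu> lborel u (normal_density 0 \<sigma>))"
    using gaussian u by (simp add: zero_mean_gaussian_def Lambda_all_def)
qed

lemma eval_in_Lambda_all: "x \<in> D \<Longrightarrow> (\<lambda>f. f x) \<in> Lambda_all F nF"
  using eval_cont[of x] by (simp add: Lambda_all_def cont_lin_fun_def)

text \<open>Starting with 0 makes the initial error the first term of the decreasing sequence in
  \<open>all_error_arbitrarily_small\<close>.\<close>

lemma dense_sequence:
  obtains s :: "nat \<Rightarrow> fn" where "s 0 = (\<lambda>_. 0)" "\<And>k. s k \<in> F"
    "\<And>f e. f \<in> F \<Longrightarrow> 0 < e \<Longrightarrow> \<exists>k. nF (\<lambda>x. f x - s k x) < e"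
proof -
  obtain S where S: "countable S" "S \<subseteq> F" "\<And>f e. f \<in> F \<Longrightarrow> 0 < e \<Longrightarrow> \<exists>s\<in>S. nF (\<lambda>x. f x - s x) < e"
    using separable by blast
  have ne: "S \<noteq> {}" using S(3)[OF zero_F, of 1] by auto
  define s where "s k = (case k of 0 \<Rightarrow> (\<lambda>_. 0) | Suc k \<Rightarrow> from_nat_into S k)" for k
  show thesis
  proof
    show "s 0 = (\<lambda>_. 0)" by (simp add: s_def)
    show "s k \<in> F" for k
      using zero_F from_nat_into[OF ne] S(2) by (auto simp: s_def split: nat.split)
    fix f e assume "f \<in> F" "0 < (e::real)"
    then obtain t where t: "t \<in> S" "nF (\<lambda>x. f x - t x) < e" using S(3) by blast
    then obtain k where "from_nat_into S k = t" using from_nat_into_surj[OF S(1) t(1)] by blast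
    then show "\<exists>k. nF (\<lambda>x. f x - s k x) < e"
      using t by (intro exI[of _ "Suc k"]) (simp add: s_def)
  qed
qed

lemma dist_measurable:
  assumes s: "s \<in> F"
  shows "Measurable.pred \<mu> (\<lambda>f. nF (\<lambda>x. f x - s x) < e)"
proof -
  have "{f \<in> F. nF (\<lambda>x. f x - s x) < e} \<in> norm_open_sets F nF"
    unfolding norm_open_sets_def
  proof (intro CollectI conjI ballI)
    fix f assume "f \<in> {f \<in> F. nF (\<lambda>x. f x - s x) < e}"
    then have f: "f \<in> F" "nF (\<lambda>x. f x - s x) < e" by auto
    show "\<exists>r>0. \<forall>g\<in>F. nF (\<lambda>x. g x - f x) < r \<longrightarrow> g \<in> {f \<in> F. nF (\<lambda>x. f x - s x) < e}"
      using f nF_diff_triangle[OF _ f(1) s]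
      by (intro exI[of _ "e - nF (\<lambda>x. f x - s x)"]) force
  qed auto
  then have "{f \<in> space \<mu>. nF (\<lambda>x. f x - s x) < e} \<in> sets \<mu>"
    by (simp add: space_\<mu> norm_open_in_sets)
  then show ?thesis by (simp add: pred_def)
qed

text \<open>Joint measurability underlies every use of Fubini below. Replace f by the first dense
  element within 1 / (n + 1): this is a countable gluing of functions measurable in x, and it
  converges pointwise because evaluations are continuous.\<close>

lemma eval_measurable: "(\<lambda>(f, x). f x) \<in> borel_measurable (\<mu> \<Otimes>\<^sub>M R)"
proof -
  obtain s :: "nat \<Rightarrow> fn" where s: "\<And>k. s k \<in> F"
    "\<And>f e. f \<in> F \<Longrightarrow> 0 < e \<Longrightarrow> \<exists>k. nF (\<lambda>x. f x - s k x) < e"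
    by (rule dense_sequence) blast
  define K where "K n f = (LEAST k. nF (\<lambda>x. f x - s k x) < 1 / real (Suc n))" for n f
  have K: "nF (\<lambda>x. f x - s (K n f) x) < 1 / real (Suc n)" if "f \<in> F" for n f
    unfolding K_def by (rule LeastI_ex) (rule s(2)[OF that], simp)
  have [measurable]: "K n \<in> \<mu> \<rightarrow>\<^sub>M count_space UNIV" for n
    unfolding K_def by (intro measurable_Least dist_measurable s(1))
  note [measurable] = F_meas[OF s(1)]
  show ?thesis
  proof (rule borel_measurable_LIMSEQ_real)
    show "(\<lambda>p. s (K n (fst p)) (snd p)) \<in> borel_measurable (\<mu> \<Otimes>\<^sub>M R)" for n
      by (rule measurable_compose_countable[where f = "\<lambda>k p. s k (snd p)" and g = "\<lambda>p. K n (fst p)"]) measurable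
    fix p assume "p \<in> space (\<mu> \<Otimes>\<^sub>M R)"
    then have f: "fst p \<in> F" and x: "snd p \<in> D"
      by (auto simp: space_pair_measure space_\<mu> space_R)
    obtain C where C: "0 < C" "\<And>f. f \<in> F \<Longrightarrow> \<bar>f (snd p)\<bar> \<le> C * nF f"
      using clf_bound[of "\<lambda>f. f (snd p)"] eval_in_Lambda_all[OF x] by (auto simp: Lambda_all_def)
    have "(\<lambda>n. s (K n (fst p)) (snd p)) \<longlonglongrightarrow> fst p (snd p)"
    proof (rule LIM_zero_cancel, rule Lim_null_comparison)
      show "\<forall>\<^sub>F n in sequentially. norm (s (K n (fst p)) (snd p) - fst p (snd p)) \<le> C * inverse (real (Suc n))"
      proof (intro always_eventually allI)
        fix n
        have "\<bar>fst p (snd p) - s (K n (fst p)) (snd p)\<bar> \<le> C * nF (\<lambda>x. fst p x - s (K n (fst p)) x)"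
          using C(2)[OF diff_F[OF f s(1)]] .
        also have "\<dots> \<le> C * inverse (real (Suc n))"
          using K[OF f, of n] C(1) by (intro mult_left_mono) (auto simp: inverse_eq_divide)
        finally show "norm (s (K n (fst p)) (snd p) - fst p (snd p)) \<le> C * inverse (real (Suc n))"
          by (simp add: abs_minus_commute)
      qed
      show "(\<lambda>n. C * inverse (real (Suc n))) \<longlonglongrightarrow> 0"
        by (rule tendsto_mult_right_zero[OF LIMSEQ_inverse_real_of_nat])
    qed
    then show "(\<lambda>n. s (K n (fst p)) (snd p)) \<longlonglongrightarrow> (case p of (f, x) \<Rightarrow> f x)"
      by (simp add: case_prod_beta)
  qed
qed

lemma eval_measurable_G [measurable]:
  "(\<lambda>p. fst p (snd p)) \<in> borel_measurable (\<mu> \<Otimes>\<^sub>M G)"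
  using eval_measurable
  by (simp only: case_prod_beta' measurable_cong_sets[OF sets_pair_measure_cong[OF refl sets_G] refl])

sublocale pair_sigma_finite G \<mu> by unfold_locales

lemma Fubini_G\<mu>:
  assumes "(\<lambda>p. h (fst p) (snd p)) \<in> borel_measurable (\<mu> \<Otimes>\<^sub>M G)"
  shows "(\<integral>\<^sup>+f. \<integral>\<^sup>+x. h f x \<partial>G \<partial>\<mu>) = (\<integral>\<^sup>+x. \<integral>\<^sup>+f. h f x \<partial>\<mu> \<partial>G)"
proof (rule Fubini'[of "\<lambda>x f. h f x"])
  show "(\<lambda>(x, f). h f x) \<in> borel_measurable (G \<Otimes>\<^sub>M \<mu>)"
    using measurable_compose[OF measurable_pair_swap' assms] by (simp add: case_prod_beta)
qed

section \<open>The covariance kernel and its finite trace\<close>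

definition K :: "point \<Rightarrow> point \<Rightarrow> real" where
  "K x y = ip (\<lambda>f. f x) (\<lambda>f. f y)"

lemma K_measurable: "case_prod K \<in> borel_measurable (G \<Otimes>\<^sub>M G)"
proof -
  have m: "(\<lambda>q. (snd q, h (fst q))) \<in> (G \<Otimes>\<^sub>M G) \<Otimes>\<^sub>M \<mu> \<rightarrow>\<^sub>M \<mu> \<Otimes>\<^sub>M G" if "h \<in> G \<Otimes>\<^sub>M G \<rightarrow>\<^sub>M G" for h
    using that by measurable
  have "(\<lambda>q. snd q (fst (fst q)) * snd q (snd (fst q))) \<in> borel_measurable ((G \<Otimes>\<^sub>M G) \<Otimes>\<^sub>M \<mu>)"
    using measurable_compose[OF m[of fst] eval_measurable_G] measurable_compose[OF m[of snd] eval_measurable_G]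
    by (intro borel_measurable_times) auto
  then have "(\<lambda>p. \<integral>f. f (fst p) * f (snd p) \<partial>\<mu>) \<in> borel_measurable (G \<Otimes>\<^sub>M G)"
    by (intro \<mu>.borel_measurable_lebesgue_integral) (simp add: case_prod_beta)
  then show ?thesis unfolding K_def ip_def case_prod_beta' .
qed

lemma L2sq_measurable [measurable]: "L2sq d D \<rho> \<in> borel_measurable \<mu>"
  unfolding L2sq_def[abs_def] by measurable

lemma embedding_pos:
  obtains C where "0 < C" "\<And>f. f \<in> F \<Longrightarrow> L2sq d D \<rho> f \<le> ennreal (C * (nF f)\<^sup>2)"
proof -
  obtain C where C: "\<And>f. f \<in> F \<Longrightarrow> L2sq d D \<rho> f \<le> ennreal (C * (nF f)\<^sup>2)" using embedding by blast
  have "L2sq d D \<rho> f \<le> ennreal ((\<bar>C\<bar> + 1) * (nF f)\<^sup>2)" if "f \<in> F" for f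
    by (rule order_trans[OF C[OF that]]) (intro ennreal_leI mult_right_mono, auto)
  then show ?thesis using that[of "\<bar>C\<bar> + 1"] by simp
qed

lemma L2sq_finite: "f \<in> F \<Longrightarrow> L2sq d D \<rho> f < \<infinity>"
  by (rule embedding_pos) (metis ennreal_less_top infinity_ennreal_def order_le_less_trans)

lemma K_diag: "x \<in> D \<Longrightarrow> ennreal (K x x) = (\<integral>\<^sup>+f. ennreal ((f x)\<^sup>2) \<partial>\<mu>)"
  unfolding K_def ip_self
  by (rule nn_integral_eq_integral[symmetric]) (auto intro: square_integrable eval_in_Lambda_all)

text \<open>The squared L_2 norm is finite at every f, hence at most some n on an event of
  probability above 11 / 12. That one event serves all evaluations:
  \<open>bulk_second_moment\<close> bounds each K(x, x) by twice its part on the event, and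
  integration over x gives at most 2 n.\<close>

lemma K_finite: "(\<integral>\<^sup>+x. ennreal (K x x) \<partial>G) < \<infinity>"
proof -
  define A where "A n = {f \<in> space \<mu>. L2sq d D \<rho> f \<le> ennreal (real n)}" for n :: nat
  have A_sets [measurable]: "A n \<in> sets \<mu>" for n unfolding A_def by measurable
  have "(\<lambda>n. \<mu>.prob (A n)) \<longlonglongrightarrow> \<mu>.prob (\<Union>n. A n)"
  proof (rule \<mu>.finite_Lim_measure_incseq)
    show "incseq A" unfolding A_def incseq_def
      by (auto elim!: order_trans intro!: ennreal_leI)
  qed auto
  moreover have "(\<Union>n. A n) = space \<mu>"
  proof -
    have "\<exists>n. f \<in> A n" if "f \<in> space \<mu>" for f
    proof -
      have "L2sq d D \<rho> f < \<infinity>" using L2sq_finite that by (simp add: space_\<mu>)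
      then obtain n :: nat where "L2sq d D \<rho> f < of_nat n" using ennreal_Ex_less_of_nat[of "L2sq d D \<rho> f"] by auto
      then show ?thesis using that by (auto simp: A_def ennreal_of_nat_eq_real_of_nat intro!: exI[of _ n])
    qed
    then show ?thesis by (auto simp: A_def)
  qed
  ultimately have "(\<lambda>n. \<mu>.prob (A n)) \<longlonglongrightarrow> 1" by (simp add: \<mu>.prob_space)
  from order_tendstoD(1)[OF this, of "11 / 12"] obtain n where n: "11 / 12 < \<mu>.prob (A n)"
    by (auto simp: eventually_sequentially)
  then have small: "\<mu>.prob (space \<mu> - A n) \<le> 1 / 12" by (simp add: \<mu>.prob_compl)
  have "(\<integral>\<^sup>+x. ennreal (K x x) \<partial>G) \<le> (\<integral>\<^sup>+x. 2 * (\<integral>\<^sup>+f. indicator (A n) f * ennreal ((f x)\<^sup>2) \<partial>\<mu>) \<partial>G)"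
  proof (rule nn_integral_mono)
    fix x assume "x \<in> space G"
    then have x: "x \<in> D" by (simp add: space_G)
    note u = eval_in_Lambda_all[OF x]
    have "K x x \<le> 2 * (\<integral>f. indicator (A n) f * (f x)\<^sup>2 \<partial>\<mu>)"
      unfolding K_def ip_self by (rule bulk_second_moment[OF u A_sets small])
    then have "ennreal (K x x) \<le> ennreal (2 * (\<integral>f. indicator (A n) f * (f x)\<^sup>2 \<partial>\<mu>))"
      by (rule ennreal_leI)
    also have "\<dots> = 2 * ennreal (\<integral>f. indicator (A n) f * (f x)\<^sup>2 \<partial>\<mu>)"
      by (simp add: ennreal_mult')
    also have "ennreal (\<integral>f. indicator (A n) f * (f x)\<^sup>2 \<partial>\<mu>)
        = (\<integral>\<^sup>+f. ennreal (indicator (A n) f * (f x)\<^sup>2) \<partial>\<mu>)"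
      using integrable_mult_indicator[OF A_sets square_integrable[OF u]]
      by (intro nn_integral_eq_integral[symmetric]) auto
    also have "\<dots> = (\<integral>\<^sup>+f. indicator (A n) f * ennreal ((f x)\<^sup>2) \<partial>\<mu>)"
      by (intro nn_integral_cong) (simp add: indicator_def)
    finally show "ennreal (K x x) \<le> 2 * (\<integral>\<^sup>+f. indicator (A n) f * ennreal ((f x)\<^sup>2) \<partial>\<mu>)" .
  qed
  also have "\<dots> = 2 * (\<integral>\<^sup>+x. \<integral>\<^sup>+f. indicator (A n) f * ennreal ((f x)\<^sup>2) \<partial>\<mu> \<partial>G)"
  proof (rule nn_integral_cmult)
    have "(\<lambda>p. indicator (A n) (snd p) * ennreal ((snd p (fst p))\<^sup>2)) \<in> borel_measurable (G \<Otimes>\<^sub>M \<mu>)"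
      using measurable_compose[OF measurable_pair_swap' eval_measurable_G] by (simp add: case_prod_beta) measurable
    then show "(\<lambda>x. \<integral>\<^sup>+f. indicator (A n) f * ennreal ((f x)\<^sup>2) \<partial>\<mu>) \<in> borel_measurable G"
      by (intro \<mu>.borel_measurable_nn_integral) (simp add: case_prod_beta)
  qed
  also have "(\<integral>\<^sup>+x. \<integral>\<^sup>+f. indicator (A n) f * ennreal ((f x)\<^sup>2) \<partial>\<mu> \<partial>G)
      = (\<integral>\<^sup>+f. \<integral>\<^sup>+x. indicator (A n) f * ennreal ((f x)\<^sup>2) \<partial>G \<partial>\<mu>)"
    by (rule Fubini_G\<mu>[symmetric]) measurable
  also have "\<dots> \<le> (\<integral>\<^sup>+f. ennreal (real n) \<partial>\<mu>)"
  proof (rule nn_integral_mono)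
    fix f assume f: "f \<in> space \<mu>"
    show "(\<integral>\<^sup>+x. indicator (A n) f * ennreal ((f x)\<^sup>2) \<partial>G) \<le> ennreal (real n)"
      using f by (cases "f \<in> A n") (auto simp: A_def L2sq_def)
  qed
  also have "\<dots> = ennreal (real n)" by (simp add: \<mu>.emeasure_space_1)
  finally have "(\<integral>\<^sup>+x. ennreal (K x x) \<partial>G) \<le> 2 * ennreal (real n)"
    by (meson mult_left_mono order_trans zero_le)
  also have "\<dots> < \<infinity>" by (simp add: ennreal_mult_less_top)
  finally show ?thesis .
qed

lemma initial_error: "(\<integral>\<^sup>+f. L2sq d D \<rho> f \<partial>\<mu>) = (\<integral>\<^sup>+x. ennreal (K x x) \<partial>G)"
proof -
  have "(\<integral>\<^sup>+f. L2sq d D \<rho> f \<partial>\<mu>) = (\<integral>\<^sup>+x. \<integral>\<^sup>+f. ennreal ((f x)\<^sup>2) \<partial>\<mu> \<partial>G)"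
    unfolding L2sq_def by (rule Fubini_G\<mu>) measurable
  also have "\<dots> = (\<integral>\<^sup>+x. ennreal (K x x) \<partial>G)"
    by (intro nn_integral_cong) (simp add: K_diag space_G)
  finally show ?thesis .
qed

lemma K_psd: "psd_on (space G) K"
  unfolding K_def by (rule ip_psd) (simp add: eval_in_Lambda_all space_G)

sublocale sampling G K
  by unfold_locales (rule K_measurable K_psd K_finite)+

section \<open>Function values against an arbitrary algorithm\<close>

lemma algorithm_measurable:
  assumes A: "(Ls, \<phi>) \<in> algorithms d D (Lambda_all F nF) r"
  shows "(\<lambda>p. \<phi> (\<lambda>i\<in>{..<r}. Ls i (fst p)) (snd p)) \<in> borel_measurable (\<mu> \<Otimes>\<^sub>M G)"
proof -
  have Ls: "\<And>i. i < r \<Longrightarrow> Ls i \<in> borel_measurable \<mu>" and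
    \<phi>: "case_prod \<phi> \<in> borel_measurable (PiM {..<r} (\<lambda>_. lborel) \<Otimes>\<^sub>M R)"
    using A by (simp_all add: algorithms_def V_measurable)
  have 1: "(\<lambda>p. \<lambda>i\<in>{..<r}. Ls i (fst p)) \<in> \<mu> \<Otimes>\<^sub>M G \<rightarrow>\<^sub>M PiM {..<r} (\<lambda>_. lborel)"
  proof (rule measurable_restrict)
    fix i assume "i \<in> {..<r}"
    then have "(\<lambda>p. Ls i (fst p)) \<in> borel_measurable (\<mu> \<Otimes>\<^sub>M G)"
      by (intro measurable_compose[OF measurable_fst Ls]) simp
    then show "(\<lambda>p. Ls i (fst p)) \<in> \<mu> \<Otimes>\<^sub>M G \<rightarrow>\<^sub>M lborel" by simp
  qed
  have 2: "snd \<in> \<mu> \<Otimes>\<^sub>M G \<rightarrow>\<^sub>M R"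
    using measurable_snd[of \<mu> G] by (simp only: measurable_cong_sets[OF refl sets_G])
  from measurable_compose[OF measurable_Pair[OF 1 2] \<phi>] show ?thesis by simp
qed

text \<open>Fixing x turns the algorithm into a real function of the data, the form to which
  \<open>linear_is_optimal\<close> applies.\<close>

lemma algorithm_section_measurable:
  assumes A: "(Ls, \<phi>) \<in> algorithms d D \<Lambda> r" and x: "x \<in> D"
  shows "(\<lambda>y. \<phi> y x) \<in> borel_measurable (PiM {..<r} (\<lambda>_. borel))"
proof -
  have \<phi>: "case_prod \<phi> \<in> borel_measurable (PiM {..<r} (\<lambda>_. lborel) \<Otimes>\<^sub>M R)"
    using A by (auto simp: algorithms_def)
  have "(\<lambda>y. (y, x)) \<in> PiM {..<r} (\<lambda>_. lborel) \<rightarrow>\<^sub>M PiM {..<r} (\<lambda>_. lborel) \<Otimes>\<^sub>M R"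
    using x by (intro measurable_Pair2') (simp add: space_R)
  from measurable_compose[OF this \<phi>] have "(\<lambda>y. \<phi> y x) \<in> borel_measurable (PiM {..<r} (\<lambda>_. lborel))"
    by simp
  moreover have eq: "borel_measurable (PiM {..<r} (\<lambda>_. lborel)) = borel_measurable (PiM {..<r} (\<lambda>_. borel :: real measure))"
    by (intro measurable_cong_sets sets_PiM_cong) auto
  ultimately show ?thesis unfolding eq by blast
qed

text \<open>Fubini reduces the error of the given algorithm to pointwise errors
  \<open>\<kappa> x\<close>. Each of them dominates the diagonal of the projected kernel, so
  \<open>good_sample\<close> bounds the prediction error from function values by the integral of
  \<open>\<kappa>\<close>.\<close>

lemma std_error_le:
  assumes A: "(Ls, \<phi>) \<in> algorithms d D (Lambda_all F nF) r" and r: "0 < r" "2 * r \<le> m"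
  shows "avg_err2 d D \<rho> \<mu> (Lambda_std D) m
    \<le> ennreal ((real m + 1) / (real m + 1 - 2 * real r)) * alg_err2 d D \<rho> \<mu> r Ls \<phi>"
proof -
  have Ls: "Ls i \<in> Lambda_all F nF" if "i < r" for i using A that by (auto simp: algorithms_def)
  define \<kappa> where "\<kappa> x = (\<integral>\<^sup>+f. ennreal ((f x - \<phi> (\<lambda>i\<in>{..<r}. Ls i f) x)\<^sup>2) \<partial>\<mu>)" for x
  note [measurable] = algorithm_measurable[OF A]
  have \<kappa>m: "\<kappa> \<in> borel_measurable G"
  proof -
    have "(\<lambda>p. ennreal ((fst p (snd p) - \<phi> (\<lambda>i\<in>{..<r}. Ls i (fst p)) (snd p))\<^sup>2)) \<in> borel_measurable (\<mu> \<Otimes>\<^sub>M G)"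
      by measurable
    from measurable_compose[OF measurable_pair_swap' this] show ?thesis
      unfolding \<kappa>_def by (intro \<mu>.borel_measurable_nn_integral) (simp add: case_prod_beta')
  qed
  have \<kappa>_int: "alg_err2 d D \<rho> \<mu> r Ls \<phi> = (\<integral>\<^sup>+x. \<kappa> x \<partial>G)"
    unfolding alg_err2_def L2sq_def \<kappa>_def by (rule Fubini_G\<mu>) measurable
  obtain c b where
    orth: "\<And>u i. u \<in> Lambda_all F nF \<Longrightarrow> i < r \<Longrightarrow> ip (\<lambda>f. u f - (\<Sum>j<r. c u j * Ls j f)) (Ls i) = 0" and
    res: "\<And>u w. u \<in> Lambda_all F nF \<Longrightarrow> w \<in> Lambda_all F nF \<Longrightarrow>
       ip (\<lambda>f. u f - (\<Sum>j<r. c u j * Ls j f)) (\<lambda>f. w f - (\<Sum>j<r. c w j * Ls j f)) = ip u w - (\<Sum>l<r. b l u * b l w)"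
    using projection[of r Ls] Ls by blast
  define ev :: "point \<Rightarrow> fn \<Rightarrow> real" where "ev x = (\<lambda>f. f x)" for x
  define g where "g x = (\<lambda>f. ev x f - (\<Sum>j<r. c (ev x) j * Ls j f))" for x
  have ev: "ev x \<in> Lambda_all F nF" if "x \<in> D" for x
    unfolding ev_def by (rule eval_in_Lambda_all[OF that])
  have g: "g x \<in> Lambda_all F nF" if "x \<in> D" for x
    unfolding g_def using ev[OF that] Ls by (intro V_diff V_sum) auto
  have psd': "psd_on (space G) (\<lambda>x y. ip (g x) (g y))"
    by (rule ip_psd) (simp add: g space_G)
  have dec: "K x y = ip (g x) (g y) + (\<Sum>l<r. b l (ev x) * b l (ev y))" if "x \<in> space G" "y \<in> space G" for x y
    using res[OF ev ev, of x y] that by (simp add: g_def K_def ev_def space_G)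
  have le\<kappa>: "ennreal (ip (g x) (g x)) \<le> \<kappa> x" if "x \<in> space G" for x
  proof -
    have x: "x \<in> D" using that by (simp add: space_G)
    have "ennreal (ip (g x) (g x)) \<le> (\<integral>\<^sup>+f. ennreal ((ev x f - \<phi> (\<lambda>i\<in>{..<r}. Ls i f) x)\<^sup>2) \<partial>\<mu>)"
      unfolding g_def
      by (rule linear_is_optimal[where \<psi> = "\<lambda>y. \<phi> y x"])
        (auto intro: Ls ev[OF x] orth[OF ev[OF x]] algorithm_section_measurable[OF A x])
    then show ?thesis unfolding \<kappa>_def by (simp only: ev_def)
  qed
  obtain n X B where nX: "n \<le> m" "\<And>i. i < n \<Longrightarrow> X i \<in> space G"
    and err: "(\<integral>\<^sup>+x. ennreal (kriging_err K n X (\<lambda>i. \<Sum>j<n. B i j * K (X j) x) x) \<partial>G)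
       \<le> ennreal ((real m + 1) / (real m + 1 - 2 * real r)) * (\<integral>\<^sup>+x. \<kappa> x \<partial>G)"
    by (rule good_sample[OF psd' dec \<kappa>m le\<kappa> r(2)]) ((assumption | rule that)+)
  have XD: "X i \<in> D" if "i < n" for i using nX(2)[OF that] by (simp add: space_G)
  obtain x0 where x0: "x0 \<in> D" using D_nonempty by blast
  define a where "a x i = (\<Sum>j<n. B i j * K (X j) x)" for x i
  \<comment> \<open>The sample may have fewer than m points; the remaining functionals evaluate at a
    dummy point \<open>x0\<close>, and \<open>\<phi>'\<close> ignores their values.\<close>
  define Ls' where "Ls' i = (\<lambda>f :: fn. f (if i < n then X i else x0))" for i
  define \<phi>' where "\<phi>' y x = (\<Sum>i<n. a x i * y i)" for y :: point and x
  have alg: "(Ls', \<phi>') \<in> algorithms d D (Lambda_std D) m"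
    unfolding algorithms_def
  proof (intro CollectI case_prodI conjI allI impI)
    show "Ls' i \<in> Lambda_std D" for i
      unfolding Ls'_def Lambda_std_def using XD x0 by auto
    have Km: "(\<lambda>x. K (X j) x) \<in> borel_measurable R" if "j < n" for j
    proof -
      have "(\<lambda>x. case_prod K (X j, x)) \<in> borel_measurable G"
        using nX(2)[OF that] by (intro measurable_compose[OF _ K_measurable] measurable_Pair1') auto
      then show ?thesis by (simp only: measurable_cong_sets[OF sets_G refl] case_prod_conv)
    qed
    have am: "(\<lambda>x. a x i) \<in> borel_measurable R" for i
      unfolding a_def by (intro borel_measurable_sum borel_measurable_times borel_measurable_const Km) auto
    have "(\<lambda>p. \<Sum>i<n. a (snd p) i * fst p i) \<in> borel_measurable (PiM {..<m} (\<lambda>_. lborel) \<Otimes>\<^sub>M R)"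
    proof (intro borel_measurable_sum borel_measurable_times)
      fix i assume "i \<in> {..<n}"
      then have i: "i \<in> {..<m}" using nX(1) by auto
      show "(\<lambda>p. a (snd p) i) \<in> borel_measurable (PiM {..<m} (\<lambda>_. lborel) \<Otimes>\<^sub>M R)"
        by (rule measurable_compose[OF measurable_snd am])
      have "(\<lambda>p. fst p i) \<in> PiM {..<m} (\<lambda>_. lborel) \<Otimes>\<^sub>M R \<rightarrow>\<^sub>M lborel"
        by (rule measurable_compose[OF measurable_fst measurable_component_singleton[OF i]])
      then show "(\<lambda>p. fst p i) \<in> borel_measurable (PiM {..<m} (\<lambda>_. lborel) \<Otimes>\<^sub>M R)" by simp
    qed
    then show "case_prod \<phi>' \<in> borel_measurable (PiM {..<m} (\<lambda>_. lborel) \<Otimes>\<^sub>M R)"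
      by (simp add: \<phi>'_def case_prod_beta')
  qed
  have \<phi>'_eq: "\<phi>' (\<lambda>i\<in>{..<m}. Ls' i f) x = (\<Sum>i<n. a x i * f (X i))" for f x
    unfolding \<phi>'_def by (rule sum.cong) (use nX(1) in \<open>auto simp: Ls'_def\<close>)
  have "alg_err2 d D \<rho> \<mu> m Ls' \<phi>' = (\<integral>\<^sup>+x. \<integral>\<^sup>+f. ennreal ((f x - \<phi>' (\<lambda>i\<in>{..<m}. Ls' i f) x)\<^sup>2) \<partial>\<mu> \<partial>G)"
    unfolding alg_err2_def L2sq_def
  proof (rule Fubini_G\<mu>)
    have "algorithms d D (Lambda_std D) m \<subseteq> algorithms d D (Lambda_all F nF) m"
      using eval_in_Lambda_all by (fastforce simp: algorithms_def Lambda_std_def)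
    then have [measurable]: "(\<lambda>p. \<phi>' (\<lambda>i\<in>{..<m}. Ls' i (fst p)) (snd p)) \<in> borel_measurable (\<mu> \<Otimes>\<^sub>M G)"
      using alg by (intro algorithm_measurable) auto
    show "(\<lambda>p. ennreal ((fst p (snd p) - \<phi>' (\<lambda>i\<in>{..<m}. Ls' i (fst p)) (snd p))\<^sup>2)) \<in> borel_measurable (\<mu> \<Otimes>\<^sub>M G)"
      by measurable
  qed
  also have "\<dots> = (\<integral>\<^sup>+x. ennreal (kriging_err K n X (a x) x) \<partial>G)"
  proof (rule nn_integral_cong)
    fix x assume "x \<in> space G"
    then have x: "x \<in> D" by (simp add: space_G)
    show "(\<integral>\<^sup>+f. ennreal ((f x - \<phi>' (\<lambda>i\<in>{..<m}. Ls' i f) x)\<^sup>2) \<partial>\<mu>) = ennreal (kriging_err K n X (a x) x)"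
      using kriging_err_ip[of ev x n X "a x"] ev[OF x] ev[OF XD]
      by (simp add: \<phi>'_eq ev_def K_def[abs_def])
  qed
  also have "\<dots> \<le> ennreal ((real m + 1) / (real m + 1 - 2 * real r)) * alg_err2 d D \<rho> \<mu> r Ls \<phi>"
    using err by (simp add: a_def[abs_def] \<kappa>_int)
  finally have "alg_err2 d D \<rho> \<mu> m Ls' \<phi>' \<le> \<dots>" .
  moreover have "avg_err2 d D \<rho> \<mu> (Lambda_std D) m \<le> alg_err2 d D \<rho> \<mu> m Ls' \<phi>'"
    using alg r unfolding avg_err2_def by (auto intro!: INF_lower2)
  ultimately show ?thesis by (rule order_trans[rotated])
qed

section \<open>Arbitrary functionals reach every positive error level\<close>

lemma F_square_integrable:
  assumes f: "f \<in> F"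
  shows "integrable G (\<lambda>x. (f x)\<^sup>2)"
proof (rule integrableI_bounded)
  note [measurable] = measurable_G[OF F_meas[OF f]]
  show "(\<lambda>x. (f x)\<^sup>2) \<in> borel_measurable G" by measurable
  show "(\<integral>\<^sup>+x. ennreal (norm ((f x)\<^sup>2)) \<partial>G) < \<infinity>"
    using L2sq_finite[OF f] by (simp add: L2sq_def)
qed

definition inner_G :: "fn \<Rightarrow> fn \<Rightarrow> real" where
  "inner_G f s = (\<integral>x. f x * s x \<partial>G)"

lemma F_product_integrable:
  assumes f: "f \<in> F" and s: "s \<in> F"
  shows "integrable G (\<lambda>x. f x * s x)"
proof -
  have "integrable G (\<lambda>x. ((f x + s x)\<^sup>2 - (f x)\<^sup>2 - (s x)\<^sup>2) / 2)"
    using F_square_integrable[OF f] F_square_integrable[OF s] F_square_integrable[OF add_F[OF f s]]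
    by (intro integrable_divide Bochner_Integration.integrable_diff) auto
  then show ?thesis by (simp add: power2_sum)
qed

lemma inner_G_square:
  assumes f: "f \<in> F" and s: "s \<in> F"
  shows "inner_G (\<lambda>x. f x + t * s x) (\<lambda>x. f x + t * s x) = inner_G f f + 2 * t * inner_G f s + t\<^sup>2 * inner_G s s"
proof -
  have "(\<lambda>x. (f x + t * s x) * (f x + t * s x)) = (\<lambda>x. f x * f x + (2 * t) * (f x * s x) + t\<^sup>2 * (s x * s x))"
    by (rule ext) (simp add: algebra_simps power2_eq_square)
  then show ?thesis
    unfolding inner_G_def using F_product_integrable[OF f f] F_product_integrable[OF f s] F_product_integrable[OF s s]
    by simp
qed

lemma L2sq_inner_G: "f \<in> F \<Longrightarrow> L2sq d D \<rho> f = ennreal (inner_G f f)"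
  unfolding L2sq_def inner_G_def power2_eq_square
  by (rule nn_integral_eq_integral) (auto intro: F_product_integrable)

lemma inner_G_nonneg: "0 \<le> inner_G f f"
  unfolding inner_G_def by simp

text \<open>Cauchy-Schwarz in L_2 followed by the continuous embedding bounds the functional by the
  norm of F.\<close>

lemma inner_G_in_Lambda_all:
  assumes s: "s \<in> F"
  shows "(\<lambda>f. inner_G f s) \<in> Lambda_all F nF"
proof -
  obtain C where C: "0 < C" "\<And>f. f \<in> F \<Longrightarrow> L2sq d D \<rho> f \<le> ennreal (C * (nF f)\<^sup>2)"
    using embedding_pos by blast
  have "\<bar>inner_G f s\<bar> \<le> sqrt (C * inner_G s s) * nF f" if f: "f \<in> F" for f
  proof (rule power2_le_imp_le)
    have "(inner_G f s)\<^sup>2 \<le> inner_G f f * inner_G s s"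
    proof (rule discriminant_le)
      show "0 \<le> inner_G f f + 2 * t * inner_G f s + t\<^sup>2 * inner_G s s" for t
        unfolding inner_G_square[OF f s, symmetric] by (rule inner_G_nonneg)
    qed (rule inner_G_nonneg)
    also have "inner_G f f \<le> C * (nF f)\<^sup>2"
      using C(2)[OF f] C(1) unfolding L2sq_inner_G[OF f] by (subst (asm) ennreal_le_iff) auto
    then have "inner_G f f * inner_G s s \<le> C * (nF f)\<^sup>2 * inner_G s s"
      by (rule mult_right_mono) (rule inner_G_nonneg)
    also have "\<dots> = (sqrt (C * inner_G s s) * nF f)\<^sup>2"
      using C(1) inner_G_nonneg[of s] by (simp add: power_mult_distrib)
    finally show "\<bar>inner_G f s\<bar>\<^sup>2 \<le> (sqrt (C * inner_G s s) * nF f)\<^sup>2" by simp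
    show "0 \<le> sqrt (C * inner_G s s) * nF f"
      using C(1) inner_G_nonneg[of s] nF_nonneg[OF f] by simp
  qed
  moreover have "inner_G (\<lambda>x. f x + g x) s = inner_G f s + inner_G g s" if "f \<in> F" "g \<in> F" for f g
    using F_product_integrable[OF that(1) s] F_product_integrable[OF that(2) s]
    by (simp add: inner_G_def distrib_right)
  moreover have "inner_G (\<lambda>x. c * f x) s = c * inner_G f s" for c f
    by (simp add: inner_G_def mult.assoc)
  ultimately show ?thesis unfolding Lambda_all_def cont_lin_fun_def by blast
qed

text \<open>The element of s_0, ..., s_n closest to f minimizes |s_k|^2 - 2 <f, s_k>, so it can be selected from
  the values of n + 1 functionals.\<close>

lemma all_error_arbitrarily_small:
  assumes \<tau>: "0 < \<tau>"
  shows "\<exists>n. avg_err2 d D \<rho> \<mu> (Lambda_all F nF) n \<le> \<tau>"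
proof -
  obtain s :: "nat \<Rightarrow> fn" where s0: "s 0 = (\<lambda>_. 0)" and s: "\<And>k. s k \<in> F"
    and dense: "\<And>f e. f \<in> F \<Longrightarrow> 0 < e \<Longrightarrow> \<exists>k. nF (\<lambda>x. f x - s k x) < e"
    by (rule dense_sequence) blast
  define c where "c k = inner_G (s k) (s k)" for k
  define good where "good n y k \<longleftrightarrow> k \<le> n \<and> (\<forall>j\<in>{..n}. c k - 2 * y k \<le> c j - 2 * y j)" for n k and y :: point
  \<comment> \<open>Breaking ties by the least index makes the selection measurable in the
    data.\<close>
  define sel where "sel n y = (LEAST k. good n y k)" for n y
  have sel: "good n y (sel n y)" for n y
    unfolding sel_def
  proof (rule LeastI_ex)
    have "\<exists>k\<in>{..n}. \<forall>j\<in>{..n}. c k - 2 * y k \<le> c j - 2 * y j"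
      using ex_min_if_finite[of "(\<lambda>k. c k - 2 * y k) ` {..n}"] by (auto simp: not_less)
    then show "\<exists>k. good n y k" by (auto simp: good_def)
  qed
  define u where "u n f = (INF k\<in>{..n}. L2sq d D \<rho> (\<lambda>x. f x - s k x))" for n f
  have dist: "L2sq d D \<rho> (\<lambda>x. f x - s k x) = ennreal (inner_G f f + (c k - 2 * inner_G f (s k)))" if f: "f \<in> F" for f k
  proof -
    have "inner_G (\<lambda>x. f x - s k x) (\<lambda>x. f x - s k x) = inner_G f f + (c k - 2 * inner_G f (s k))"
      using inner_G_square[OF f s, of "-1" k] by (simp add: c_def)
    then show ?thesis by (simp only: L2sq_inner_G[OF diff_F[OF f s]])
  qed
  have dist_meas [measurable]: "(\<lambda>f. L2sq d D \<rho> (\<lambda>x. f x - s k x)) \<in> borel_measurable \<mu>" for k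
  proof -
    note [measurable] = measurable_G[OF F_meas[OF s]]
    show ?thesis unfolding L2sq_def by measurable
  qed
  have alg: "avg_err2 d D \<rho> \<mu> (Lambda_all F nF) (Suc n) \<le> (\<integral>\<^sup>+f. u n f \<partial>\<mu>)" for n
  proof -
    define Ls where "Ls k = (\<lambda>f. inner_G f (s k))" for k
    define \<phi> where "\<phi> y x = s (sel n y) x" for y x
    have A: "(Ls, \<phi>) \<in> algorithms d D (Lambda_all F nF) (Suc n)"
      unfolding algorithms_def
    proof (intro CollectI case_prodI conjI allI impI)
      show "Ls i \<in> Lambda_all F nF" for i unfolding Ls_def by (rule inner_G_in_Lambda_all[OF s])
      have comp: "(\<lambda>y. y k) \<in> borel_measurable (PiM {..<Suc n} (\<lambda>_. lborel))" if "k \<le> n" for k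
        using measurable_component_singleton[of k "{..<Suc n}" "\<lambda>_. lborel :: real measure"] that by simp
      have "Measurable.pred (PiM {..<Suc n} (\<lambda>_. lborel)) (\<lambda>y. good n y k)" for k
      proof (cases "k \<le> n")
        case True
        have "Measurable.pred (PiM {..<Suc n} (\<lambda>_. lborel)) (\<lambda>y. c k - 2 * y k \<le> c j - 2 * y j)" if "j \<le> n" for j
          unfolding pred_def
          by (intro borel_measurable_le borel_measurable_diff borel_measurable_times borel_measurable_const
              comp True that)
        then have "Measurable.pred (PiM {..<Suc n} (\<lambda>_. lborel)) (\<lambda>y. \<forall>j\<in>{..n}. c k - 2 * y k \<le> c j - 2 * y j)"
          by (intro pred_intros_finite) auto
        then show ?thesis using True by (simp add: good_def)
      next
        case False
        then show ?thesis by (simp add: good_def)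
      qed
      then have selm: "sel n \<in> PiM {..<Suc n} (\<lambda>_. lborel) \<rightarrow>\<^sub>M count_space UNIV"
        unfolding sel_def[abs_def] by (rule measurable_Least)
      have "(\<lambda>p. s (sel n (fst p)) (snd p)) \<in> borel_measurable (PiM {..<Suc n} (\<lambda>_. lborel) \<Otimes>\<^sub>M R)"
      proof (rule measurable_compose_countable[where f = "\<lambda>k p. s k (snd p)" and g = "\<lambda>p. sel n (fst p)"])
        show "(\<lambda>p. s k (snd p)) \<in> borel_measurable (PiM {..<Suc n} (\<lambda>_. lborel) \<Otimes>\<^sub>M R)" for k
          by (rule measurable_compose[OF measurable_snd F_meas[OF s]])
        show "(\<lambda>p. sel n (fst p)) \<in> PiM {..<Suc n} (\<lambda>_. lborel) \<Otimes>\<^sub>M R \<rightarrow>\<^sub>M count_space UNIV"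
          by (rule measurable_compose[OF measurable_fst selm])
      qed
      then show "case_prod \<phi> \<in> borel_measurable (PiM {..<Suc n} (\<lambda>_. lborel) \<Otimes>\<^sub>M R)"
        by (simp add: \<phi>_def case_prod_beta')
    qed
    have "avg_err2 d D \<rho> \<mu> (Lambda_all F nF) (Suc n) \<le> alg_err2 d D \<rho> \<mu> (Suc n) Ls \<phi>"
      using A unfolding avg_err2_def by (auto intro!: INF_lower2)
    also have "\<dots> \<le> (\<integral>\<^sup>+f. u n f \<partial>\<mu>)"
      unfolding alg_err2_def
    proof (rule nn_integral_mono)
      fix f assume "f \<in> space \<mu>"
      then have f: "f \<in> F" by (simp add: space_\<mu>)
      define y where "y = (\<lambda>i\<in>{..<Suc n}. Ls i f)"
      have y: "y k = inner_G f (s k)" if "k \<le> n" for k using that by (simp add: y_def Ls_def)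
      have g: "sel n y \<le> n" "\<And>j. j \<le> n \<Longrightarrow> c (sel n y) - 2 * y (sel n y) \<le> c j - 2 * y j"
        using sel[of n y] by (auto simp: good_def)
      show "L2sq d D \<rho> (\<lambda>x. f x - \<phi> y x) \<le> u n f"
        unfolding u_def \<phi>_def
      proof (rule INF_greatest)
        fix j assume "j \<in> {..n}"
        then have j: "j \<le> n" by simp
        show "L2sq d D \<rho> (\<lambda>x. f x - s (sel n y) x) \<le> L2sq d D \<rho> (\<lambda>x. f x - s j x)"
          unfolding dist[OF f] using g(2)[OF j] y[OF j] y[OF g(1)] by (intro ennreal_leI) simp
      qed
    qed
    finally show ?thesis .
  qed
  have [measurable]: "u n \<in> borel_measurable \<mu>" for n
    unfolding u_def by measurable
  \<comment> \<open>Monotone convergence from above needs one finite integral; the choice of s_0 as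
    0 makes it the initial error.\<close>
  have "(\<integral>\<^sup>+f. (INF n. u n f) \<partial>\<mu>) = (INF n. \<integral>\<^sup>+f. u n f \<partial>\<mu>)"
  proof (rule nn_integral_monotone_convergence_INF_decseq)
    show "decseq u"
      by (rule antimonoI, rule le_funI) (auto simp: u_def intro!: INF_superset_mono)
    have "(\<integral>\<^sup>+f. u 0 f \<partial>\<mu>) = (\<integral>\<^sup>+f. L2sq d D \<rho> f \<partial>\<mu>)"
      by (simp add: u_def s0)
    then show "(\<integral>\<^sup>+f. u 0 f \<partial>\<mu>) < \<infinity>"
      using initial_error K_finite by simp
  qed measurable
  moreover have "(\<integral>\<^sup>+f. (INF n. u n f) \<partial>\<mu>) = (\<integral>\<^sup>+f. 0 \<partial>\<mu>)"
  proof (rule nn_integral_cong)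
    fix f assume "f \<in> space \<mu>"
    then have f: "f \<in> F" by (simp add: space_\<mu>)
    obtain C where C: "0 < C" "\<And>f. f \<in> F \<Longrightarrow> L2sq d D \<rho> f \<le> ennreal (C * (nF f)\<^sup>2)"
      using embedding_pos by blast
    have "(INF n. u n f) \<le> 0 + ennreal e" if e: "0 < e" for e
    proof -
      \<comment> \<open>An F-distance below sqrt(e / C) becomes a squared G-distance of at most e
        under the embedding constant C.\<close>
      obtain k where k: "nF (\<lambda>x. f x - s k x) < sqrt (e / C)"
        using dense[OF f, of "sqrt (e / C)"] e C(1) by auto
      then have "(nF (\<lambda>x. f x - s k x))\<^sup>2 \<le> (sqrt (e / C))\<^sup>2"
        using nF_nonneg[OF diff_F[OF f s]] by (intro power_mono) auto
      then have "C * (nF (\<lambda>x. f x - s k x))\<^sup>2 \<le> e"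
        using e C(1) by (simp add: field_simps)
      then have "L2sq d D \<rho> (\<lambda>x. f x - s k x) \<le> ennreal e"
        using C(2)[OF diff_F[OF f s], of k] by (meson ennreal_leI order_trans)
      moreover have "(INF n. u n f) \<le> u k f" by (rule INF_lower) simp
      moreover have "u k f \<le> L2sq d D \<rho> (\<lambda>x. f x - s k x)" unfolding u_def by (rule INF_lower) simp
      ultimately show ?thesis by simp
    qed
    then have "(INF n. u n f) \<le> 0" by (rule ennreal_le_epsilon)
    then show "(INF n. u n f) = 0" by simp
  qed
  ultimately have "(INF n. \<integral>\<^sup>+f. u n f \<partial>\<mu>) < \<tau>" using \<tau> by simp
  then obtain n where "(\<integral>\<^sup>+f. u n f \<partial>\<mu>) < \<tau>" by (auto simp: INF_less_iff)
  then show ?thesis using alg[of n] by (intro exI[of _ "Suc n"]) (auto intro: order_trans)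
qed

text \<open>With m = k r the factor in \<open>std_error_le\<close> is (k r + 1) / (k r + 1 - 2 r).
  The condition on k says k / (k - 2) <= A^2 and keeps this factor below A^2, so a tolerance smaller
  by A for arbitrary functionals pays for it.\<close>

lemma info_compl_std_le:
  assumes A: "0 < A" and k: "3 \<le> k" "real k \<le> A\<^sup>2 * (real k - 2)" and \<epsilon>: "0 < \<epsilon>"
  shows "info_compl c \<epsilon> d D \<rho> \<mu> (Lambda_std D) \<le> k * info_compl c (\<epsilon> / A) d D \<rho> \<mu> (Lambda_all F nF)"
proof -
  define cri where "cri = CRI2 c d D \<rho> \<mu>"
  define r where "r = info_compl c (\<epsilon> / A) d D \<rho> \<mu> (Lambda_all F nF)"
  have A1: "1 \<le> A\<^sup>2"
  proof (rule ccontr)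
    assume "\<not> 1 \<le> A\<^sup>2"
    then have "A\<^sup>2 * (real k - 2) \<le> 1 * (real k - 2)" using k(1) by (intro mult_right_mono) auto
    with k(2) have "real k \<le> 1 * (real k - 2)" by (rule order_trans)
    then show False by simp
  qed
  \<comment> \<open>Without such an n the LEAST defining r would carry no information.\<close>
  have "\<exists>n. avg_err2 d D \<rho> \<mu> (Lambda_all F nF) n \<le> ennreal ((\<epsilon> / A)\<^sup>2) * cri"
  proof (cases "cri = 0")
    case True
    \<comment> \<open>The criterion vanishes only under NOR with initial error 0, and then n = 0
      qualifies.\<close>
    then have "c = NOR" by (cases c) (auto simp: cri_def CRI2_def)
    then have "avg_err2 d D \<rho> \<mu> (Lambda_all F nF) 0 = 0"
      using True by (simp add: cri_def CRI2_def avg_err2_def)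
    then show ?thesis by (intro exI[of _ 0]) simp
  next
    case False
    then have "0 < ennreal ((\<epsilon> / A)\<^sup>2) * cri"
      using A \<epsilon> by (simp add: ennreal_zero_less_mult_iff zero_less_iff_neq_zero)
    then show ?thesis by (rule all_error_arbitrarily_small)
  qed
  then have r: "avg_err2 d D \<rho> \<mu> (Lambda_all F nF) r \<le> ennreal ((\<epsilon> / A)\<^sup>2) * cri"
    unfolding r_def info_compl_def cri_def by (rule LeastI_ex)
  \<comment> \<open>The factor stands on the left so that the infimum on the right can be bounded
    algorithm by algorithm.\<close>
  have "ennreal (1 / A\<^sup>2) * avg_err2 d D \<rho> \<mu> (Lambda_std D) (k * r) \<le> avg_err2 d D \<rho> \<mu> (Lambda_all F nF) r"
  proof (cases "r = 0")
    case True
    \<comment> \<open>For r = 0 also k r = 0, and both classes use the zero algorithm.\<close>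
    have "ennreal (1 / A\<^sup>2) * avg_err2 d D \<rho> \<mu> (Lambda_std D) 0 \<le> 1 * avg_err2 d D \<rho> \<mu> (Lambda_std D) 0"
      using A1 A by (intro mult_right_mono) (auto simp: ennreal_le_1)
    also have "\<dots> = avg_err2 d D \<rho> \<mu> (Lambda_all F nF) 0" by (simp add: avg_err2_def)
    finally show ?thesis using True by simp
  next
    case False
    have "ennreal (1 / A\<^sup>2) * avg_err2 d D \<rho> \<mu> (Lambda_std D) (k * r) \<le> alg_err2 d D \<rho> \<mu> r Ls \<phi>"
      if alg: "(Ls, \<phi>) \<in> algorithms d D (Lambda_all F nF) r" for Ls \<phi>
    proof -
      define q where "q = (real (k * r) + 1) / (real (k * r) + 1 - 2 * real r)"
      have kr: "2 * real r + real r \<le> real k * real r"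
        using mult_right_mono[of 3 "real k" "real r"] k(1) by simp
      have "real k * real r \<le> A\<^sup>2 * (real k - 2) * real r"
        using k(2) by (rule mult_right_mono) simp
      \<comment> \<open>The additional 1 on both sides is harmless because A^2 is at least
        1.\<close>
      then have "real (k * r) + 1 \<le> A\<^sup>2 * (real (k * r) + 1 - 2 * real r)"
        using A1 by (simp add: algebra_simps)
      then have q: "q \<le> A\<^sup>2" unfolding q_def using kr by (subst pos_divide_le_eq) auto
      have "2 * r \<le> k * r" using k(1) by simp
      from std_error_le[OF alg _ this] False
      have "avg_err2 d D \<rho> \<mu> (Lambda_std D) (k * r) \<le> ennreal q * alg_err2 d D \<rho> \<mu> r Ls \<phi>"
        by (simp add: q_def)
      also have "\<dots> \<le> ennreal (A\<^sup>2) * alg_err2 d D \<rho> \<mu> r Ls \<phi>"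
        using q by (intro mult_right_mono ennreal_leI) auto
      finally have "ennreal (1 / A\<^sup>2) * avg_err2 d D \<rho> \<mu> (Lambda_std D) (k * r)
          \<le> ennreal (1 / A\<^sup>2) * (ennreal (A\<^sup>2) * alg_err2 d D \<rho> \<mu> r Ls \<phi>)"
        by (rule mult_left_mono) simp
      also have "\<dots> = alg_err2 d D \<rho> \<mu> r Ls \<phi>"
        using A by (simp add: mult.assoc[symmetric] ennreal_mult[symmetric])
      finally show ?thesis .
    qed
    then show ?thesis
      using False unfolding avg_err2_def[of d D \<rho> \<mu> "Lambda_all F nF" r] by (auto intro!: INF_greatest)
  qed
  from order_trans[OF this r]
  have "ennreal (A\<^sup>2) * (ennreal (1 / A\<^sup>2) * avg_err2 d D \<rho> \<mu> (Lambda_std D) (k * r)) \<le> ennreal (A\<^sup>2) * (ennreal ((\<epsilon> / A)\<^sup>2) * cri)"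
    by (rule mult_left_mono) simp
  moreover have "ennreal (A\<^sup>2) * (ennreal (1 / A\<^sup>2) * e) = e" for e
    using A by (simp add: mult.assoc[symmetric] ennreal_mult[symmetric])
  moreover have "ennreal (A\<^sup>2) * (ennreal ((\<epsilon> / A)\<^sup>2) * cri) = ennreal (\<epsilon>\<^sup>2) * cri"
    using A by (simp add: mult.assoc[symmetric] ennreal_mult[symmetric] power_divide)
  ultimately have "avg_err2 d D \<rho> \<mu> (Lambda_std D) (k * r) \<le> ennreal (\<epsilon>\<^sup>2) * cri" by simp
  then have "info_compl c \<epsilon> d D \<rho> \<mu> (Lambda_std D) \<le> k * r"
    unfolding info_compl_def[of c \<epsilon>] cri_def by (rule Least_le)
  then show ?thesis by (simp add: r_def)
qed

lemma info_compl_std_le_powr: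
  assumes A: "0 < A" and k: "3 \<le> k" "real k \<le> A\<^sup>2 * (real k - 2)" and \<epsilon>: "0 < \<epsilon>" and \<omega>: "0 < \<omega>"
  shows "real (info_compl c \<epsilon> d D \<rho> \<mu> (Lambda_std D))
    \<le> real k * (real (info_compl c (\<epsilon> / A) d D \<rho> \<mu> (Lambda_all F nF)) + 1) powr (1 + \<omega>)"
proof -
  define r where "r = info_compl c (\<epsilon> / A) d D \<rho> \<mu> (Lambda_all F nF)"
  have "real (info_compl c \<epsilon> d D \<rho> \<mu> (Lambda_std D)) \<le> real (k * r)"
    using info_compl_std_le[OF A k \<epsilon>, of c] unfolding r_def by (simp only: of_nat_le_iff)
  also have "\<dots> \<le> real k * (real r + 1) powr 1"
    by (simp add: mult_left_mono)
  also have "\<dots> \<le> real k * (real r + 1) powr (1 + \<omega>)"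
    using \<omega> by (intro mult_left_mono powr_mono) auto
  finally show ?thesis by (simp add: r_def)
qed

end

text \<open>A value A above 1 is what admits a finite k with k <= A^2 (k - 2).\<close>

lemma A_delta_gt_1:
  assumes "0 < \<delta>" "\<delta> < 1"
  shows "1 < A_delta \<delta>"
proof -
  have "1 < sqrt (1 + 1 / (12 * ln (1 / \<delta>)))" using assms by simp
  moreover have "1 < 1 / sqrt (1 - \<delta>)" using assms by simp
  ultimately show ?thesis unfolding A_delta_def by (rule less_1_mult)
qed

theorem theorem2p2:
  fixes c :: criterion
  shows
  "(\<forall>\<omega>>0. \<exists>C>0. \<forall>d D \<rho> F nF \<mu>. avg_setting d D \<rho> F nF \<mu> \<longrightarrow>
      (\<forall>\<epsilon>. 0 < \<epsilon> \<and> \<epsilon> < 1 \<longrightarrow>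
        real (info_compl c \<epsilon> d D \<rho> \<mu> (Lambda_std D))
          \<le> C * (real (info_compl c (\<epsilon> / 4) d D \<rho> \<mu> (Lambda_all F nF)) + 1) powr (1 + \<omega>)))
   \<and>
   (\<exists>\<omega>0>0. \<exists>\<delta>0>0. \<forall>\<omega> \<delta>. 0 < \<omega> \<and> \<omega> < \<omega>0 \<and> 0 < \<delta> \<and> \<delta> < \<delta>0 \<longrightarrow>
      (\<exists>C>0. \<forall>d D \<rho> F nF \<mu>. avg_setting d D \<rho> F nF \<mu> \<longrightarrow>
        (\<forall>\<epsilon>. 0 < \<epsilon> \<and> \<epsilon> < 1 \<longrightarrow>
          real (info_compl c \<epsilon> d D \<rho> \<mu> (Lambda_std D))
            \<le> C * (real (info_compl c (\<epsilon> / A_delta \<delta>) d D \<rho> \<mu> (Lambda_all F nF)) + 1)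
                  powr (1 + \<omega>))))"
proof (intro conjI allI impI)
  fix \<omega> :: real assume \<omega>: "0 < \<omega>"
  show "\<exists>C>0. \<forall>d D \<rho> F nF \<mu>. avg_setting d D \<rho> F nF \<mu> \<longrightarrow>
      (\<forall>\<epsilon>. 0 < \<epsilon> \<and> \<epsilon> < 1 \<longrightarrow>
        real (info_compl c \<epsilon> d D \<rho> \<mu> (Lambda_std D))
          \<le> C * (real (info_compl c (\<epsilon> / 4) d D \<rho> \<mu> (Lambda_all F nF)) + 1) powr (1 + \<omega>))"
  \<comment> \<open>With A = 4 the choice k = 3 satisfies 3 <= 16 (3 - 2).\<close>
  proof (intro exI[of _ "real 3"] conjI allI impI)
    fix d D \<rho> F nF \<mu> \<epsilon> assume "avg_setting d D \<rho> F nF \<mu>" and \<epsilon>: "0 < \<epsilon> \<and> \<epsilon> < (1::real)"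
    then interpret average_case_setting d D \<rho> F nF \<mu> by unfold_locales
    show "real (info_compl c \<epsilon> d D \<rho> \<mu> (Lambda_std D))
          \<le> real 3 * (real (info_compl c (\<epsilon> / 4) d D \<rho> \<mu> (Lambda_all F nF)) + 1) powr (1 + \<omega>)"
      by (rule info_compl_std_le_powr) (use \<epsilon> \<omega> in auto)
  qed simp
next
  show "\<exists>\<omega>0>0. \<exists>\<delta>0>0. \<forall>\<omega> \<delta>. 0 < \<omega> \<and> \<omega> < \<omega>0 \<and> 0 < \<delta> \<and> \<delta> < \<delta>0 \<longrightarrow>
      (\<exists>C>0. \<forall>d D \<rho> F nF \<mu>. avg_setting d D \<rho> F nF \<mu> \<longrightarrow>
        (\<forall>\<epsilon>. 0 < \<epsilon> \<and> \<epsilon> < 1 \<longrightarrow>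
          real (info_compl c \<epsilon> d D \<rho> \<mu> (Lambda_std D))
            \<le> C * (real (info_compl c (\<epsilon> / A_delta \<delta>) d D \<rho> \<mu> (Lambda_all F nF)) + 1)
                  powr (1 + \<omega>)))"
  proof -
    have *: "\<forall>\<omega> \<delta>. 0 < \<omega> \<and> \<omega> < 1 \<and> 0 < \<delta> \<and> \<delta> < 1 \<longrightarrow>
      (\<exists>C>0. \<forall>d D \<rho> F nF \<mu>. avg_setting d D \<rho> F nF \<mu> \<longrightarrow>
        (\<forall>\<epsilon>. 0 < \<epsilon> \<and> \<epsilon> < 1 \<longrightarrow>
          real (info_compl c \<epsilon> d D \<rho> \<mu> (Lambda_std D))
            \<le> C * (real (info_compl c (\<epsilon> / A_delta \<delta>) d D \<rho> \<mu> (Lambda_all F nF)) + 1)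
                  powr (1 + \<omega>)))"
    proof (intro allI impI)
      fix \<omega> \<delta> :: real assume \<omega>\<delta>: "0 < \<omega> \<and> \<omega> < 1 \<and> 0 < \<delta> \<and> \<delta> < 1"
      define A where "A = A_delta \<delta>"
      have A: "1 < A" using A_delta_gt_1 \<omega>\<delta> by (simp add: A_def)
      then have A2: "0 < A\<^sup>2 - 1" by simp
      \<comment> \<open>Solving k <= A^2 (k - 2) for k gives k >= 2 A^2 / (A^2 - 1). This grows
        without bound as A approaches 1 but depends on \<open>\<delta>\<close> alone.\<close>
      define k where "k = max 3 (nat \<lceil>2 * A\<^sup>2 / (A\<^sup>2 - 1)\<rceil>)"
      have k3: "3 \<le> k" by (simp add: k_def)
      have "2 * A\<^sup>2 / (A\<^sup>2 - 1) \<le> real k" unfolding k_def by linarith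
      then have "real k \<le> A\<^sup>2 * (real k - 2)" using A2 by (simp add: pos_divide_le_eq algebra_simps)
      note k = k3 this
      show "\<exists>C>0. \<forall>d D \<rho> F nF \<mu>. avg_setting d D \<rho> F nF \<mu> \<longrightarrow>
          (\<forall>\<epsilon>. 0 < \<epsilon> \<and> \<epsilon> < 1 \<longrightarrow>
            real (info_compl c \<epsilon> d D \<rho> \<mu> (Lambda_std D))
              \<le> C * (real (info_compl c (\<epsilon> / A_delta \<delta>) d D \<rho> \<mu> (Lambda_all F nF)) + 1)
                    powr (1 + \<omega>))"
      proof (intro exI[of _ "real k"] conjI allI impI)
        fix d D \<rho> F nF \<mu> \<epsilon> assume "avg_setting d D \<rho> F nF \<mu>" and \<epsilon>: "0 < \<epsilon> \<and> \<epsilon> < (1::real)"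
        then interpret average_case_setting d D \<rho> F nF \<mu> by unfold_locales
        show "real (info_compl c \<epsilon> d D \<rho> \<mu> (Lambda_std D))
            \<le> real k * (real (info_compl c (\<epsilon> / A_delta \<delta>) d D \<rho> \<mu> (Lambda_all F nF)) + 1) powr (1 + \<omega>)"
          unfolding A_def[symmetric] by (rule info_compl_std_le_powr[OF _ k]) (use \<epsilon> \<omega>\<delta> A in auto)
      qed (use k3 in simp)
    qed
    \<comment> \<open>Both thresholds are taken to be 1; \<open>A_delta_gt_1\<close> covers every
      positive \<open>\<delta>\<close> below 1.\<close>
    show ?thesis by (intro exI[of _ "1 :: real"] conjI *) simp_all
  qed
qed

end
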